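(* Let $1<p<\infty$. Let $\Omega\subset\mathbb R^n$ ($n\ge2$) be a bounded Hölder-$\alpha$ domain for some $0<\alpha\le1$, let $d(x)$ denote the distance from $x\in\Omega$ to $\partial\Omega$, and let $\beta\in\mathbb R$ with $\beta p>-\alpha$. Then there is a constant $C$ such that $$\|f\|_{L^p(\Omega,d^{\beta p})}\le C\,\|\nabla f\|_{L^p(\Omega,d^{(\beta+\alpha)p})}$$ for every weakly differentiable $f\in L^p(\Omega,d^{\beta p})$ with $\int_\Omega f\,d^{\beta p}=0$.
   Context: Bounded Hölder-$\alpha$ domain: a bounded domain $\Omega\subset\mathbb R^n$ whose boundary is locally the graph of a function $\varphi$ with $|\varphi(x')-\varphi(y')|\le K_\varphi|x'-y'|^\alpha$; that is, near each boundary point, in suitable rigidly moved coordinates $(x',x_n)\in\mathbb R^{n-1}\times\mathbb R$ and within an open box around the point, $\Omega$ coincides with $\{x_n<\varphi(x')\}$ for such a $\varphi$. For a weight $\eta$ (measurable, positive a.e.), $\|f\|_{L^p(\Omega,\eta)}=\left(\int_\Omega|f|^p\eta\right)^{1/p}$; the right-hand side of the inequality may be $+\infty$. (For $\beta p>-\alpha$ the weight $d^{\beta p}$ is integrable on $\Omega$, so $\int_\Omega f d^{\beta p}$ is well defined.) *)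

theory Defs
  imports "HOL-Analysis.Analysis"
begin

definition rigid_motion :: "(real^'n \<Rightarrow> real^'n) \<Rightarrow> bool" where
  "rigid_motion T \<longleftrightarrow> (\<exists>A c. orthogonal_transformation A \<and> T = (\<lambda>x. A x + c))"

(* Relative to a distinguished axis k, a point y splits as (x', x_n) with x_n = y $ k. The copy of
   R^(n-1) in which x' lives is the coordinate hyperplane of all v with v $ k = 0. *)
definition horizontal_part :: "'n \<Rightarrow> real^'n \<Rightarrow> real^'n" where
  "horizontal_part k y = (\<chi> i. if i = k then 0 else y $ i)"

definition holder_on :: "'a::metric_space set \<Rightarrow> real \<Rightarrow> ('a \<Rightarrow> real) \<Rightarrow> bool" where
  "holder_on S \<alpha> \<phi> \<longleftrightarrow> (\<exists>K. \<forall>u\<in>S. \<forall>v\<in>S. \<bar>\<phi> u - \<phi> v\<bar> \<le> K * dist u v powr \<alpha>)"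

(* The index type has no order, hence no last coordinate, so the axis k that plays the role of x_n is
   chosen along with T. This is no loss or gain of generality: coordinate permutations are orthogonal. *)
definition bounded_holder_domain :: "real \<Rightarrow> (real^'n) set \<Rightarrow> bool" where
  "bounded_holder_domain \<alpha> \<Omega> \<longleftrightarrow>
     open \<Omega> \<and> connected \<Omega> \<and> \<Omega> \<noteq> {} \<and> bounded \<Omega> \<and>
     (\<forall>z\<in>frontier \<Omega>. \<exists>T k \<phi> a b.
        rigid_motion T \<and> holder_on {v. v $ k = 0} \<alpha> \<phi> \<and> T z \<in> box a b \<and>
        T ` \<Omega> \<inter> box a b = {y \<in> box a b. y $ k < \<phi> (horizontal_part k y)})"

(* C^m functions on the whole space, by recursion on directional derivatives. *)
primrec times_cont_diff :: "nat \<Rightarrow> ('a::euclidean_space \<Rightarrow> real) \<Rightarrow> bool" where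
  "times_cont_diff 0 \<psi> \<longleftrightarrow> continuous_on UNIV \<psi>"
| "times_cont_diff (Suc m) \<psi> \<longleftrightarrow>
     \<psi> differentiable_on UNIV \<and>
     (\<forall>v. times_cont_diff m (\<lambda>x. frechet_derivative \<psi> (at x) v))"

definition test_function :: "'a::euclidean_space set \<Rightarrow> ('a \<Rightarrow> real) \<Rightarrow> bool" where
  "test_function \<Omega> \<psi> \<longleftrightarrow>
     (\<forall>m. times_cont_diff m \<psi>) \<and>
     compact (closure {x. \<psi> x \<noteq> 0}) \<and> closure {x. \<psi> x \<noteq> 0} \<subseteq> \<Omega>"

definition locally_integrable ::
    "'a::euclidean_space set \<Rightarrow> ('a \<Rightarrow> 'b::{banach, second_countable_topology}) \<Rightarrow> bool" where
  "locally_integrable \<Omega> f \<longleftrightarrow> (\<forall>K. compact K \<and> K \<subseteq> \<Omega> \<longrightarrow> set_integrable lebesgue K f)"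

definition has_weak_gradient ::
    "(real^'n \<Rightarrow> real) \<Rightarrow> (real^'n \<Rightarrow> real^'n) \<Rightarrow> (real^'n) set \<Rightarrow> bool" where
  "has_weak_gradient f g \<Omega> \<longleftrightarrow>
     locally_integrable \<Omega> f \<and> locally_integrable \<Omega> g \<and>
     (\<forall>\<psi> i. test_function \<Omega> \<psi> \<longrightarrow>
        (LINT x:\<Omega>|lebesgue. f x * frechet_derivative \<psi> (at x) (axis i 1)) =
        - (LINT x:\<Omega>|lebesgue. g x $ i * \<psi> x))"

(* The value may be infinite; the case distinction is needed because powr is not defined on ennreal. *)
definition weighted_Lp_norm ::
    "real \<Rightarrow> 'a::euclidean_space set \<Rightarrow> ('a \<Rightarrow> real) \<Rightarrow> ('a \<Rightarrow> 'b::real_normed_vector) \<Rightarrow> ennreal" where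
  "weighted_Lp_norm p \<Omega> \<eta> f =
     (let I = (\<integral>\<^sup>+x\<in>\<Omega>. ennreal (norm (f x) powr p * \<eta> x) \<partial>lebesgue)
      in if I = \<infinity> then \<infinity> else ennreal (enn2real I powr (1 / p)))"

definition weighted_Lp ::
    "real \<Rightarrow> 'a::euclidean_space set \<Rightarrow> ('a \<Rightarrow> real) \<Rightarrow> ('a \<Rightarrow> 'b::real_normed_vector) set" where
  "weighted_Lp p \<Omega> \<eta> =
     {f. f \<in> borel_measurable (lebesgue_on \<Omega>) \<and> weighted_Lp_norm p \<Omega> \<eta> f < \<infinity>}"

(* For x in \<Omega> this is d(x)^s, d being the distance to the boundary. *)
definition dist_weight :: "'a::euclidean_space set \<Rightarrow> real \<Rightarrow> 'a \<Rightarrow> real" where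
  "dist_weight \<Omega> s x = infdist x (frontier \<Omega>) powr s"

end

theory Submission
  imports Defs
begin

text \<open>Let \<open>d\<close> be the distance to the boundary and \<open>\<gamma> = \<beta> p > -\<alpha>\<close>. For every vector \<open>s e\<close>, a weakly
  differentiable \<open>f\<close> satisfies \<open>\<bar>f (x + s e) - f x\<bar> \<le> \<integral>\<^sub>0\<^sup>s \<bar>e\<bar> \<bar>\<nabla>f (x + \<tau> e)\<bar> d\<tau>\<close> for almost every \<open>x\<close>, and
  this translation estimate is all that the argument needs.

  Near a boundary point let \<open>t\<close> be the depth below the graph. Hoelder continuity gives \<open>t \<le> M d\<^sup>\<alpha>\<close>, and
  \<open>d\<close> increases along downward translations. Hence \<open>d\<^sup>\<gamma>\<close> is at most a multiple of \<open>t\<^sup>\<sigma> d\<^sup>\<nu>\<close> and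
  \<open>t\<^sup>p\<^sup>+\<^sup>\<sigma> d\<^sup>\<nu>\<close> at most a multiple of \<open>d\<^sup>\<gamma>\<^sup>+\<^sup>\<alpha>\<^sup>p\<close>, where \<open>\<sigma> = min \<gamma> 0 / \<alpha> > -1\<close> and \<open>\<nu> = max \<gamma> 0\<close>. Hardy's
  inequality with the power weight \<open>t\<^sup>\<sigma>\<close> along the vertical fibres bounds the weighted norm of
  \<open>f - f (\<cdot> - s e)\<close>, and averaging over \<open>s\<close> bounds that of \<open>f (\<cdot> - s e)\<close> by the norm of \<open>f\<close> on a compact
  part of the domain. There \<open>f - c\<close> is controlled by the Poincare inequality on balls and connectedness.
  Finally, the weighted mean zero condition bounds \<open>c\<close> by Jensen's inequality.\<close>

subsection \<open>Smooth approximations of box indicators\<close>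

text \<open>For \<alpha> < 1 the depth is not comparable to \<open>d\<close>; the bound
  \<open>t \<le> M * d powr \<alpha>\<close> fixes all exponents. Hardy's gain of
  \<open>t powr p\<close> is worth \<open>d powr (\<alpha> * p)\<close>, which is the loss of weight
  on the right-hand side. A negative power of \<open>d\<close> is traded for a power of
  \<open>t\<close>, integrable along fibres exactly when \<sigma> > -1, that is \<gamma> >
  -\<alpha>. Trading a positive power of \<open>d\<close> as well would cost too much on the way
  back from \<open>t\<close> to \<open>d\<close>, so it is kept and carried down the fibre by
  monotonicity. As \<open>f\<close> is given only almost everywhere, there are no slice values from
  which Hardy's inequality could start. Differences of translates take their place, and the average
  over \<open>s\<close> replaces the slice: for one fixed \<open>s\<close> the transported weight
  could be singular at depth \<open>s\<close>. The resulting estimate (gradient term plus a compact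
  part) holds for all pairs \<open>f\<close>, \<open>G\<close> without normalisation. Applied to the
  constant 1 it gives integrability of the weight; applied to \<open>f - c\<close> it reduces the
  theorem to the interior.\<close>

text \<open>The index \<open>k\<close> closes this family under differentiation, up to linear combinations.\<close>

definition flat_exp :: "nat \<Rightarrow> real \<Rightarrow> real" where
  "flat_exp k x = (if x > 0 then exp (- (1 / x)) / x ^ k else 0)"

lemma flat_exp_nonneg: "0 \<le> flat_exp k x"
  by (simp add: flat_exp_def)

lemma flat_exp_0_le_1: "flat_exp 0 x \<le> 1"
  by (simp add: flat_exp_def)

lemma flat_exp_tendsto_0: "(flat_exp k \<longlongrightarrow> 0) (at_right 0)"
proof -
  have "((\<lambda>y::real. y ^ k / exp y) \<longlongrightarrow> 0) at_top"
    by (rule tendsto_power_div_exp_0)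
  then have "((\<lambda>x. inverse x ^ k / exp (inverse x)) \<longlongrightarrow> 0) (at_right (0::real))"
    by (rule filterlim_compose[OF _ filterlim_inverse_at_top_right])
  moreover have "\<forall>\<^sub>F x in at_right (0::real). inverse x ^ k / exp (inverse x) = flat_exp k x"
    by (rule eventually_at_right_less[THEN eventually_mono])
       (simp add: flat_exp_def exp_minus power_inverse field_simps)
  ultimately show ?thesis by (rule Lim_transform_eventually)
qed

lemma flat_exp_has_derivative:
  "(flat_exp k has_real_derivative (flat_exp (k + 2) x - real k * flat_exp (k + 1) x)) (at x)"
proof -
  consider "x > 0" | "x < 0" | "x = 0" by linarith
  then show ?thesis
  proof cases
    case 1
    have "((\<lambda>x. exp (- (1 / x)) / x ^ k) has_real_derivative
        (flat_exp (k + 2) x - real k * flat_exp (k + 1) x)) (at x)"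
    proof (cases k)
      case 0
      then show ?thesis using 1
        by (auto intro!: derivative_eq_intros simp: flat_exp_def field_simps power2_eq_square)
    next
      case (Suc n)
      have "(exp (- (1 / x)) * (1 / x\<^sup>2) * x ^ Suc n - exp (- (1 / x)) * (real (Suc n) * x ^ n)) / (x ^ Suc n * x ^ Suc n)
         = exp (- (1 / x)) / x ^ (Suc n + 2) - real (Suc n) * (exp (- (1 / x)) / x ^ (Suc n + 1))"
        using 1 by (simp add: divide_simps) (simp add: algebra_simps power2_eq_square)
      moreover have "((\<lambda>x. exp (- (1 / x)) / x ^ Suc n) has_real_derivative
         (exp (- (1 / x)) * (1 / x\<^sup>2) * x ^ Suc n - exp (- (1 / x)) * (real (Suc n) * x ^ n)) / (x ^ Suc n * x ^ Suc n)) (at x)"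
        using 1 by (auto intro!: derivative_eq_intros simp del: power_Suc simp: power2_eq_square)
      ultimately show ?thesis using 1 Suc by (simp add: flat_exp_def)
    qed
    moreover have "\<forall>\<^sub>F y in nhds x. flat_exp k y = exp (- (1 / y)) / y ^ k"
      using eventually_nhds_in_open[of "{0<..}" x] 1
      by (auto elim!: eventually_mono simp: flat_exp_def)
    ultimately show ?thesis by (subst DERIV_cong_ev[OF refl _ refl]) auto
  next
    case 2
    have "\<forall>\<^sub>F y in nhds x. flat_exp k y = 0"
      using eventually_nhds_in_open[of "{..<0}" x] 2
      by (auto elim!: eventually_mono simp: flat_exp_def)
    then show ?thesis using 2
      by (subst DERIV_cong_ev[OF refl _ refl]) (auto simp: flat_exp_def)
  next
    case 3
    \<comment> \<open>To the right of 0 the difference quotient is the next member of the family, so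
      \<open>flat_exp_tendsto_0\<close> already gives differentiability at 0.\<close>
    have "((\<lambda>y. flat_exp k y / y) \<longlongrightarrow> 0) (at_right 0)"
    proof (rule Lim_transform_eventually[OF flat_exp_tendsto_0[of "Suc k"]])
      show "\<forall>\<^sub>F y in at_right 0. flat_exp (Suc k) y = flat_exp k y / y"
        by (simp add: flat_exp_def)
    qed
    moreover have "((\<lambda>y. flat_exp k y / y) \<longlongrightarrow> 0) (at_left 0)"
      by (rule tendsto_eventually) (auto simp: flat_exp_def eventually_at_filter)
    ultimately have "((\<lambda>y. flat_exp k y / y) \<longlongrightarrow> 0) (at 0)"
      by (simp add: filterlim_split_at)
    then show ?thesis using 3
      by (simp add: has_field_derivative_iff flat_exp_def)
  qed
qed

section \<open>Calculus of \<open>times_cont_diff\<close>\<close>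

lemma tcd_imp_continuous: "times_cont_diff m \<psi> \<Longrightarrow> continuous_on UNIV \<psi>"
  by (cases m) (auto intro: differentiable_imp_continuous_on)

lemma tcd_Suc_imp: "times_cont_diff (Suc m) \<psi> \<Longrightarrow> times_cont_diff m \<psi>"
proof (induction m arbitrary: \<psi>)
  case (Suc m)
  have "\<psi> differentiable_on UNIV \<and>
      (\<forall>v. times_cont_diff (Suc m) (\<lambda>x. frechet_derivative \<psi> (at x) v))"
    using Suc.prems by (subst (asm) times_cont_diff.simps(2))
  with Suc.IH show ?case by (subst times_cont_diff.simps(2)) blast
qed (auto intro: differentiable_imp_continuous_on)

text \<open>Uniqueness of derivatives lets an explicit formula \<open>D\<close> stand for the choice
  operator behind \<open>frechet_derivative\<close>.\<close>

lemma tcd_SucI: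
  assumes "\<And>x. (\<psi> has_derivative (D x)) (at x)"
    and "\<And>v. times_cont_diff m (\<lambda>x. D x v)"
  shows "times_cont_diff (Suc m) \<psi>"
proof -
  have "frechet_derivative \<psi> (at x) = D x" for x
    using assms(1) by (metis frechet_derivative_at)
  moreover have "\<psi> differentiable_on UNIV"
    using assms(1) by (auto simp: differentiable_on_def differentiable_def)
  ultimately show ?thesis using assms(2) by simp
qed

lemma tcd_Suc_has_derivative:
  "times_cont_diff (Suc m) \<psi> \<Longrightarrow> (\<psi> has_derivative (frechet_derivative \<psi> (at x))) (at x)"
  by (auto simp: differentiable_on_def frechet_derivative_works)

lemma tcd_const: "times_cont_diff m (\<lambda>x. c)"
proof (induction m arbitrary: c)
  case (Suc m)
  show ?case by (rule tcd_SucI[where D="\<lambda>_ _. 0"]) (auto intro: Suc)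
qed auto

lemma tcd_add:
  "times_cont_diff m \<phi> \<Longrightarrow> times_cont_diff m \<psi> \<Longrightarrow> times_cont_diff m (\<lambda>x. \<phi> x + \<psi> x)"
proof (induction m arbitrary: \<phi> \<psi>)
  case 0
  then show ?case by (auto intro: continuous_intros)
next
  case (Suc m)
  show ?case
  proof (rule tcd_SucI)
    fix x show "((\<lambda>x. \<phi> x + \<psi> x) has_derivative
      (\<lambda>v. frechet_derivative \<phi> (at x) v + frechet_derivative \<psi> (at x) v)) (at x)"
      using Suc.prems by (intro has_derivative_add tcd_Suc_has_derivative)
  qed (use Suc in auto)
qed

lemma tcd_mult:
  "times_cont_diff m \<phi> \<Longrightarrow> times_cont_diff m \<psi> \<Longrightarrow> times_cont_diff m (\<lambda>x. \<phi> x * \<psi> x)"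
proof (induction m arbitrary: \<phi> \<psi>)
  case 0
  then show ?case by (auto intro: continuous_intros)
next
  case (Suc m)
  show ?case
  proof (rule tcd_SucI)
    fix x show "((\<lambda>x. \<phi> x * \<psi> x) has_derivative
      (\<lambda>v. \<phi> x * frechet_derivative \<psi> (at x) v + frechet_derivative \<phi> (at x) v * \<psi> x)) (at x)"
      using Suc.prems by (intro has_derivative_mult tcd_Suc_has_derivative)
  next
    fix v
    have "times_cont_diff m (\<lambda>x. frechet_derivative \<phi> (at x) v)"
      "times_cont_diff m (\<lambda>x. frechet_derivative \<psi> (at x) v)"
      using Suc.prems by auto
    then show "times_cont_diff m
      (\<lambda>x. \<phi> x * frechet_derivative \<psi> (at x) v + frechet_derivative \<phi> (at x) v * \<psi> x)"
      using Suc.prems[THEN tcd_Suc_imp] by (intro tcd_add Suc.IH)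
  qed
qed

lemma tcd_prod:
  "finite I \<Longrightarrow> (\<And>i. i \<in> I \<Longrightarrow> times_cont_diff m (h i)) \<Longrightarrow> times_cont_diff m (\<lambda>x. \<Prod>i\<in>I. h i x)"
  by (induction I rule: finite_induct) (auto intro: tcd_mult tcd_const)

text \<open>The induction on \<open>m\<close> keeps \<open>k\<close> arbitrary, since one derivative
  leads to the indices \<open>k + 1\<close> and \<open>k + 2\<close>.\<close>

lemma tcd_flat_exp_affine:
  fixes l :: "'a::euclidean_space \<Rightarrow> real"
  assumes "bounded_linear l"
  shows "times_cont_diff m (\<lambda>x. flat_exp k (l x + c))"
proof (induction m arbitrary: k)
  case 0
  have "continuous_on UNIV (flat_exp k)"
    by (rule DERIV_continuous_on) (rule has_field_derivative_at_within[OF flat_exp_has_derivative])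
  moreover have "continuous_on UNIV (\<lambda>x. l x + c)"
    by (intro continuous_on_add continuous_on_const linear_continuous_on assms)
  ultimately have "continuous_on UNIV (flat_exp k \<circ> (\<lambda>x. l x + c))"
    by (metis continuous_on_compose continuous_on_subset subset_UNIV)
  then show ?case by (simp add: o_def)
next
  case (Suc m)
  let ?D = "\<lambda>x v. l v * (flat_exp (k + 2) (l x + c) + (- real k) * flat_exp (k + 1) (l x + c))"
  show ?case
  proof (rule tcd_SucI)
    fix x
    have "((\<lambda>x. l x + c) has_derivative l) (at x)"
      using has_derivative_add_const[OF bounded_linear_imp_has_derivative[OF assms]] .
    from DERIV_compose_FDERIV[OF flat_exp_has_derivative this]
    show "((\<lambda>x. flat_exp k (l x + c)) has_derivative ?D x) (at x)" by (simp add: mult_ac)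
  qed (intro tcd_mult tcd_add tcd_const Suc)
qed

text \<open>Since \<open>exp (- 1 / (N * c))\<close> tends to 1 for \<open>c > 0\<close>, scaling by
  \<open>N\<close> makes the bumps converge to the indicator of the box, while they all vanish off
  the same open box and stay between 0 and 1.\<close>

definition box_bump :: "nat \<Rightarrow> 'a::euclidean_space \<Rightarrow> 'a \<Rightarrow> 'a \<Rightarrow> real" where
  "box_bump N a b x =
     (\<Prod>i\<in>Basis. flat_exp 0 (real N * (x \<bullet> i - a \<bullet> i)) * flat_exp 0 (real N * (b \<bullet> i - x \<bullet> i)))"

lemma box_bump_nonneg: "0 \<le> box_bump N a b x"
  by (auto simp: box_bump_def intro!: prod_nonneg mult_nonneg_nonneg flat_exp_nonneg)

lemma box_bump_le_1: "box_bump N a b x \<le> 1"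
  unfolding box_bump_def
  by (rule prod_le_1) (auto intro!: mult_le_one mult_nonneg_nonneg flat_exp_nonneg flat_exp_0_le_1)

lemma box_bump_eq_0: "x \<notin> box a b \<Longrightarrow> box_bump N a b x = 0"
proof -
  assume "x \<notin> box a b"
  then obtain i where "i \<in> Basis" "x \<bullet> i \<le> a \<bullet> i \<or> b \<bullet> i \<le> x \<bullet> i"
    by (auto simp: mem_box not_less)
  then show ?thesis
    by (auto simp: box_bump_def flat_exp_def zero_less_mult_iff intro!: bexI[of _ i])
qed

lemma tcd_box_bump_shift: "times_cont_diff m (\<lambda>x. box_bump N a b (x - u))"
proof -
  have 1: "times_cont_diff m (\<lambda>x::'a. flat_exp 0 (real N * (x \<bullet> i) + c))" for i :: 'a and c
    by (rule tcd_flat_exp_affine)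
       (intro bounded_linear_const_mult bounded_linear_inner_left)
  have 2: "times_cont_diff m (\<lambda>x::'a. flat_exp 0 (- real N * (x \<bullet> i) + c))" for i :: 'a and c
    by (rule tcd_flat_exp_affine)
       (intro bounded_linear_const_mult bounded_linear_inner_left)
  have "times_cont_diff m (\<lambda>x::'a. \<Prod>i\<in>Basis.
      flat_exp 0 (real N * (x \<bullet> i) + (- real N * (u \<bullet> i + a \<bullet> i))) *
      flat_exp 0 (- real N * (x \<bullet> i) + real N * (b \<bullet> i + u \<bullet> i)))"
    by (intro tcd_prod tcd_mult 1 2) auto
  then show ?thesis
    by (simp add: box_bump_def algebra_simps)
qed

text \<open>Translates of one bump are the functions with which the weak identity is tested. The
  closed box appears because the support is a closure.\<close>

lemma test_function_box_bump:
  assumes "\<And>x. x \<in> cbox a b \<Longrightarrow> x + u \<in> \<Omega>"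
  shows "test_function \<Omega> (\<lambda>x. box_bump N a b (x - u))"
proof -
  have "{x. box_bump N a b (x - u) \<noteq> 0} \<subseteq> (\<lambda>x. u + x) ` cbox a b"
  proof
    fix x assume "x \<in> {x. box_bump N a b (x - u) \<noteq> 0}"
    then have "x - u \<in> cbox a b" using box_bump_eq_0[of "x - u" a b N] box_subset_cbox by auto
    then show "x \<in> (\<lambda>x. u + x) ` cbox a b" by (intro image_eqI[of _ _ "x - u"]) auto
  qed
  moreover have "compact ((\<lambda>x. u + x) ` cbox a b)"
    by (intro compact_translation compact_cbox)
  ultimately have "closure {x. box_bump N a b (x - u) \<noteq> 0} \<subseteq> (\<lambda>x. u + x) ` cbox a b"
    by (intro closure_minimal) (auto intro: compact_imp_closed)
  with \<open>compact _\<close> assms show ?thesis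
    unfolding test_function_def
  proof (intro conjI allI tcd_box_bump_shift)
    assume c: "closure {x. box_bump N a b (x - u) \<noteq> 0} \<subseteq> (\<lambda>x. u + x) ` cbox a b"
    assume "compact ((\<lambda>x. u + x) ` cbox a b)"
    then show "compact (closure {x. box_bump N a b (x - u) \<noteq> 0})"
      using c by (metis closed_closure compact_Int_closed inf.absorb_iff2)
    have "(\<lambda>x. u + x) ` cbox a b \<subseteq> \<Omega>" using assms by (auto simp: add.commute)
    with c show "closure {x. box_bump N a b (x - u) \<noteq> 0} \<subseteq> \<Omega>" by (rule order_trans)
  qed
qed

lemma box_bump_tendsto: "(\<lambda>N. box_bump N a b x) \<longlonglongrightarrow> indicator (box a b) x"
proof (cases "x \<in> box a b")
  case True
  have *: "(\<lambda>N. flat_exp 0 (real N * c)) \<longlonglongrightarrow> 1" if "c > 0" for c :: real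
  proof -
    have "(\<lambda>N. exp (- ((1 / c) * (1 / real N)))) \<longlonglongrightarrow> exp (- ((1 / c) * 0))"
      by (intro tendsto_intros lim_1_over_n)
    moreover have "\<forall>\<^sub>F N in sequentially. exp (- ((1 / c) * (1 / real N))) = flat_exp 0 (real N * c)"
      using eventually_gt_at_top[of "0::nat"]
      by eventually_elim (use that in \<open>auto simp: flat_exp_def mult.commute\<close>)
    ultimately show ?thesis by (auto intro: Lim_transform_eventually)
  qed
  have "(\<lambda>N. box_bump N a b x) \<longlonglongrightarrow> (\<Prod>i\<in>(Basis::'a set). 1 * 1)"
    unfolding box_bump_def using True
    by (intro tendsto_prod tendsto_mult *) (auto simp: mem_box)
  then show ?thesis using True by simp
qed (simp add: box_bump_eq_0)

subsection \<open>Locally integrable functions with vanishing box integrals\<close>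

lemma nn_integral_lborel_shift:
  fixes f :: "'a::euclidean_space \<Rightarrow> ennreal"
  assumes [measurable]: "f \<in> borel_measurable borel"
  shows "(\<integral>\<^sup>+x. f (x + c) \<partial>lborel) = (\<integral>\<^sup>+x. f x \<partial>lborel)"
proof -
  have "(\<integral>\<^sup>+x. f x \<partial>distr lborel borel ((+) c)) = (\<integral>\<^sup>+x. f (c + x) \<partial>lborel)"
    by (rule nn_integral_distr) measurable
  then show ?thesis by (simp add: lborel_distr_plus add.commute[of c])
qed

lemma integral_lborel_shift:
  fixes f :: "'a::euclidean_space \<Rightarrow> real"
  assumes [measurable]: "f \<in> borel_measurable borel"
  shows "(\<integral>x. f (x + c) \<partial>lborel) = (\<integral>x. f x \<partial>lborel)"
proof -
  have "(\<integral>x. f x \<partial>distr lborel borel ((+) c)) = (\<integral>x. f (c + x) \<partial>lborel)"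
    by (rule integral_distr) measurable
  then show ?thesis by (simp add: lborel_distr_plus add.commute[of c])
qed

lemma integrable_lborel_shift:
  fixes f :: "'a::euclidean_space \<Rightarrow> real"
  assumes [measurable]: "f \<in> borel_measurable borel"
  shows "integrable lborel (\<lambda>x. f (x + c)) \<longleftrightarrow> integrable lborel f"
proof -
  have "integrable (distr lborel borel ((+) c)) f \<longleftrightarrow> integrable lborel (\<lambda>x. f (c + x))"
    by (rule integrable_distr_eq) measurable
  then show ?thesis by (simp add: lborel_distr_plus add.commute[of c])
qed

text \<open>Dynkin's argument: boxes generate the Borel sets and are stable under intersection, so
  the integral vanishes over every Borel set. The hypothesis on the total integral is what gives
  closure under complements.\<close>

lemma AE_zero_of_integral_box_zero:
  fixes k :: "'a::euclidean_space \<Rightarrow> real"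
  assumes k: "integrable lborel k" and total: "integral\<^sup>L lborel k = 0"
    and box: "\<And>c d. (LINT x:box c d|lborel. k x) = 0"
  shows "AE x in lborel. k x = 0"
proof -
  let ?G = "range (\<lambda>(a, b). box a b :: 'a set)"
  have int: "set_integrable lborel A k" if "A \<in> sets borel" for A
    using that k integrable_mult_indicator[of A lborel k] by (simp add: set_integrable_def)
  have borel_sets: "sets (borel::'a measure) = sigma_sets UNIV ?G"
    by (simp add: borel_eq_box)
  have zero: "(LINT x:A|lborel. k x) = 0" if "A \<in> sets borel" for A
  proof -
    have "Int_stable ?G"
      by (auto simp: Int_stable_def box_Int_box)
    moreover have "?G \<subseteq> Pow UNIV" by simp
    moreover have "A \<in> sigma_sets UNIV ?G" using that borel_sets by simp
    ultimately show ?thesis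
    proof (induction rule: sigma_sets_induct_disjoint)
      case (basic A)
      then show ?case using box by auto
    next
      case empty
      show ?case by (simp add: set_lebesgue_integral_def)
    next
      case (compl A)
      then have A: "A \<in> sets borel" using borel_sets by simp
      have "integral\<^sup>L lborel k = (LINT x:A \<union> (UNIV - A)|lborel. k x)"
        by (simp add: set_lebesgue_integral_def)
      also have "\<dots> = (LINT x:A|lborel. k x) + (LINT x:UNIV - A|lborel. k x)"
        using A by (intro set_integral_Un int) auto
      finally show ?case using compl total by simp
    next
      case (union A)
      then have A: "A i \<in> sets borel" for i using borel_sets by auto
      have "(LINT x:(\<Union>i. A i)|lborel. k x) = (\<Sum>i. LINT x:A i|lborel. k x)"
        using A union(1) by (intro lebesgue_integral_countable_add int) (auto simp: disjoint_family_on_def)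
      then show ?case using union by simp
    qed
  qed
  have [measurable]: "k \<in> borel_measurable borel" using k by auto
  \<comment> \<open>The values \<open>c = 1\<close> and \<open>c = -1\<close> treat the sets where
    \<open>k\<close> is positive and negative.\<close>
  have "AE x in lborel. indicator {x. 0 < c * k x} x *\<^sub>R (c * k x) = 0" for c
  proof (rule integral_nonneg_eq_0_iff_AE[THEN iffD1])
    have 1: "(\<lambda>x. indicator {x. 0 < c * k x} x *\<^sub>R (c * k x)) = (\<lambda>x. c * (indicator {x. 0 < c * k x} x *\<^sub>R k x))"
      by auto
    have 2: "{x. 0 < c * k x} \<in> sets borel" by measurable
    show "integrable lborel (\<lambda>x. indicator {x. 0 < c * k x} x *\<^sub>R (c * k x))"
      unfolding 1 using int[OF 2] by (simp add: set_integrable_def)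
    show "(\<integral>x. indicator {x. 0 < c * k x} x *\<^sub>R (c * k x) \<partial>lborel) = 0"
      unfolding 1 using zero[OF 2] by (simp add: set_lebesgue_integral_def)
  qed (auto simp: indicator_def)
  from this[of 1] this[of "-1"] show ?thesis
    by eventually_elim (auto simp: indicator_def split: if_splits)
qed

text \<open>On each closed box inside \<open>V\<close> the global lemma applies to \<open>h\<close>
  cut off by the open box; the faces are null, and countably many such boxes exhaust
  \<open>V\<close>.\<close>

lemma AE_zero_on_open:
  fixes h :: "'a::euclidean_space \<Rightarrow> real"
  assumes "open V"
    and int: "\<And>a b. cbox a b \<subseteq> V \<Longrightarrow> set_integrable lborel (box a b) h"
    and zero: "\<And>a b. cbox a b \<subseteq> V \<Longrightarrow> (LINT x:box a b|lborel. h x) = 0"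
  shows "AE x in lborel. x \<in> V \<longrightarrow> h x = 0"
proof -
  have *: "AE x in lborel. x \<in> cbox a b \<longrightarrow> h x = 0" if V: "cbox a b \<subseteq> V" for a b
  proof -
    let ?k = "\<lambda>x. indicator (box a b) x *\<^sub>R h x"
    have "AE x in lborel. ?k x = 0"
    proof (rule AE_zero_of_integral_box_zero)
      fix c d
      obtain c' d' where eq: "box a b \<inter> box c d = box c' d'" using box_Int_box[of a b c d] by blast
      have "(LINT x:box c' d'|lborel. h x) = 0"
      \<comment> \<open>Only a nonempty open box forces its closed box to lie in \<open>V\<close>; a
        degenerate \<open>cbox c' d'\<close> could lie anywhere.\<close>
      proof (cases "box c' d' = {}")
        case False
        then have "cbox c' d' = closure (box c' d')" by (simp add: closure_box)
        also have "\<dots> \<subseteq> closure (box a b)" by (rule closure_mono) (use eq in auto)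
        also have "\<dots> \<subseteq> cbox a b" by (intro closure_minimal box_subset_cbox closed_cbox)
        finally show ?thesis using V zero by blast
      qed (simp add: set_lebesgue_integral_def)
      moreover have "indicator (box c d) x *\<^sub>R ?k x = indicator (box c' d') x *\<^sub>R h x" for x
        by (simp add: indicator_inter_arith flip: eq)
      ultimately show "(LINT x:box c d|lborel. ?k x) = 0"
        unfolding set_lebesgue_integral_def by presburger
    qed (use int[OF V] zero[OF V] in \<open>simp_all add: set_integrable_def set_lebesgue_integral_def\<close>)
    moreover have "AE x in lborel. x \<notin> cbox a b - box a b"
    proof (rule AE_not_in)
      have "negligible (cbox a b - box a b)" by (rule negligible_frontier_interval)
      then have "emeasure lebesgue (cbox a b - box a b) = 0"
        by (simp add: negligible_iff_emeasure0)
      then show "cbox a b - box a b \<in> null_sets lborel"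
        by (auto simp: null_sets_def)
    qed
    ultimately show ?thesis by eventually_elim (auto simp: indicator_def split: if_splits)
  qed
  obtain D where D: "countable D" "\<And>X. X \<in> D \<Longrightarrow> \<exists>a b. X = cbox a b" "\<Union>D = V"
    using open_countable_Union_open_cbox[OF \<open>open V\<close>] by metis
  have "AE x in lborel. x \<in> X \<longrightarrow> h x = 0" if "X \<in> D" for X
    using D(2)[OF that] D(3) that * by blast
  then have "AE x in lborel. \<forall>X\<in>D. x \<in> X \<longrightarrow> h x = 0"
    using D(1) by (subst AE_ball_countable) auto
  then show ?thesis by eventually_elim (use D(3) in auto)
qed

subsection \<open>Jensen's inequality for powers\<close>

text \<open>The convex function \<open>h powr p\<close> lies above its tangent at \<open>a\<close>;
  this is Young's inequality with conjugate exponent \<open>p / (p - 1)\<close>.\<close>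

lemma powr_Young_tangent:
  fixes a h p :: real
  assumes "1 < p" "0 \<le> a" "0 \<le> h"
  shows "p * a powr (p - 1) * h \<le> h powr p + (p - 1) * a powr p"
proof -
  define q where "q = p / (p - 1)"
  have q: "1 < q" "1 / p + 1 / q = 1" using assms by (auto simp: q_def field_simps)
  have "h * a powr (p - 1) \<le> h powr p / p + (a powr (p - 1)) powr q / q"
    using Youngs_inequality[OF assms(1) q, of h "a powr (p - 1)"] assms by simp
  also have "(a powr (p - 1)) powr q = a powr p"
    using assms by (simp add: powr_powr q_def)
  finally have "h * a powr (p - 1) \<le> h powr p / p + a powr p * (p - 1) / p"
    using assms by (simp add: q_def)
  then show ?thesis using assms by (simp add: field_simps)
qed

text \<open>Integrate the tangent inequality at \<open>a\<close> against \<open>w\<close> and cancel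
  the finite term \<open>(p - 1) * a powr p\<close>. Stating it for a lower bound \<open>a\<close>
  of the mean, and for mass at most 1, lets both integrals be infinite and allows densities that are
  not normalised.\<close>

lemma powr_nn_integral_le:
  fixes h w :: "'a \<Rightarrow> real"
  assumes p: "1 < p" and a: "0 \<le> a"
    and [measurable]: "h \<in> borel_measurable M" "w \<in> borel_measurable M"
    and h: "\<And>x. 0 \<le> h x" and w: "\<And>x. 0 \<le> w x"
    and w1: "(\<integral>\<^sup>+x. ennreal (w x) \<partial>M) \<le> 1"
    and le: "ennreal a \<le> (\<integral>\<^sup>+x. ennreal (h x * w x) \<partial>M)"
  shows "ennreal (a powr p) \<le> (\<integral>\<^sup>+x. ennreal (h x powr p * w x) \<partial>M)"
proof (cases "a = 0")
  case False
  with a have a: "a > 0" by simp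
  let ?I = "\<integral>\<^sup>+x. ennreal (h x powr p * w x) \<partial>M"
  have "ennreal (p * a powr p) = ennreal (p * a powr (p - 1)) * ennreal a"
    using a p by (simp add: powr_diff flip: ennreal_mult)
  also have "\<dots> \<le> ennreal (p * a powr (p - 1)) * (\<integral>\<^sup>+x. ennreal (h x * w x) \<partial>M)"
    by (intro mult_left_mono le) simp
  also have "\<dots> = (\<integral>\<^sup>+x. ennreal (p * a powr (p - 1) * h x * w x) \<partial>M)"
    using p h w by (simp add: mult.assoc flip: nn_integral_cmult ennreal_mult)
  also have "\<dots> \<le> (\<integral>\<^sup>+x. ennreal (h x powr p * w x) + ennreal ((p - 1) * a powr p) * ennreal (w x) \<partial>M)"
  proof (rule nn_integral_mono)
    fix x
    have "p * a powr (p - 1) * h x * w x \<le> (h x powr p + (p - 1) * a powr p) * w x"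
      using powr_Young_tangent[OF p _ h] a by (intro mult_right_mono w) auto
    then show "ennreal (p * a powr (p - 1) * h x * w x)
        \<le> ennreal (h x powr p * w x) + ennreal ((p - 1) * a powr p) * ennreal (w x)"
      using p w[of x] h[of x] by (simp add: distrib_right ennreal_leI flip: ennreal_mult ennreal_plus)
  qed
  also have "\<dots> = ?I + ennreal ((p - 1) * a powr p) * (\<integral>\<^sup>+x. ennreal (w x) \<partial>M)"
    by (simp add: nn_integral_add nn_integral_cmult)
  also have "\<dots> \<le> ?I + ennreal ((p - 1) * a powr p) * 1"
    by (intro add_left_mono mult_left_mono w1) simp
  finally have "ennreal (p * a powr p) \<le> ?I + ennreal ((p - 1) * a powr p)" by simp
  moreover have "ennreal (p * a powr p) = ennreal (a powr p) + ennreal ((p - 1) * a powr p)"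
  proof -
    have "0 \<le> (p - 1) * a powr p" using p by simp
    moreover have "p * a powr p = a powr p + (p - 1) * a powr p" by (simp add: algebra_simps)
    ultimately show ?thesis by (metis ennreal_plus powr_ge_zero)
  qed
  ultimately show ?thesis
    by (simp add: ennreal_add_left_cancel_le add.commute)
qed simp

subsection \<open>The fundamental theorem of calculus for weak gradients\<close>

text \<open>Bound and support serve the Fubini argument, the formula for translates serves the weak
  identity, and the derivative along a line serves the fundamental theorem. The minus sign comes
  from moving the bump forwards, that is, its argument backwards.\<close>

lemma box_bump_directional_derivative:
  fixes a b e :: "'a::euclidean_space"
  obtains D C where "continuous_on UNIV D" "\<And>y. \<bar>D y\<bar> \<le> C" "\<And>y. y \<notin> cbox a b \<Longrightarrow> D y = 0"
    "\<And>u x. frechet_derivative (\<lambda>x. box_bump N a b (x - u)) (at x) e = D (x - u)"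
    "\<And>x t. ((\<lambda>t. box_bump N a b (x - t *\<^sub>R e)) has_vector_derivative - D (x - t *\<^sub>R e)) (at t)"
proof -
  let ?\<phi> = "box_bump N a b"
  define D where "D y = frechet_derivative ?\<phi> (at y) e" for y
  have tcd: "times_cont_diff (Suc 0) ?\<phi>"
    using tcd_box_bump_shift[of "Suc 0" N a b 0] by simp
  have der: "(?\<phi> has_derivative frechet_derivative ?\<phi> (at y)) (at y)" for y
    using tcd by (rule tcd_Suc_has_derivative)
  have cont: "continuous_on UNIV D"
    using tcd by (simp add: D_def)
  have zero: "D y = 0" if "y \<notin> cbox a b" for y
  proof -
    have "(?\<phi> has_derivative (\<lambda>_. 0)) (at y)"
    proof (rule has_derivative_transform_within_open)
      show "((\<lambda>_. 0::real) has_derivative (\<lambda>_. 0)) (at y)" by simp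
      show "open (- cbox a b)" by (simp add: open_Compl closed_cbox)
      show "y \<in> - cbox a b" using that by simp
      show "0 = ?\<phi> x" if "x \<in> - cbox a b" for x
        using that box_bump_eq_0[of x a b N] box_subset_cbox[of a b] by auto
    qed
    from frechet_derivative_at[OF this] show ?thesis by (metis D_def)
  qed
  have "compact (D ` cbox a b)"
    using cont by (intro compact_continuous_image compact_cbox) (rule continuous_on_subset, auto)
  then obtain C where C: "\<And>y. y \<in> cbox a b \<Longrightarrow> \<bar>D y\<bar> \<le> C"
    using compact_imp_bounded[of "D ` cbox a b"] by (auto simp: bounded_iff)
  have bound: "\<bar>D y\<bar> \<le> max C 0" for y
    using C[of y] zero[of y] by (cases "y \<in> cbox a b") auto
  have shift: "frechet_derivative (\<lambda>x. ?\<phi> (x - u)) (at x) e = D (x - u)" for u x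
  proof -
    have "((\<lambda>x. x - u) has_derivative (\<lambda>v. v)) (at x)"
      by (auto intro!: derivative_eq_intros)
    from has_derivative_compose[OF this der]
    have "((\<lambda>x. ?\<phi> (x - u)) has_derivative (\<lambda>v. frechet_derivative ?\<phi> (at (x - u)) v)) (at x)" .
    from frechet_derivative_at[OF this] show ?thesis by (metis D_def)
  qed
  have line: "((\<lambda>t. ?\<phi> (x - t *\<^sub>R e)) has_vector_derivative - D (x - t *\<^sub>R e)) (at t)" for x t
  proof -
    have lin: "linear (frechet_derivative ?\<phi> (at y))" for y
      using der has_derivative_linear by blast
    have "((\<lambda>t. x - t *\<^sub>R e) has_derivative (\<lambda>h. - (h *\<^sub>R e))) (at t)"
      by (auto intro!: derivative_eq_intros)
    from has_derivative_compose[OF this der]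
    have "((\<lambda>t. ?\<phi> (x - t *\<^sub>R e)) has_derivative
        (\<lambda>h. frechet_derivative ?\<phi> (at (x - t *\<^sub>R e)) (- (h *\<^sub>R e)))) (at t)" .
    then show ?thesis
      by (simp add: has_vector_derivative_def D_def linear_neg[OF lin] linear_scale[OF lin])
  qed
  show ?thesis by (rule that[OF cont bound zero shift line])
qed

text \<open>By Tonelli it is enough that each slice is dominated, after a translation, by the
  integral of \<bar>u\<bar> over \<open>K\<close>; there is only a bounded interval of
  slices.\<close>

lemma integrable_tube:
  fixes u :: "'a::euclidean_space \<Rightarrow> real"
  assumes [measurable]: "u \<in> borel_measurable borel" "K \<in> sets borel" "B \<in> sets borel"
    and K: "\<And>x t. x \<in> B \<Longrightarrow> 0 \<le> t \<Longrightarrow> t \<le> s \<Longrightarrow> x + t *\<^sub>R e \<in> K"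
    and int: "set_integrable lborel K u"
  shows "integrable (lborel \<Otimes>\<^sub>M lborel)
    (\<lambda>(t, x). indicator {0..s} t * (indicator B x * u (x + t *\<^sub>R e)))"
    (is "integrable _ (\<lambda>(t, x). ?F t x)")
proof (rule integrableI_bounded)
  show "(\<lambda>(t, x). ?F t x) \<in> borel_measurable (lborel \<Otimes>\<^sub>M lborel)" by measurable
  let ?U = "\<integral>\<^sup>+x. ennreal (norm (indicator K x *\<^sub>R u x)) \<partial>lborel"
  have U: "?U < \<infinity>"
    using int by (simp add: set_integrable_def integrable_iff_bounded)
  have "(\<integral>\<^sup>+z. ennreal (norm (case z of (t, x) \<Rightarrow> ?F t x)) \<partial>(lborel \<Otimes>\<^sub>M lborel))
     = (\<integral>\<^sup>+t. \<integral>\<^sup>+x. ennreal (norm (?F t x)) \<partial>lborel \<partial>lborel)"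
    by (subst lborel.nn_integral_fst[symmetric]) auto
  also have "\<dots> \<le> (\<integral>\<^sup>+t. indicator {0..s} t * ?U \<partial>lborel)"
  proof (rule nn_integral_mono)
    fix t :: real
    have "(\<integral>\<^sup>+x. ennreal (norm (?F t x)) \<partial>lborel)
        \<le> (\<integral>\<^sup>+x. indicator {0..s} t * ennreal (norm (indicator K (x + t *\<^sub>R e) *\<^sub>R u (x + t *\<^sub>R e))) \<partial>lborel)"
      using K by (intro nn_integral_mono) (auto simp: indicator_def)
    also have "\<dots> = indicator {0..s} t * ?U"
      by (subst nn_integral_cmult, simp,
          subst nn_integral_lborel_shift[where f="\<lambda>x. ennreal (norm (indicator K x *\<^sub>R u x))"]) auto
    finally show "(\<integral>\<^sup>+x. ennreal (norm (?F t x)) \<partial>lborel) \<le> indicator {0..s} t * ?U" .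
  qed
  also have "\<dots> = emeasure lborel {0..s} * ?U"
    by (simp add: nn_integral_multc)
  also have "\<dots> < \<infinity>"
    using U by (cases "0 \<le> s") (simp_all add: ennreal_mult_less_top)
  finally show "(\<integral>\<^sup>+z. ennreal (norm (case z of (t, x) \<Rightarrow> ?F t x)) \<partial>(lborel \<Otimes>\<^sub>M lborel)) < \<infinity>" .
qed

text \<open>The complement is the sum of a compact segment and the closed complement of \<Omega>,
  hence closed.\<close>

lemma open_segments_inside:
  fixes \<Omega> :: "'a::euclidean_space set"
  assumes "open \<Omega>"
  shows "open {x. \<forall>t\<in>{0..s}. x + t *\<^sub>R e \<in> \<Omega>}"
proof -
  let ?T = "(\<lambda>t. - (t *\<^sub>R e)) ` {0..s}"
  have "compact ?T"
    by (intro compact_continuous_image continuous_intros compact_Icc)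
  moreover have "closed (- \<Omega>)" using assms by (simp add: closed_Compl)
  ultimately have "closed (\<Union>x\<in>?T. \<Union>y\<in>- \<Omega>. {x + y})"
    by (rule compact_closed_sums)
  moreover have "(\<Union>x\<in>?T. \<Union>y\<in>- \<Omega>. {x + y}) = - {x. \<forall>t\<in>{0..s}. x + t *\<^sub>R e \<in> \<Omega>}" (is "?L = ?R")
  proof
    show "?L \<subseteq> ?R" by auto
    show "?R \<subseteq> ?L"
    proof
      fix x assume "x \<in> ?R"
      then obtain t where "t \<in> {0..s}" "x + t *\<^sub>R e \<notin> \<Omega>" by auto
      then show "x \<in> ?L" by (auto intro!: bexI[of _ t] bexI[of _ "x + t *\<^sub>R e"])
    qed
  qed
  ultimately have "closed (- {x. \<forall>t\<in>{0..s}. x + t *\<^sub>R e \<in> \<Omega>})" by simp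
  then show ?thesis by (simp only: closed_def double_complement)
qed

text \<open>Fubini and the weak identity for the translates \<open>\<phi>(\<cdot> - t e)\<close> turn the fundamental theorem of
  calculus for the test function \<open>\<phi>\<close> into the one for \<open>f\<close>.\<close>

lemma weak_derivative_bump:
  fixes f g :: "'a::euclidean_space \<Rightarrow> real" and e :: 'a
  assumes [measurable]: "f \<in> borel_measurable borel" "g \<in> borel_measurable borel"
    and s: "0 \<le> s"
    and K: "K = (\<lambda>(x, t). x + t *\<^sub>R e) ` (cbox a b \<times> {0..s})" "K \<subseteq> \<Omega>"
    and f: "set_integrable lborel K f" and g: "set_integrable lborel K g"
    and weak: "\<And>\<psi>. test_function \<Omega> \<psi> \<Longrightarrow>
      (\<integral>x. f x * frechet_derivative \<psi> (at x) e \<partial>lborel) = - (\<integral>x. g x * \<psi> x \<partial>lborel)"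
  shows "(\<integral>x. box_bump N a b x * (f (x + s *\<^sub>R e) - f x) \<partial>lborel) =
    (\<integral>x. box_bump N a b x * (\<integral>t. indicator {0..s} t * (indicator (box a b) x * g (x + t *\<^sub>R e)) \<partial>lborel) \<partial>lborel)"
proof -
  let ?\<phi> = "box_bump N a b"
  have [measurable]: "?\<phi> \<in> borel_measurable borel"
    using tcd_imp_continuous[OF tcd_box_bump_shift[of 0 N a b 0]]
    by (simp add: borel_measurable_continuous_onI)
  obtain D C where D: "continuous_on UNIV D" "\<And>y. \<bar>D y\<bar> \<le> C" "\<And>y. y \<notin> cbox a b \<Longrightarrow> D y = 0"
    "\<And>u x. frechet_derivative (\<lambda>x. ?\<phi> (x - u)) (at x) e = D (x - u)"
    "\<And>x t. ((\<lambda>t. ?\<phi> (x - t *\<^sub>R e)) has_vector_derivative - D (x - t *\<^sub>R e)) (at t)"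
    by (rule box_bump_directional_derivative[of a b N e]) (rule that)
  have [measurable]: "D \<in> borel_measurable borel"
    using D(1) by (simp add: borel_measurable_continuous_onI)
  have "compact K"
    unfolding K by (intro compact_continuous_image compact_Times compact_cbox compact_Icc)
      (auto intro!: continuous_intros simp: case_prod_beta)
  then have [measurable]: "K \<in> sets borel" by (simp add: compact_imp_closed)
  have inK: "x + t *\<^sub>R e \<in> K" if "x \<in> cbox a b" "0 \<le> t" "t \<le> s" for x t
    using that unfolding K by force
  have boxK: "x + t *\<^sub>R e \<in> K" if "x \<in> box a b" "0 \<le> t" "t \<le> s" for x t
    using that inK box_subset_cbox[of a b] by blast
  have tf: "test_function \<Omega> (\<lambda>x. ?\<phi> (x - t *\<^sub>R e))" if "0 \<le> t" "t \<le> s" for t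
    using that inK K(2) by (intro test_function_box_bump) blast
  have fD_int: "integrable (lborel \<Otimes>\<^sub>M lborel) (\<lambda>(t, x). f x * (indicator {0..s} t * - D (x - t *\<^sub>R e)))"
  proof (rule Bochner_Integration.integrable_bound)
    let ?F = "\<lambda>(t::real, x). indicator {0..s} t * (indicator K x * (C * f x))"
    have "set_integrable lborel K (\<lambda>x. C * f x)" using f by simp
    \<comment> \<open>The tube lemma with direction 0: the dominating function does not move with
      \<open>t\<close>, because \<open>D (x - t *\<^sub>R e) \<noteq> 0\<close> already forces
      \<open>x \<in> K\<close>.\<close>
    then show "integrable (lborel \<Otimes>\<^sub>M lborel) ?F"
      using integrable_tube[of "\<lambda>x. C * f x" K K s 0] by simp
    show "AE z in lborel \<Otimes>\<^sub>M lborel.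
        norm (case z of (t, x) \<Rightarrow> f x * (indicator {0..s} t * - D (x - t *\<^sub>R e))) \<le> norm (?F z)"
    proof (rule AE_I2, clarify)
      fix t :: real and x :: 'a
      show "norm (f x * (indicator {0..s} t * - D (x - t *\<^sub>R e)))
        \<le> norm (indicator {0..s} t * (indicator K x * (C * f x)))"
      proof (cases "t \<in> {0..s} \<and> D (x - t *\<^sub>R e) \<noteq> 0")
        case True
        then have "x - t *\<^sub>R e \<in> cbox a b" using D(3) by blast
        then have "x \<in> K" using inK[of "x - t *\<^sub>R e" t] True by simp
        moreover have "\<bar>D (x - t *\<^sub>R e)\<bar> \<le> \<bar>C\<bar>" using D(2)[of "x - t *\<^sub>R e"] by linarith
        ultimately show ?thesis
          using True mult_left_mono[of "\<bar>D (x - t *\<^sub>R e)\<bar>" "\<bar>C\<bar>" "\<bar>f x\<bar>"]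
          by (simp add: abs_mult mult.commute[of "\<bar>C\<bar>"])
      qed (auto simp: indicator_def)
    qed
  qed measurable
  have g_int: "integrable (lborel \<Otimes>\<^sub>M lborel)
      (\<lambda>(t, x). indicator {0..s} t * (indicator (box a b) x * g (x + t *\<^sub>R e)))"
    using boxK g by (intro integrable_tube) auto
  \<comment> \<open>The indicator hidden in the bump is made explicit, because the translates of
    \<open>g\<close> are controlled only over the box.\<close>
  have \<phi>0: "?\<phi> x = indicator (box a b) x * ?\<phi> x" for x
    using box_bump_eq_0[of x a b N] by (auto simp: indicator_def)
  have \<phi>_le: "\<bar>?\<phi> x\<bar> \<le> 1" for x
    using box_bump_nonneg[of N a b x] box_bump_le_1[of N a b x] by simp
  have g\<phi>_int: "integrable (lborel \<Otimes>\<^sub>M lborel)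
      (\<lambda>(t, x). ?\<phi> x * (indicator {0..s} t * (indicator (box a b) x * g (x + t *\<^sub>R e))))"
  proof (rule Bochner_Integration.integrable_bound[OF g_int])
    show "AE z in lborel \<Otimes>\<^sub>M lborel.
      norm (case z of (t, x) \<Rightarrow> ?\<phi> x * (indicator {0..s} t * (indicator (box a b) x * g (x + t *\<^sub>R e))))
      \<le> norm (case z of (t, x) \<Rightarrow> indicator {0..s} t * (indicator (box a b) x * g (x + t *\<^sub>R e)))"
      using \<phi>_le by (intro AE_I2) (auto simp: abs_mult intro!: mult_left_le_one_le)
  qed measurable
  have f\<phi>_int: "integrable lborel (\<lambda>x. f x * ?\<phi> (x - t *\<^sub>R e))" if t: "0 \<le> t" "t \<le> s" for t
  proof (rule Bochner_Integration.integrable_bound)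
    show "integrable lborel (\<lambda>x. indicator K x *\<^sub>R f x)" using f by (simp add: set_integrable_def)
    show "AE x in lborel. norm (f x * ?\<phi> (x - t *\<^sub>R e)) \<le> norm (indicator K x *\<^sub>R f x)"
    proof (rule AE_I2)
      fix x
      show "norm (f x * ?\<phi> (x - t *\<^sub>R e)) \<le> norm (indicator K x *\<^sub>R f x)"
      proof (cases "x \<in> K")
        case False
        then have "x - t *\<^sub>R e \<notin> box a b" using boxK[of "x - t *\<^sub>R e" t] t by auto
        then show ?thesis using box_bump_eq_0[of "x - t *\<^sub>R e" a b N] by simp
      qed (use \<phi>_le in \<open>auto simp: abs_mult mult_left_le\<close>)
    qed
  qed measurable
  have ftc: "(\<integral>t. indicator {0..s} t *\<^sub>R - D (x - t *\<^sub>R e) \<partial>lborel) = ?\<phi> (x - s *\<^sub>R e) - ?\<phi> (x - 0 *\<^sub>R e)" for x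
  proof (rule integral_FTC_Icc[OF s])
    show "continuous_on {0..s} (\<lambda>t. - D (x - t *\<^sub>R e))"
      by (intro continuous_intros continuous_on_compose2[OF D(1)]) auto
  qed (rule has_vector_derivative_at_within[OF D(5)])
  have fs: "integrable lborel (\<lambda>x. ?\<phi> x * f (x + s *\<^sub>R e))"
    using f\<phi>_int[of s] integrable_lborel_shift[of "\<lambda>x. f x * ?\<phi> (x - s *\<^sub>R e)" "s *\<^sub>R e"] s
    by (simp add: mult.commute)
  have f0: "integrable lborel (\<lambda>x. ?\<phi> x * f x)"
    using f\<phi>_int[of 0] s by (simp add: mult.commute)
  have "(\<integral>x. ?\<phi> x * (f (x + s *\<^sub>R e) - f x) \<partial>lborel)
     = (\<integral>x. ?\<phi> x * f (x + s *\<^sub>R e) \<partial>lborel) - (\<integral>x. ?\<phi> x * f x \<partial>lborel)"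
    using fs f0 by (simp add: right_diff_distrib)
  also have "(\<integral>x. ?\<phi> x * f (x + s *\<^sub>R e) \<partial>lborel) = (\<integral>x. f x * ?\<phi> (x - s *\<^sub>R e) \<partial>lborel)"
    using integral_lborel_shift[of "\<lambda>x. f x * ?\<phi> (x - s *\<^sub>R e)" "s *\<^sub>R e"] by (simp add: mult.commute)
  also have "\<dots> - (\<integral>x. ?\<phi> x * f x \<partial>lborel) = (\<integral>x. f x * (?\<phi> (x - s *\<^sub>R e) - ?\<phi> (x - 0 *\<^sub>R e)) \<partial>lborel)"
    using f\<phi>_int[of s] f0 s by (simp add: right_diff_distrib mult.commute)
  \<comment> \<open>The difference now falls on the smooth bump, where the classical fundamental
    theorem applies. After Fubini each slice is a weak identity for one translate.\<close>
  also have "\<dots> = (\<integral>x. \<integral>t. f x * (indicator {0..s} t * - D (x - t *\<^sub>R e)) \<partial>lborel \<partial>lborel)"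
    unfolding ftc[symmetric] by simp
  also have "\<dots> = (\<integral>t. \<integral>x. f x * (indicator {0..s} t * - D (x - t *\<^sub>R e)) \<partial>lborel \<partial>lborel)"
    by (rule lborel_pair.Fubini_integral[OF fD_int])
  also have "\<dots> = (\<integral>t. \<integral>x. ?\<phi> x * (indicator {0..s} t * (indicator (box a b) x * g (x + t *\<^sub>R e))) \<partial>lborel \<partial>lborel)"
  proof (rule Bochner_Integration.integral_cong[OF refl])
    fix t :: real
    show "(\<integral>x. f x * (indicator {0..s} t * - D (x - t *\<^sub>R e)) \<partial>lborel) =
      (\<integral>x. ?\<phi> x * (indicator {0..s} t * (indicator (box a b) x * g (x + t *\<^sub>R e))) \<partial>lborel)"
    proof (cases "t \<in> {0..s}")
      case True
      then have "(\<integral>x. f x * (indicator {0..s} t * - D (x - t *\<^sub>R e)) \<partial>lborel) = (\<integral>x. g x * ?\<phi> (x - t *\<^sub>R e) \<partial>lborel)"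
        using weak[OF tf[of t]] by (simp add: D(4))
      also have "\<dots> = (\<integral>x. g (x + t *\<^sub>R e) * ?\<phi> x \<partial>lborel)"
        using integral_lborel_shift[of "\<lambda>x. g x * ?\<phi> (x - t *\<^sub>R e)" "t *\<^sub>R e"] by simp
      also have "\<dots> = (\<integral>x. ?\<phi> x * (indicator (box a b) x * g (x + t *\<^sub>R e)) \<partial>lborel)"
        by (rule Bochner_Integration.integral_cong[OF refl]) (subst \<phi>0, simp add: mult_ac indicator_def)
      finally show ?thesis using True by simp
    qed simp
  qed
  also have "\<dots> = (\<integral>x. \<integral>t. ?\<phi> x * (indicator {0..s} t * (indicator (box a b) x * g (x + t *\<^sub>R e))) \<partial>lborel \<partial>lborel)"
    by (rule lborel_pair.Fubini_integral[symmetric]) (use g\<phi>_int in simp)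
  finally show ?thesis by simp
qed

text \<open>As the bumps tend to the indicator of a box, the identity for bumps says that difference
  minus line integral has vanishing box integrals. The admissible base points form an open set, so
  the function vanishes almost everywhere there.\<close>

lemma weak_derivative_segment_bound:
  fixes f g :: "'a::euclidean_space \<Rightarrow> real" and e :: 'a
  assumes "open \<Omega>" and f_meas [measurable]: "f \<in> borel_measurable borel"
    and g_meas [measurable]: "g \<in> borel_measurable borel"
    and s: "0 \<le> s"
    and f: "\<And>K. compact K \<Longrightarrow> K \<subseteq> \<Omega> \<Longrightarrow> set_integrable lborel K f"
    and g: "\<And>K. compact K \<Longrightarrow> K \<subseteq> \<Omega> \<Longrightarrow> set_integrable lborel K g"
    and weak: "\<And>\<psi>. test_function \<Omega> \<psi> \<Longrightarrow>
      (\<integral>x. f x * frechet_derivative \<psi> (at x) e \<partial>lborel) = - (\<integral>x. g x * \<psi> x \<partial>lborel)"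
  shows "AE x in lborel. (\<forall>t\<in>{0..s}. x + t *\<^sub>R e \<in> \<Omega>) \<longrightarrow>
    ennreal \<bar>f (x + s *\<^sub>R e) - f x\<bar> \<le> (\<integral>\<^sup>+t\<in>{0..s}. ennreal \<bar>g (x + t *\<^sub>R e)\<bar> \<partial>lborel)"
proof -
  let ?V = "{x. \<forall>t\<in>{0..s}. x + t *\<^sub>R e \<in> \<Omega>}"
  define J where "J x = (\<integral>t. indicator {0..s} t * g (x + t *\<^sub>R e) \<partial>lborel)" for x
  define h where "h x = (f (x + s *\<^sub>R e) - f x) - J x" for x
  have box: "set_integrable lborel (box a b) h \<and> (LINT x:box a b|lborel. h x) = 0"
    if ab: "cbox a b \<subseteq> ?V" for a b
  proof -
    let ?B = "box a b"
    define K where "K = (\<lambda>(x, t). x + t *\<^sub>R e) ` (cbox a b \<times> {0..s})"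
    have "compact K"
      unfolding K_def by (intro compact_continuous_image compact_Times compact_cbox compact_Icc)
        (auto intro!: continuous_intros simp: case_prod_beta)
    then have [measurable]: "K \<in> sets borel" by (simp add: compact_imp_closed)
    have K: "K \<subseteq> \<Omega>" using ab unfolding K_def by auto
    note fK = f[OF \<open>compact K\<close> K] and gK = g[OF \<open>compact K\<close> K]
    have inK: "x + t *\<^sub>R e \<in> K" if "x \<in> ?B" "0 \<le> t" "t \<le> s" for x t
      using that box_subset_cbox[of a b] unfolding K_def by force
    have shift_int: "integrable lborel (\<lambda>x. indicator ?B x * f (x + t *\<^sub>R e))" if t: "0 \<le> t" "t \<le> s" for t
    proof (rule Bochner_Integration.integrable_bound)
      show "integrable lborel (\<lambda>x. indicator K (x + t *\<^sub>R e) *\<^sub>R f (x + t *\<^sub>R e))"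
        using fK integrable_lborel_shift[of "\<lambda>x. indicator K x *\<^sub>R f x" "t *\<^sub>R e"]
        by (simp add: set_integrable_def)
      show "AE x in lborel. norm (indicator ?B x * f (x + t *\<^sub>R e))
          \<le> norm (indicator K (x + t *\<^sub>R e) *\<^sub>R f (x + t *\<^sub>R e))"
        using inK t by (intro AE_I2) (auto simp: indicator_def)
    qed measurable
    have diff_int: "integrable lborel (\<lambda>x. indicator ?B x * (f (x + s *\<^sub>R e) - f x))"
      using shift_int[of s] shift_int[of 0] s by (simp add: right_diff_distrib)
    have JB: "indicator ?B x * J x = (\<integral>t. indicator {0..s} t * (indicator ?B x * g (x + t *\<^sub>R e)) \<partial>lborel)" for x
      by (simp add: J_def indicator_def)
    have J_int: "integrable lborel (\<lambda>x. indicator ?B x * J x)"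
      unfolding JB by (rule lborel_pair.integrable_snd)
        (use integrable_tube[OF g_meas _ _ inK gK, of ?B] in simp)
    have h_eq: "indicator ?B x *\<^sub>R h x = indicator ?B x * (f (x + s *\<^sub>R e) - f x) - indicator ?B x * J x" for x
      by (simp add: h_def right_diff_distrib)
    have h_int: "integrable lborel (\<lambda>x. indicator ?B x *\<^sub>R h x)"
      unfolding h_eq using diff_int J_int by (rule Bochner_Integration.integrable_diff)
    have \<phi>_le: "\<bar>box_bump N a b x\<bar> \<le> 1" for N x
      using box_bump_nonneg[of N a b x] box_bump_le_1[of N a b x] by simp
    have [measurable]: "box_bump N a b \<in> borel_measurable borel" for N
      using tcd_imp_continuous[OF tcd_box_bump_shift[of 0 N a b 0]]
      by (simp add: borel_measurable_continuous_onI)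
    have \<phi>_int: "integrable lborel (\<lambda>x. box_bump N a b x * u x)" if u: "integrable lborel u" for N and u :: "'a \<Rightarrow> real"
      by (rule Bochner_Integration.integrable_bound[OF u])
         (use u \<phi>_le in \<open>auto simp: abs_mult intro!: mult_left_le_one_le\<close>)
    have \<phi>_zero: "(\<integral>x. box_bump N a b x * (indicator ?B x *\<^sub>R h x) \<partial>lborel) = 0" for N
    proof -
      have \<phi>0: "box_bump N a b x * (indicator ?B x * u) = box_bump N a b x * u" for x u
        using box_bump_eq_0[of x a b N] by (auto simp: indicator_def)
      have "(\<integral>x. box_bump N a b x * (indicator ?B x *\<^sub>R h x) \<partial>lborel)
        = (\<integral>x. box_bump N a b x * (indicator ?B x * (f (x + s *\<^sub>R e) - f x)) \<partial>lborel)
          - (\<integral>x. box_bump N a b x * (indicator ?B x * J x) \<partial>lborel)"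
        unfolding h_eq right_diff_distrib[of "box_bump N a b _" "indicator ?B _ * (f (_ + s *\<^sub>R e) - f _)"]
        by (intro Bochner_Integration.integral_diff \<phi>_int diff_int J_int)
      also have "(\<integral>x. box_bump N a b x * (indicator ?B x * (f (x + s *\<^sub>R e) - f x)) \<partial>lborel)
        = (\<integral>x. box_bump N a b x * (indicator ?B x * J x) \<partial>lborel)"
        unfolding JB \<phi>0
        by (rule weak_derivative_bump[OF f_meas g_meas s K_def K fK gK weak])
      finally show ?thesis by simp
    qed
    have "(\<lambda>N. \<integral>x. box_bump N a b x * (indicator ?B x *\<^sub>R h x) \<partial>lborel)
        \<longlonglongrightarrow> (\<integral>x. indicator ?B x *\<^sub>R h x \<partial>lborel)"
    proof (rule integral_dominated_convergence[where w="\<lambda>x. norm (indicator ?B x *\<^sub>R h x)"])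
      show "AE x in lborel. (\<lambda>N. box_bump N a b x * (indicator ?B x *\<^sub>R h x)) \<longlonglongrightarrow> indicator ?B x *\<^sub>R h x"
      proof (rule AE_I2)
        fix x
        have "(\<lambda>N. box_bump N a b x * (indicator ?B x *\<^sub>R h x))
            \<longlonglongrightarrow> indicator ?B x * (indicator ?B x *\<^sub>R h x)"
          by (intro tendsto_mult_right box_bump_tendsto)
        then show "(\<lambda>N. box_bump N a b x * (indicator ?B x *\<^sub>R h x)) \<longlonglongrightarrow> indicator ?B x *\<^sub>R h x"
          by (cases "x \<in> ?B") simp_all
      qed
      show "AE x in lborel. norm (box_bump N a b x * (indicator ?B x *\<^sub>R h x)) \<le> norm (indicator ?B x *\<^sub>R h x)" for N
        using \<phi>_le by (intro AE_I2) (auto simp: abs_mult intro!: mult_left_le_one_le)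
      show "(\<lambda>x. box_bump N a b x * (indicator ?B x *\<^sub>R h x)) \<in> borel_measurable lborel" for N
        using \<phi>_int[OF h_int] by (rule borel_measurable_integrable)
    qed (use h_int in auto)
    then have "(\<integral>x. indicator ?B x *\<^sub>R h x \<partial>lborel) = 0"
      unfolding \<phi>_zero by (simp add: LIMSEQ_const_iff)
    then show ?thesis using h_int by (simp add: set_integrable_def set_lebesgue_integral_def)
  qed
  have "AE x in lborel. x \<in> ?V \<longrightarrow> h x = 0"
    using open_segments_inside[OF \<open>open \<Omega>\<close>] box by (intro AE_zero_on_open) blast+
  then show ?thesis
  proof eventually_elim
    fix x assume h: "x \<in> ?V \<longrightarrow> h x = 0"
    show "(\<forall>t\<in>{0..s}. x + t *\<^sub>R e \<in> \<Omega>) \<longrightarrow>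
      ennreal \<bar>f (x + s *\<^sub>R e) - f x\<bar> \<le> (\<integral>\<^sup>+t\<in>{0..s}. ennreal \<bar>g (x + t *\<^sub>R e)\<bar> \<partial>lborel)"
    proof
      assume "\<forall>t\<in>{0..s}. x + t *\<^sub>R e \<in> \<Omega>"
      with h have eq: "f (x + s *\<^sub>R e) - f x = J x" by (simp add: h_def)
      have "ennreal \<bar>J x\<bar> \<le> (\<integral>\<^sup>+t. ennreal (norm (indicator {0..s} t * g (x + t *\<^sub>R e))) \<partial>lborel)"
      \<comment> \<open>Where \<open>g\<close> is not integrable along the segment, the Bochner
        integral \<open>J x\<close> is 0 by convention and the bound is trivial.\<close>
      proof (cases "integrable lborel (\<lambda>t. indicator {0..s} t * g (x + t *\<^sub>R e))")
        case True
        then show ?thesis unfolding J_def real_norm_def[symmetric] by (rule integral_norm_bound_ennreal)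
      qed (simp add: J_def not_integrable_integral_eq)
      also have "\<dots> = (\<integral>\<^sup>+t\<in>{0..s}. ennreal \<bar>g (x + t *\<^sub>R e)\<bar> \<partial>lborel)"
        by (intro nn_integral_cong) (auto simp: indicator_def)
      finally show "ennreal \<bar>f (x + s *\<^sub>R e) - f x\<bar> \<le> (\<integral>\<^sup>+t\<in>{0..s}. ennreal \<bar>g (x + t *\<^sub>R e)\<bar> \<partial>lborel)"
        unfolding eq .
    qed
  qed
qed

text \<open>\<open>G\<close> plays the role of \<open>\<bar>\<nabla>f\<bar>\<close>. The null set may depend on \<open>e\<close> and \<open>s\<close>, so no representative of \<open>f\<close>
  that is absolutely continuous on lines is needed.\<close>

definition upper_gradient :: "'a::euclidean_space set \<Rightarrow> ('a \<Rightarrow> real) \<Rightarrow> ('a \<Rightarrow> real) \<Rightarrow> bool" where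
  "upper_gradient \<Omega> f G \<longleftrightarrow>
     f \<in> borel_measurable borel \<and> G \<in> borel_measurable borel \<and> (\<forall>x. 0 \<le> G x) \<and>
     (\<forall>e s. 0 \<le> s \<longrightarrow> (AE x in lborel. (\<forall>t\<in>{0..s}. x + t *\<^sub>R e \<in> \<Omega>) \<longrightarrow>
        ennreal \<bar>f (x + s *\<^sub>R e) - f x\<bar> \<le>
          (\<integral>\<^sup>+t\<in>{0..s}. ennreal (norm e * G (x + t *\<^sub>R e)) \<partial>lborel)))"

section \<open>From weak gradients to upper gradients\<close>

lemma upper_gradient_diff_const:
  "upper_gradient \<Omega> f G \<Longrightarrow> upper_gradient \<Omega> (\<lambda>x. f x - c) G"
  unfolding upper_gradient_def
  by (elim conjE, intro conjI borel_measurable_diff borel_measurable_const) simp_all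

text \<open>Measurability is glued from countably many closed boxes exhausting \<Omega> and from the
  complement, where the function is 0.\<close>

lemma locally_integrable_imp_measurable:
  fixes u :: "'a::euclidean_space \<Rightarrow> 'b::{banach, second_countable_topology}"
  assumes "open \<Omega>" "locally_integrable \<Omega> u"
  shows "(\<lambda>x. indicator \<Omega> x *\<^sub>R u x) \<in> borel_measurable lebesgue"
proof -
  obtain D where D: "countable D" "\<And>X. X \<in> D \<Longrightarrow> \<exists>a b. X = cbox a b" "\<Union>D = \<Omega>"
    using open_countable_Union_open_cbox[OF \<open>open \<Omega>\<close>] by metis
  have restr: "(\<lambda>x. indicator \<Omega> x *\<^sub>R u x) \<in> borel_measurable (restrict_space lebesgue X)"
    if "X \<in> insert (- \<Omega>) D" for X
  proof (cases "X = - \<Omega>")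
    case True
    have "(\<lambda>x. 0) \<in> borel_measurable (restrict_space lebesgue X)" by simp
    then show ?thesis
      by (rule measurable_cong[THEN iffD1, rotated]) (auto simp: space_restrict_space True)
  next
    case False
    with that D obtain a b where X: "X = cbox a b" "X \<subseteq> \<Omega>" by blast
    then have "set_integrable lebesgue X u"
      using assms(2) by (simp add: locally_integrable_def)
    then have "(\<lambda>x. indicator X x *\<^sub>R u x) \<in> borel_measurable lebesgue"
      by (auto simp: set_integrable_def)
    then have "u \<in> borel_measurable (restrict_space lebesgue X)"
      using X by (subst borel_measurable_restrict_space_iff) auto
    then show ?thesis
      by (rule measurable_cong[THEN iffD1, rotated]) (use X in \<open>auto simp: space_restrict_space\<close>)
  qed
  have sets: "X \<inter> space lebesgue \<in> sets lebesgue" if "X \<in> insert (- \<Omega>) D" for X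
  proof (cases "X = - \<Omega>")
    case False
    with that obtain a b where "X = cbox a b" using D(2) by blast
    then show ?thesis by simp
  qed (use \<open>open \<Omega>\<close> in simp)
  have cover: "space lebesgue \<subseteq> \<Union>(insert (- \<Omega>) D)"
    using D(3) by auto
  have "countable (insert (- \<Omega>) D)" using D(1) by simp
  from measurable_piecewise_restrict[OF this sets cover restr] show ?thesis by blast
qed

lemma directional_derivative_bounded:
  assumes "test_function \<Omega> \<psi>"
  obtains C where "\<And>x. \<bar>frechet_derivative \<psi> (at x) e\<bar> \<le> C"
    "\<And>x. x \<notin> closure {x. \<psi> x \<noteq> 0} \<Longrightarrow> frechet_derivative \<psi> (at x) e = 0"
    "continuous_on UNIV (\<lambda>x. frechet_derivative \<psi> (at x) e)"
proof -
  let ?K = "closure {x. \<psi> x \<noteq> 0}"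
  define D where "D x = frechet_derivative \<psi> (at x) e" for x
  have tcd: "times_cont_diff (Suc 0) \<psi>" and K: "compact ?K"
    using assms unfolding test_function_def by blast+
  have cont: "continuous_on UNIV D" using tcd by (simp add: D_def)
  have zero: "D x = 0" if "x \<notin> ?K" for x
  proof -
    have "(\<psi> has_derivative (\<lambda>_. 0)) (at x)"
    proof (rule has_derivative_transform_within_open)
      show "((\<lambda>_. 0::real) has_derivative (\<lambda>_. 0)) (at x)" by simp
      show "open (- ?K)" by (simp add: open_Compl)
      show "x \<in> - ?K" using that by simp
      show "0 = \<psi> y" if "y \<in> - ?K" for y
        using that closure_subset[of "{x. \<psi> x \<noteq> 0}"] by auto
    qed
    from frechet_derivative_at[OF this] show ?thesis by (metis D_def)
  qed
  have "compact (D ` ?K)"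
    using cont by (intro compact_continuous_image K) (rule continuous_on_subset, auto)
  then obtain C where C: "\<And>x. x \<in> ?K \<Longrightarrow> \<bar>D x\<bar> \<le> C"
    using compact_imp_bounded[of "D ` ?K"] by (auto simp: bounded_iff)
  have "\<bar>D x\<bar> \<le> max C 0" for x
    using C[of x] zero[of x] by (cases "x \<in> ?K") auto
  then show ?thesis using that zero cont unfolding D_def by blast
qed

text \<open>The later Fubini and translation arguments take place on \<open>lborel\<close>, so
  Lebesgue measurable data are replaced by Borel representatives. These represent the extensions by
  0, which turns integrals over \<Omega> into integrals over the whole space.\<close>

lemma weak_gradient_imp_upper_gradient:
  fixes f :: "real^'n \<Rightarrow> real"
  assumes "open \<Omega>" and weak: "has_weak_gradient f g \<Omega>"
  obtains f' G where "upper_gradient \<Omega> f' G"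
    "AE x in lborel. x \<in> \<Omega> \<longrightarrow> f x = f' x \<and> norm (g x) = G x"
proof -
  have lf: "locally_integrable \<Omega> f" and lg: "locally_integrable \<Omega> g"
    using weak by (auto simp: has_weak_gradient_def)
  have fm: "(\<lambda>x. indicator \<Omega> x *\<^sub>R f x) \<in> borel_measurable lebesgue"
    and gm: "(\<lambda>x. indicator \<Omega> x *\<^sub>R g x) \<in> borel_measurable lebesgue"
    using locally_integrable_imp_measurable[OF \<open>open \<Omega>\<close>] lf lg by blast+
  obtain f' where f'[measurable]: "f' \<in> borel_measurable lborel"
    and ae_f: "AE x in lborel. indicator \<Omega> x *\<^sub>R f x = f' x"
    using completion_ex_borel_measurable_real[OF fm] by blast
  have "\<forall>i. \<exists>u\<in>borel_measurable lborel. AE x in lborel. (indicator \<Omega> x *\<^sub>R g x) $ i = u x"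
  proof
    fix i
    have "(\<lambda>x. (indicator \<Omega> x *\<^sub>R g x) $ i) \<in> borel_measurable lebesgue"
      using borel_measurable_inner[OF gm borel_measurable_const[of "axis i 1"]]
      by (simp add: inner_axis)
    then show "\<exists>u\<in>borel_measurable lborel. AE x in lborel. (indicator \<Omega> x *\<^sub>R g x) $ i = u x"
      by (rule completion_ex_borel_measurable_real)
  qed
  then obtain u where u[measurable]: "\<And>i. u i \<in> borel_measurable lborel"
    and ae_u: "\<And>i. AE x in lborel. (indicator \<Omega> x *\<^sub>R g x) $ i = u i x"
    by metis
  define g' where "g' x = (\<chi> i. u i x)" for x
  have "AE x in lborel. \<forall>i. (indicator \<Omega> x *\<^sub>R g x) $ i = u i x"
    using ae_u by (simp add: AE_all_countable)
  then have ae_g: "AE x in lborel. indicator \<Omega> x *\<^sub>R g x = g' x"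
    by eventually_elim (simp add: g'_def vec_eq_iff)
  have [measurable]: "g' \<in> borel_measurable borel"
  proof (rule borel_measurable_euclidean_space[THEN iffD2], rule ballI)
    fix b :: "real^'n" assume "b \<in> Basis"
    then obtain i where "b = axis i 1" by (auto simp: Basis_vec_def)
    then have "(\<lambda>x. g' x \<bullet> b) = u i" by (auto simp: g'_def inner_axis)
    then show "(\<lambda>x. g' x \<bullet> b) \<in> borel_measurable borel" using u[of i] by simp
  qed
  have f'_int: "set_integrable lborel K f'" and g'_int: "set_integrable lborel K g'"
    if K: "compact K" "K \<subseteq> \<Omega>" for K
  proof -
    have [measurable]: "K \<in> sets borel" using K by (simp add: compact_imp_closed)
    have "integrable lebesgue (\<lambda>x. indicator K x *\<^sub>R f' x) \<longleftrightarrow> integrable lebesgue (\<lambda>x. indicator K x *\<^sub>R f x)"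
    proof (rule integrable_cong_AE)
      show "(\<lambda>x. indicator K x *\<^sub>R f x) \<in> borel_measurable lebesgue"
        using lf K by (auto simp: locally_integrable_def set_integrable_def)
      show "AE x in lebesgue. indicator K x *\<^sub>R f' x = indicator K x *\<^sub>R f x"
        using AE_completion[OF ae_f] by eventually_elim (use K in \<open>auto simp: indicator_def split: if_splits\<close>)
    qed (intro measurable_completion, measurable)
    then show "set_integrable lborel K f'"
      using lf K by (simp add: locally_integrable_def set_integrable_def integrable_completion)
    have "integrable lebesgue (\<lambda>x. indicator K x *\<^sub>R g' x) \<longleftrightarrow> integrable lebesgue (\<lambda>x. indicator K x *\<^sub>R g x)"
    proof (rule integrable_cong_AE)
      show "(\<lambda>x. indicator K x *\<^sub>R g x) \<in> borel_measurable lebesgue"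
        using lg K by (auto simp: locally_integrable_def set_integrable_def)
      show "AE x in lebesgue. indicator K x *\<^sub>R g' x = indicator K x *\<^sub>R g x"
        using AE_completion[OF ae_g] by eventually_elim (use K in \<open>auto simp: indicator_def split: if_splits\<close>)
    qed (intro measurable_completion, measurable)
    then show "set_integrable lborel K g'"
      using lg K by (simp add: locally_integrable_def set_integrable_def integrable_completion)
  qed
  have main: "(\<integral>x. f' x * frechet_derivative \<psi> (at x) e \<partial>lborel) = - (\<integral>x. (g' x \<bullet> e) * \<psi> x \<partial>lborel)"
    if tf: "test_function \<Omega> \<psi>" for \<psi> e
  proof -
    let ?D = "\<lambda>x. frechet_derivative \<psi> (at x)"
    let ?K = "closure {x. \<psi> x \<noteq> 0}"
    have K: "compact ?K" "?K \<subseteq> \<Omega>" and tcd: "times_cont_diff (Suc 0) \<psi>" "times_cont_diff 0 \<psi>"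
      using tf unfolding test_function_def by blast+
    have \<psi>0: "x \<notin> ?K \<Longrightarrow> \<psi> x = 0" for x using closure_subset[of "{x. \<psi> x \<noteq> 0}"] by auto
    have [measurable]: "\<psi> \<in> borel_measurable borel"
      using tcd(2) by (simp add: borel_measurable_continuous_onI)
    have lin: "linear (?D x)" for x
      using tcd_Suc_has_derivative[OF tcd(1)] has_derivative_linear by blast
    have D0: "x \<notin> ?K \<Longrightarrow> ?D x v = 0" for x v
      using directional_derivative_bounded[OF tf, of v] by metis
    have Dm[measurable]: "(\<lambda>x. ?D x v) \<in> borel_measurable borel" for v
      using directional_derivative_bounded[OF tf, of v]
      by (metis borel_measurable_continuous_onI)
    have fD_int: "integrable lborel (\<lambda>x. f' x * ?D x v)" for v
    proof -
      obtain C where C: "\<And>x. \<bar>?D x v\<bar> \<le> C" using directional_derivative_bounded[OF tf, of v] by metis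
      show ?thesis
      proof (rule Bochner_Integration.integrable_bound)
        show "integrable lborel (\<lambda>x. C * (indicator ?K x *\<^sub>R f' x))"
          using f'_int[OF K] by (simp add: set_integrable_def)
        show "AE x in lborel. norm (f' x * ?D x v) \<le> norm (C * (indicator ?K x *\<^sub>R f' x))"
        proof (rule AE_I2)
          fix x
          have "\<bar>?D x v\<bar> \<le> \<bar>C\<bar>" using C[of x] by linarith
          then show "norm (f' x * ?D x v) \<le> norm (C * (indicator ?K x *\<^sub>R f' x))"
            using D0[of x v] mult_left_mono[of "\<bar>?D x v\<bar>" "\<bar>C\<bar>" "\<bar>f' x\<bar>"]
            by (cases "x \<in> ?K") (auto simp: abs_mult mult.commute[of "\<bar>C\<bar>"])
        qed
      qed measurable
    qed
    have g\<psi>_int: "integrable lborel (\<lambda>x. g' x $ i * \<psi> x)" for i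
    proof -
      have "compact (\<psi> ` ?K)"
        using tcd(2) by (intro compact_continuous_image K) (auto intro: continuous_on_subset)
      then obtain C where C: "\<And>x. x \<in> ?K \<Longrightarrow> \<bar>\<psi> x\<bar> \<le> C"
        using compact_imp_bounded[of "\<psi> ` ?K"] by (auto simp: bounded_iff)
      show ?thesis
      proof (rule Bochner_Integration.integrable_bound)
        show "integrable lborel (\<lambda>x. C *\<^sub>R (indicator ?K x *\<^sub>R g' x))"
          using g'_int[OF K] by (intro integrable_scaleR_right) (simp add: set_integrable_def)
        have "(\<lambda>x. g' x $ i) = (\<lambda>x. g' x \<bullet> axis i 1)" by (simp add: inner_axis)
        then have [measurable]: "(\<lambda>x. g' x $ i) \<in> borel_measurable borel" by simp
        show "(\<lambda>x. g' x $ i * \<psi> x) \<in> borel_measurable lborel" by measurable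
        show "AE x in lborel. norm (g' x $ i * \<psi> x) \<le> norm (C *\<^sub>R (indicator ?K x *\<^sub>R g' x))"
        proof (rule AE_I2)
          fix x
          show "norm (g' x $ i * \<psi> x) \<le> norm (C *\<^sub>R (indicator ?K x *\<^sub>R g' x))"
          proof (cases "x \<in> ?K")
            case True
            then have "\<bar>g' x $ i\<bar> * \<bar>\<psi> x\<bar> \<le> norm (g' x) * \<bar>C\<bar>"
              using C[OF True] component_le_norm_cart[of "g' x" i] by (intro mult_mono) auto
            then show ?thesis using True by (simp add: abs_mult mult.commute)
          next
            case False
            then have "\<psi> x = 0" by (rule \<psi>0)
            then show ?thesis by simp
          qed
        qed
      qed
    qed
    have axis: "(\<integral>x. f' x * ?D x (axis i 1) \<partial>lborel) = - (\<integral>x. g' x $ i * \<psi> x \<partial>lborel)" for i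
    proof -
      have "(\<integral>x. f' x * ?D x (axis i 1) \<partial>lborel) = (\<integral>x. f' x * ?D x (axis i 1) \<partial>lebesgue)"
        by (rule integral_completion[symmetric, OF borel_measurable_integrable[OF fD_int]])
      also have "\<dots> = (LINT x:\<Omega>|lebesgue. f x * ?D x (axis i 1))"
        unfolding set_lebesgue_integral_def
      proof (rule integral_cong_AE)
        show 1: "(\<lambda>x. f' x * ?D x (axis i 1)) \<in> borel_measurable lebesgue"
          by (intro measurable_completion, measurable)
        have "(\<lambda>x. (indicator \<Omega> x *\<^sub>R f x) * ?D x (axis i 1)) \<in> borel_measurable lebesgue"
          by (intro borel_measurable_times fm) (intro measurable_completion, measurable)
        then show "(\<lambda>x. indicator \<Omega> x *\<^sub>R (f x * ?D x (axis i 1))) \<in> borel_measurable lebesgue"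
          by (simp add: mult.assoc)
        show "AE x in lebesgue. f' x * ?D x (axis i 1) = indicator \<Omega> x *\<^sub>R (f x * ?D x (axis i 1))"
          using AE_completion[OF ae_f] by eventually_elim auto
      qed
      also have "\<dots> = - (LINT x:\<Omega>|lebesgue. g x $ i * \<psi> x)"
        using weak tf unfolding has_weak_gradient_def by blast
      also have "(LINT x:\<Omega>|lebesgue. g x $ i * \<psi> x) = (\<integral>x. g' x $ i * \<psi> x \<partial>lebesgue)"
        unfolding set_lebesgue_integral_def
      proof (rule integral_cong_AE)
        show "(\<lambda>x. g' x $ i * \<psi> x) \<in> borel_measurable lebesgue"
          by (rule measurable_completion[OF borel_measurable_integrable[OF g\<psi>_int]])
        have "(\<lambda>x. ((indicator \<Omega> x *\<^sub>R g x) \<bullet> axis i 1) * \<psi> x) \<in> borel_measurable lebesgue"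
          by (intro borel_measurable_times borel_measurable_inner gm borel_measurable_const)
             (intro measurable_completion, measurable)
        then show "(\<lambda>x. indicator \<Omega> x *\<^sub>R (g x $ i * \<psi> x)) \<in> borel_measurable lebesgue"
          by (simp add: inner_axis mult.assoc)
        show "AE x in lebesgue. indicator \<Omega> x *\<^sub>R (g x $ i * \<psi> x) = g' x $ i * \<psi> x"
          using AE_completion[OF ae_g]
        proof eventually_elim
          fix x assume "indicator \<Omega> x *\<^sub>R g x = g' x"
          then show "indicator \<Omega> x *\<^sub>R (g x $ i * \<psi> x) = g' x $ i * \<psi> x"
            by (metis mult.assoc real_scaleR_def vector_scaleR_component)
        qed
      qed
      also have "\<dots> = (\<integral>x. g' x $ i * \<psi> x \<partial>lborel)"
        by (rule integral_completion[OF borel_measurable_integrable[OF g\<psi>_int]])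
      finally show ?thesis .
    qed
    \<comment> \<open>The weak identity is given for coordinate directions; linearity of the
      derivative extends it to all \<open>e\<close>.\<close>
    have e: "e = (\<Sum>i\<in>UNIV. e $ i *\<^sub>R axis i 1)"
      using basis_expansion[of e] by (simp add: scalar_mult_eq_scaleR)
    have De: "?D x e = (\<Sum>i\<in>UNIV. e $ i * ?D x (axis i 1))" for x
      by (subst e) (simp add: linear_sum[OF lin] linear_scale[OF lin])
    have "(\<integral>x. f' x * ?D x e \<partial>lborel) = (\<integral>x. (\<Sum>i\<in>UNIV. e $ i * (f' x * ?D x (axis i 1))) \<partial>lborel)"
      unfolding De by (simp add: sum_distrib_left mult_ac)
    also have "\<dots> = (\<Sum>i\<in>UNIV. e $ i * (\<integral>x. f' x * ?D x (axis i 1) \<partial>lborel))"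
      using fD_int by simp
    also have "\<dots> = - (\<Sum>i\<in>UNIV. e $ i * (\<integral>x. g' x $ i * \<psi> x \<partial>lborel))"
      by (simp add: axis sum_negf)
    also have "(\<Sum>i\<in>UNIV. e $ i * (\<integral>x. g' x $ i * \<psi> x \<partial>lborel)) = (\<integral>x. (\<Sum>i\<in>UNIV. e $ i * (g' x $ i * \<psi> x)) \<partial>lborel)"
      using g\<psi>_int by simp
    also have "\<dots> = (\<integral>x. (g' x \<bullet> e) * \<psi> x \<partial>lborel)"
      by (simp add: inner_vec_def sum_distrib_left mult_ac)
    finally show ?thesis .
  qed
  have "upper_gradient \<Omega> f' (\<lambda>x. norm (g' x))"
    unfolding upper_gradient_def
  proof (intro conjI allI impI)
    fix e and s :: real assume s: "0 \<le> s"
    have ge: "set_integrable lborel K (\<lambda>x. g' x \<bullet> e)" if "compact K" "K \<subseteq> \<Omega>" for K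
      using g'_int[OF that] integrable_inner_left[of e lborel "\<lambda>x. indicator K x *\<^sub>R g' x"]
      by (simp add: set_integrable_def)
    have "AE x in lborel. (\<forall>t\<in>{0..s}. x + t *\<^sub>R e \<in> \<Omega>) \<longrightarrow>
      ennreal \<bar>f' (x + s *\<^sub>R e) - f' x\<bar> \<le> (\<integral>\<^sup>+t\<in>{0..s}. ennreal \<bar>g' (x + t *\<^sub>R e) \<bullet> e\<bar> \<partial>lborel)"
      by (rule weak_derivative_segment_bound[OF \<open>open \<Omega>\<close> _ _ s f'_int ge main])
         (use f' in auto)
    then show "AE x in lborel. (\<forall>t\<in>{0..s}. x + t *\<^sub>R e \<in> \<Omega>) \<longrightarrow>
      ennreal \<bar>f' (x + s *\<^sub>R e) - f' x\<bar> \<le> (\<integral>\<^sup>+t\<in>{0..s}. ennreal (norm e * norm (g' (x + t *\<^sub>R e))) \<partial>lborel)"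
    proof eventually_elim
      fix x
      have "(\<integral>\<^sup>+t\<in>{0..s}. ennreal \<bar>g' (x + t *\<^sub>R e) \<bullet> e\<bar> \<partial>lborel)
        \<le> (\<integral>\<^sup>+t\<in>{0..s}. ennreal (norm e * norm (g' (x + t *\<^sub>R e))) \<partial>lborel)"
        \<comment> \<open>Cauchy-Schwarz replaces the directional derivative by the full norm, so
          that a single \<open>G\<close> serves all directions.\<close>
        by (intro nn_integral_mono mult_right_mono ennreal_leI)
           (subst mult.commute, simp_all add: Cauchy_Schwarz_ineq2)
      then show "(\<forall>t\<in>{0..s}. x + t *\<^sub>R e \<in> \<Omega>) \<longrightarrow>
          ennreal \<bar>f' (x + s *\<^sub>R e) - f' x\<bar> \<le> (\<integral>\<^sup>+t\<in>{0..s}. ennreal \<bar>g' (x + t *\<^sub>R e) \<bullet> e\<bar> \<partial>lborel)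
        \<Longrightarrow> (\<forall>t\<in>{0..s}. x + t *\<^sub>R e \<in> \<Omega>) \<longrightarrow>
          ennreal \<bar>f' (x + s *\<^sub>R e) - f' x\<bar> \<le> (\<integral>\<^sup>+t\<in>{0..s}. ennreal (norm e * norm (g' (x + t *\<^sub>R e))) \<partial>lborel)"
        by (meson order_trans)
    qed
  qed (use f' in auto)
  moreover have "AE x in lborel. x \<in> \<Omega> \<longrightarrow> f x = f' x \<and> norm (g x) = norm (g' x)"
    using ae_f ae_g by eventually_elim (metis indicator_simps(1) scaleR_one)
  ultimately show ?thesis by (rule that)
qed

subsection \<open>Boundary charts\<close>

text \<open>A connected set that meets both \<Omega> and its complement meets the boundary. When
  \<open>infdist\<close> is 0, in particular by convention for an empty boundary, the ball is
  empty.\<close>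

lemma ball_infdist_frontier_subset:
  fixes \<Omega> :: "'a::euclidean_space set"
  assumes "x \<in> \<Omega>"
  shows "ball x (infdist x (frontier \<Omega>)) \<subseteq> \<Omega>"
proof (cases "infdist x (frontier \<Omega>) > 0")
  case True
  show ?thesis
  proof (rule ccontr)
    assume "\<not> ?thesis"
    then have "ball x (infdist x (frontier \<Omega>)) \<inter> frontier \<Omega> \<noteq> {}"
      using assms True centre_in_ball[of x "infdist x (frontier \<Omega>)"]
      by (intro connected_Int_frontier) (blast intro: connected_ball)+
    then show False using infdist_le[of _ "frontier \<Omega>" x] by force
  qed
next
  case False
  then have "ball x (infdist x (frontier \<Omega>)) = {}" by simp
  then show ?thesis by blast
qed

lemma infdist_frontier_pos:
  assumes "open \<Omega>" "frontier \<Omega> \<noteq> {}" "x \<in> \<Omega>"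
  shows "0 < infdist x (frontier \<Omega>)"
  using assms infdist_pos_not_in_closed[of "frontier \<Omega>" x]
  by (auto simp: frontier_def interior_open)

text \<open>A chart in coordinate-free form: \<open>e\<close> is the upward direction of the rotated coordinate system and
  \<open>t x\<close> the depth of \<open>x\<close> below the graph.\<close>

locale graph_chart =
  fixes \<Omega> :: "'a::euclidean_space set" and z e :: 'a and t :: "'a \<Rightarrow> real" and R K \<alpha> :: real
  assumes open_domain: "open \<Omega>"
    and alpha: "0 < \<alpha>" "\<alpha> \<le> 1"
    and R: "0 < R" "R \<le> 1"
    and K: "0 \<le> K"
    and norm_e: "norm e = 1"
    and t_cont: "continuous_on UNIV t"
    and t_shift: "t (x - s *\<^sub>R e) = t x + s"
    and t_diff: "t x - t y \<le> K * dist x y powr \<alpha> + dist x y"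
    and z: "z \<in> frontier \<Omega>"
    and mem: "x \<in> ball z R \<Longrightarrow> x \<in> \<Omega> \<longleftrightarrow> 0 < t x"

text \<open>A rigid motion is an isometry and the horizontal projection does not increase distances,
  so the depth measured in chart coordinates keeps the Hoelder bound; the vertical coordinate adds
  the linear term.\<close>

lemma bounded_holder_domain_chart:
  fixes \<Omega> :: "(real^'n) set"
  assumes dom: "bounded_holder_domain \<alpha> \<Omega>" and \<alpha>: "0 < \<alpha>" "\<alpha> \<le> 1" and z: "z \<in> frontier \<Omega>"
  shows "\<exists>e t R K. graph_chart \<Omega> z e t R K \<alpha>"
proof -
  from dom z obtain T k \<phi> a b where T: "rigid_motion T" and hol: "holder_on {v. v $ k = 0} \<alpha> \<phi>"
    and Tz: "T z \<in> box a b"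
    and graph: "T ` \<Omega> \<inter> box a b = {y \<in> box a b. y $ k < \<phi> (horizontal_part k y)}"
    unfolding bounded_holder_domain_def by blast
  from T obtain A c where A: "orthogonal_transformation A" and T_eq: "T = (\<lambda>x. A x + c)"
    by (auto simp: rigid_motion_def)
  have lin: "linear A" using A by (simp add: orthogonal_transformation_def)
  obtain K0 where K0: "\<And>u v. u $ k = 0 \<Longrightarrow> v $ k = 0 \<Longrightarrow> \<bar>\<phi> u - \<phi> v\<bar> \<le> K0 * dist u v powr \<alpha>"
    using hol unfolding holder_on_def by auto
  obtain e where e: "A e = axis k 1"
    using orthogonal_transformation_surj[OF A] by (metis surjD)
  have ne: "norm e = 1"
    using orthogonal_transformation_norm[OF A, of e] e by (simp add: norm_axis_1)
  have T_dist: "dist (T x) (T y) = dist x y" for x y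
    unfolding T_eq dist_norm using orthogonal_transformation_norm[OF A, of "x - y"]
    by (simp add: linear_diff[OF lin])
  have hp_dist: "dist (horizontal_part k u) (horizontal_part k v) \<le> dist u v" for u v :: "real^'n"
    unfolding dist_norm by (rule norm_le_componentwise_cart) (simp add: horizontal_part_def)
  define t where "t x = \<phi> (horizontal_part k (T x)) - T x $ k" for x
  \<comment> \<open>The absolute value is taken because the definition of \<open>holder_on\<close>
    does not force the constant to be nonnegative.\<close>
  have t_diff: "t x - t y \<le> \<bar>K0\<bar> * dist x y powr \<alpha> + dist x y" for x y
  proof -
    have "\<phi> (horizontal_part k (T x)) - \<phi> (horizontal_part k (T y))
        \<le> K0 * dist (horizontal_part k (T x)) (horizontal_part k (T y)) powr \<alpha>"
      using K0[of "horizontal_part k (T x)" "horizontal_part k (T y)"] by (simp add: horizontal_part_def)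
    also have "\<dots> \<le> \<bar>K0\<bar> * dist x y powr \<alpha>"
      using hp_dist[of "T x" "T y"] \<alpha> T_dist[of x y] by (intro mult_mono powr_mono2) auto
    finally have "\<phi> (horizontal_part k (T x)) - \<phi> (horizontal_part k (T y)) \<le> \<bar>K0\<bar> * dist x y powr \<alpha>" .
    moreover have "T y $ k - T x $ k \<le> dist x y"
      using component_le_norm_cart[of "T y - T x" k] T_dist[of y x] by (simp add: dist_norm norm_minus_commute)
    ultimately show ?thesis by (simp add: t_def)
  qed
  have t_cont: "continuous_on UNIV t"
  proof (rule continuous_at_imp_continuous_on, rule ballI)
    fix x :: "real^'n"
    have d0: "((\<lambda>y. dist y x) \<longlongrightarrow> 0) (at x)"
      using tendsto_dist[OF tendsto_ident_at[of x UNIV] tendsto_const[of x]] by simp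
    have "((\<lambda>y. dist y x powr \<alpha>) \<longlongrightarrow> 0) (at x)"
      using tendsto_zero_powrI[OF d0 tendsto_const[of \<alpha>] _ \<alpha>(1)] by simp
    then have "((\<lambda>y. \<bar>K0\<bar> * dist y x powr \<alpha> + dist y x) \<longlongrightarrow> \<bar>K0\<bar> * 0 + 0) (at x)"
      by (intro tendsto_intros d0)
    then have b0: "((\<lambda>y. \<bar>K0\<bar> * dist y x powr \<alpha> + dist y x) \<longlongrightarrow> 0) (at x)" by simp
    have "((\<lambda>y. t y - t x) \<longlongrightarrow> 0) (at x)"
    proof (rule Lim_null_comparison[OF _ b0], rule always_eventually, rule allI)
      fix y
      show "norm (t y - t x) \<le> \<bar>K0\<bar> * dist y x powr \<alpha> + dist y x"
        using t_diff[of x y] t_diff[of y x] by (simp add: dist_commute abs_le_iff)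
    qed
    then show "isCont t x" by (simp add: isCont_def LIM_zero_iff)
  qed
  have t_shift: "t (x - s *\<^sub>R e) = t x + s" for x s
  proof -
    have Ts: "T (x - s *\<^sub>R e) = T x - s *\<^sub>R axis k 1"
      by (simp add: T_eq linear_diff[OF lin] linear_scale[OF lin] e)
    have "horizontal_part k (T x - s *\<^sub>R axis k 1) = horizontal_part k (T x)"
      by (simp add: horizontal_part_def vec_eq_iff axis_def)
    then show ?thesis by (simp add: t_def Ts)
  qed
  have "continuous_on UNIV T"
    unfolding T_eq by (intro continuous_intros linear_continuous_on linear_conv_bounded_linear[THEN iffD1] lin)
  then have "open (T -` box a b)" by (intro open_vimage open_box)
  then obtain R where R: "0 < R" "ball z R \<subseteq> T -` box a b"
    using Tz openE[of "T -` box a b" z] by auto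
  have inj: "inj T"
    by (rule injI) (metis T_dist dist_eq_0_iff)
  \<comment> \<open>With a radius of at most 1, linear terms are dominated by \<alpha>-th powers and
    nonnegative powers of \<open>d\<close> by 1.\<close>
  have mem: "x \<in> \<Omega> \<longleftrightarrow> 0 < t x" if "x \<in> ball z (min R 1)" for x
  proof -
    have "T x \<in> box a b" using that R by auto
    then have "T x \<in> T ` \<Omega> \<longleftrightarrow> T x $ k < \<phi> (horizontal_part k (T x))" using graph by blast
    then show ?thesis by (simp add: t_def inj_image_mem_iff[OF inj])
  qed
  have "graph_chart \<Omega> z e t (min R 1) \<bar>K0\<bar> \<alpha>"
    by unfold_locales (use dom \<alpha> R ne t_cont t_shift t_diff z mem in \<open>simp_all add: bounded_holder_domain_def\<close>)
  then show ?thesis by blast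
qed

section \<open>Depth versus distance in a chart\<close>

context graph_chart
begin

abbreviation d :: "'a \<Rightarrow> real" where "d x \<equiv> infdist x (frontier \<Omega>)"

lemma frontier_not_in: "q \<in> frontier \<Omega> \<Longrightarrow> q \<notin> \<Omega>"
  using open_domain by (simp add: frontier_def interior_open)

lemma nearest_boundary_point:
  obtains q where "q \<in> frontier \<Omega>" "d x = dist x q"
  using infdist_attains_inf[of "frontier \<Omega>" x] z by (auto simp: frontier_closed)

text \<open>The point \<open>z\<close> is outside the open set \<Omega> but in its closure: positive
  depth contradicts the former, negative depth would persist nearby and contradict the
  latter.\<close>

lemma t_z: "t z = 0"
proof (rule antisym)
  have "z \<in> ball z R" using R by simp
  then show "t z \<le> 0" using mem[of z] frontier_not_in[OF z] by simp
  show "0 \<le> t z"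
  proof (rule ccontr)
    assume "\<not> 0 \<le> t z"
    moreover have "open (ball z R \<inter> t -` {..<0})"
      using t_cont by (intro open_Int open_ball open_vimage) auto
    moreover have "z \<in> closure \<Omega>" using z by (simp add: frontier_def)
    moreover have "z \<in> ball z R \<inter> t -` {..<0}" using \<open>z \<in> ball z R\<close> \<open>\<not> 0 \<le> t z\<close> by simp
    ultimately obtain y where "y \<in> \<Omega>" "y \<in> ball z R" "t y < 0"
      using open_Int_closure_eq_empty[of "ball z R \<inter> t -` {..<0}" \<Omega>] by blast
    then show False using mem[of y] by simp
  qed
qed

lemma d_less: "x \<in> ball z r \<Longrightarrow> d x < r"
  using infdist_le[OF z, of x] by (simp add: dist_commute)

lemma d_pos: "x \<in> \<Omega> \<Longrightarrow> 0 < d x"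
  using infdist_frontier_pos[OF open_domain] z by blast

text \<open>The nearest boundary point is still in the chart and has depth at most 0, so
  \<open>t x\<close> is at most the oscillation of \<open>t\<close> over the distance
  \<open>d x\<close>. Here the Hoelder exponent enters the estimates.\<close>

lemma t_le_d_powr:
  assumes "x \<in> \<Omega>" "x \<in> ball z (R / 2)"
  shows "t x \<le> (K + 1) * d x powr \<alpha>"
proof -
  obtain q where q: "q \<in> frontier \<Omega>" "d x = dist x q" by (rule nearest_boundary_point)
  have dx: "d x < R / 2" using assms d_less by blast
  have "dist z q \<le> dist z x + dist x q" by (rule dist_triangle)
  then have "q \<in> ball z R" using assms dx q by simp
  then have "t q \<le> 0" using mem[of q] frontier_not_in[OF q(1)] by simp
  then have "t x \<le> K * d x powr \<alpha> + d x" using t_diff[of x q] q by simp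
  moreover have "d x powr 1 \<le> d x powr \<alpha>"
    using alpha dx R by (intro powr_mono') (auto intro: infdist_nonneg)
  ultimately show ?thesis using d_pos[OF assms(1)] by (simp add: algebra_simps)
qed

lemma shift_in_domain:
  assumes "x \<in> \<Omega>" "x \<in> ball z (R / 4)" "0 \<le> s" "s \<le> R / 4"
  shows "x - s *\<^sub>R e \<in> \<Omega>" "x - s *\<^sub>R e \<in> ball z (R / 2)"
proof -
  have "dist z (x - s *\<^sub>R e) \<le> dist z x + dist x (x - s *\<^sub>R e)" by (rule dist_triangle)
  also have "dist x (x - s *\<^sub>R e) = s" using assms norm_e by (simp add: dist_norm)
  finally show b: "x - s *\<^sub>R e \<in> ball z (R / 2)" using assms by simp
  have "0 < t x" using mem[of x] assms R by auto
  then have "0 < t (x - s *\<^sub>R e)" using assms by (simp add: t_shift)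
  then show "x - s *\<^sub>R e \<in> \<Omega>" using mem[of "x - s *\<^sub>R e"] b R by auto
qed

text \<open>If a boundary point \<open>q\<close> were closer to the lowered point than
  \<open>d x\<close>, then \<open>q + s *\<^sub>R e\<close> would lie in the ball of radius
  \<open>d x\<close> about \<open>x\<close>, hence in \<Omega>; lowering it again would put
  \<open>q\<close> into \<Omega>.\<close>

lemma d_mono_shift:
  assumes x: "x \<in> \<Omega>" "x \<in> ball z (R / 8)" and s: "0 \<le> s" "s \<le> R / 4"
  shows "d x \<le> d (x - s *\<^sub>R e)"
proof -
  obtain q where q: "q \<in> frontier \<Omega>" "d (x - s *\<^sub>R e) = dist (x - s *\<^sub>R e) q"
    by (rule nearest_boundary_point)
  have ball: "ball x (d x) \<subseteq> \<Omega>" by (rule ball_infdist_frontier_subset[OF x(1)])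
  show ?thesis
  proof (rule ccontr)
    assume "\<not> ?thesis"
    then have "dist (x - s *\<^sub>R e) q < d x" using q by simp
    then have b: "q + s *\<^sub>R e \<in> ball x (d x)" by (simp add: dist_norm algebra_simps)
    then have "q + s *\<^sub>R e \<in> \<Omega>" using ball by blast
    moreover have "q + s *\<^sub>R e \<in> ball z (R / 4)"
    proof -
      have "dist z (q + s *\<^sub>R e) \<le> dist z x + dist x (q + s *\<^sub>R e)" by (rule dist_triangle)
      then show ?thesis using b x d_less[OF x(2)] by simp
    qed
    ultimately have "q + s *\<^sub>R e - s *\<^sub>R e \<in> \<Omega>" using s by (rule shift_in_domain(1))
    then show False using frontier_not_in[OF q(1)] by simp
  qed
qed

end

section \<open>Integrals along vertical fibres\<close>

lemma nn_integral_shifted_powr_le: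
  fixes \<kappa> T :: real
  assumes "- 1 < \<kappa>"
  shows "(\<integral>\<^sup>+s. indicator {0..<T} s * ennreal ((T - s) powr \<kappa>) \<partial>lborel) \<le> ennreal (T powr (\<kappa> + 1) / (\<kappa> + 1))"
proof (cases "0 < T")
  case True
  have "(\<integral>\<^sup>+s. indicator {0..<T} s * ennreal ((T - s) powr \<kappa>) \<partial>lborel)
      = (\<integral>\<^sup>+s. indicator {0..<T} (T + (-1) * s) * ennreal ((T - (T + (-1) * s)) powr \<kappa>) \<partial>lborel)"
    by (subst nn_integral_real_affine[where c="-1" and t=T]) auto
  also have "\<dots> \<le> (\<integral>\<^sup>+s. ennreal (indicator {0..T} s * s powr \<kappa>) \<partial>lborel)"
    by (intro nn_integral_mono) (auto simp: indicator_def)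
  also have "\<dots> = ennreal (T powr (\<kappa> + 1) / (\<kappa> + 1))"
  proof (rule nn_integral_has_integral_lborel)
    have "((\<lambda>x. x powr \<kappa>) has_integral (T powr (\<kappa> + 1) / (\<kappa> + 1))) {0..T}"
      using True assms by (intro has_integral_powr_from_0) auto
    then have "((\<lambda>x. if x \<in> {0..T} then x powr \<kappa> else 0) has_integral (T powr (\<kappa> + 1) / (\<kappa> + 1))) UNIV"
      by (simp only: has_integral_restrict_UNIV)
    moreover have "(\<lambda>x. if x \<in> {0..T} then x powr \<kappa> else 0) = (\<lambda>x. indicator {0..T} x * x powr \<kappa>)"
      by (auto simp: indicator_def)
    ultimately show "((\<lambda>x. indicator {0..T} x * x powr \<kappa>) has_integral (T powr (\<kappa> + 1) / (\<kappa> + 1))) UNIV"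
      by simp
  qed auto
  finally show ?thesis .
qed simp

text \<open>Tonelli with the substitution \<open>y = x - s *\<^sub>R e\<close>: the point at height
  \<open>s\<close> above \<open>y\<close> has depth \<open>t y - s\<close>, so positivity of the
  depth on \<open>N\<close> confines \<open>s\<close> to \<open>s < t y\<close>, and the remaining
  integral in \<open>s\<close> is finite because \<kappa> > -1.\<close>

lemma nn_integral_shift_fibre_le:
  fixes t \<Psi> :: "'a::euclidean_space \<Rightarrow> real" and e :: 'a
  assumes [measurable]: "t \<in> borel_measurable borel" "\<Psi> \<in> borel_measurable borel"
      "N \<in> sets borel" "W \<in> sets borel"
    and t_shift: "\<And>x s. t (x - s *\<^sub>R e) = t x + s"
    and \<kappa>: "- 1 < \<kappa>" and \<Psi>: "\<And>x. 0 \<le> \<Psi> x"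
    and N: "\<And>x. x \<in> N \<Longrightarrow> 0 < t x"
    and W: "\<And>x s. x \<in> N \<Longrightarrow> 0 \<le> s \<Longrightarrow> s \<le> S \<Longrightarrow> x - s *\<^sub>R e \<in> W"
  shows "(\<integral>\<^sup>+x\<in>N. (\<integral>\<^sup>+s\<in>{0..S}. ennreal (\<Psi> (x - s *\<^sub>R e) * t x powr \<kappa>) \<partial>lborel) \<partial>lborel)
     \<le> (\<integral>\<^sup>+y\<in>W. ennreal (\<Psi> y * (t y powr (\<kappa> + 1) / (\<kappa> + 1))) \<partial>lborel)"
proof -
  have "(\<integral>\<^sup>+x\<in>N. (\<integral>\<^sup>+s\<in>{0..S}. ennreal (\<Psi> (x - s *\<^sub>R e) * t x powr \<kappa>) \<partial>lborel) \<partial>lborel)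
     = (\<integral>\<^sup>+x. \<integral>\<^sup>+s. indicator N x * (indicator {0..S} s * ennreal (\<Psi> (x - s *\<^sub>R e) * t x powr \<kappa>)) \<partial>lborel \<partial>lborel)"
    by (subst nn_integral_cmult) (auto simp: mult_ac)
  also have "\<dots> = (\<integral>\<^sup>+s. \<integral>\<^sup>+x. indicator N x * (indicator {0..S} s * ennreal (\<Psi> (x - s *\<^sub>R e) * t x powr \<kappa>)) \<partial>lborel \<partial>lborel)"
    by (rule lborel_pair.Fubini') measurable
  also have "\<dots> = (\<integral>\<^sup>+s. \<integral>\<^sup>+x. indicator N (x + s *\<^sub>R e) *
      (indicator {0..S} s * ennreal (\<Psi> x * t (x + s *\<^sub>R e) powr \<kappa>)) \<partial>lborel \<partial>lborel)"
  proof (rule nn_integral_cong)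
    fix s :: real
    show "(\<integral>\<^sup>+x. indicator N x * (indicator {0..S} s * ennreal (\<Psi> (x - s *\<^sub>R e) * t x powr \<kappa>)) \<partial>lborel)
      = (\<integral>\<^sup>+x. indicator N (x + s *\<^sub>R e) * (indicator {0..S} s * ennreal (\<Psi> x * t (x + s *\<^sub>R e) powr \<kappa>)) \<partial>lborel)"
      using nn_integral_lborel_shift[of "\<lambda>x. indicator N x * (indicator {0..S} s * ennreal (\<Psi> (x - s *\<^sub>R e) * t x powr \<kappa>))" "s *\<^sub>R e"]
      by simp
  qed
  also have "\<dots> = (\<integral>\<^sup>+x. \<integral>\<^sup>+s. indicator N (x + s *\<^sub>R e) *
      (indicator {0..S} s * ennreal (\<Psi> x * t (x + s *\<^sub>R e) powr \<kappa>)) \<partial>lborel \<partial>lborel)"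
    by (rule lborel_pair.Fubini') measurable
  also have "\<dots> \<le> (\<integral>\<^sup>+x. ennreal (\<Psi> x * (t x powr (\<kappa> + 1) / (\<kappa> + 1))) * indicator W x \<partial>lborel)"
  proof (rule nn_integral_mono)
    fix x
    have "(\<integral>\<^sup>+s. indicator N (x + s *\<^sub>R e) * (indicator {0..S} s * ennreal (\<Psi> x * t (x + s *\<^sub>R e) powr \<kappa>)) \<partial>lborel)
      \<le> (\<integral>\<^sup>+s. ennreal (indicator W x * \<Psi> x) * (indicator {0..<t x} s * ennreal ((t x - s) powr \<kappa>)) \<partial>lborel)"
    proof (rule nn_integral_mono)
      fix s :: real
      have ts: "t (x + s *\<^sub>R e) = t x - s" using t_shift[of "x + s *\<^sub>R e" s] by simp
      show "indicator N (x + s *\<^sub>R e) * (indicator {0..S} s * ennreal (\<Psi> x * t (x + s *\<^sub>R e) powr \<kappa>))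
        \<le> ennreal (indicator W x * \<Psi> x) * (indicator {0..<t x} s * ennreal ((t x - s) powr \<kappa>))"
      proof (cases "x + s *\<^sub>R e \<in> N \<and> s \<in> {0..S}")
        case True
        then have "x \<in> W" using W[of "x + s *\<^sub>R e" s] by simp
        moreover have "s < t x" using True N[of "x + s *\<^sub>R e"] ts by simp
        ultimately show ?thesis using True \<Psi>[of x] by (simp add: ts ennreal_mult)
      qed (auto simp: indicator_def)
    qed
    also have "\<dots> = ennreal (indicator W x * \<Psi> x) * (\<integral>\<^sup>+s. indicator {0..<t x} s * ennreal ((t x - s) powr \<kappa>) \<partial>lborel)"
      by (rule nn_integral_cmult) measurable
    also have "\<dots> \<le> ennreal (indicator W x * \<Psi> x) * ennreal (t x powr (\<kappa> + 1) / (\<kappa> + 1))"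
      by (intro mult_left_mono nn_integral_shifted_powr_le \<kappa>) simp
    also have "\<dots> = ennreal (\<Psi> x * (t x powr (\<kappa> + 1) / (\<kappa> + 1))) * indicator W x"
      using \<Psi>[of x] \<kappa> ennreal_mult[of "\<Psi> x" "t x powr (\<kappa> + 1) / (\<kappa> + 1)"]
      by (cases "x \<in> W") auto
    finally show "(\<integral>\<^sup>+s. indicator N (x + s *\<^sub>R e) * (indicator {0..S} s * ennreal (\<Psi> x * t (x + s *\<^sub>R e) powr \<kappa>)) \<partial>lborel)
      \<le> ennreal (\<Psi> x * (t x powr (\<kappa> + 1) / (\<kappa> + 1))) * indicator W x" .
  qed
  finally show ?thesis .
qed

text \<open>Jensen's inequality for the density \<open>b T\<^sup>b / (T + \<tau>)\<^sup>b\<^sup>+\<^sup>1\<close> of total mass at most one.\<close>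

lemma powr_weighted_segment_le:
  fixes G :: "real \<Rightarrow> real" and a b p s T :: real
  assumes p: "1 < p" and b: "0 < b" and T: "0 < T" and a: "0 \<le> a" and s: "0 \<le> s"
    and [measurable]: "G \<in> borel_measurable borel" and G: "\<And>\<tau>. 0 \<le> G \<tau>"
    and le: "ennreal a \<le> (\<integral>\<^sup>+\<tau>\<in>{0..s}. ennreal (G \<tau>) \<partial>lborel)"
  shows "ennreal (a powr p) \<le> (\<integral>\<^sup>+\<tau>\<in>{0..s}.
    ennreal (b powr (1 - p) * T powr (- (b * (p - 1))) * (G \<tau> powr p * (T + \<tau>) powr ((b + 1) * (p - 1)))) \<partial>lborel)"
proof -
  define v where "v \<tau> = b * T powr b * (T + \<tau>) powr (- b - 1)" for \<tau>
  have [measurable]: "v \<in> borel_measurable borel" unfolding v_def by measurable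
  have v_pos: "0 < v \<tau>" if "\<tau> \<in> {0..s}" for \<tau>
    using that b T by (auto simp: v_def)
  \<comment> \<open>An antiderivative is \<open>- (T / (T + \<tau>)) powr b\<close>, written with
    separate powers; the mass is therefore \<open>1 - (T / (T + s)) powr b\<close>.\<close>
  have v_int: "(\<integral>\<^sup>+\<tau>. ennreal (v \<tau>) * indicator {0..s} \<tau> \<partial>lborel) = ennreal (- (T powr b * (T + s) powr (- b)) - - (T powr b * (T + 0) powr (- b)))"
  proof (rule nn_integral_FTC_Icc[OF _ _ _ s])
    fix \<tau> assume \<tau>: "\<tau> \<in> {0..s}"
    then have "0 < T + \<tau>" using T by simp
    then have "((\<lambda>\<tau>. - (T powr b * (T + \<tau>) powr (- b))) has_real_derivative
        - (T powr b * (- b * (T + \<tau>) powr (- b - 1)))) (at \<tau>)"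
      by (auto intro!: derivative_eq_intros)
    then show "((\<lambda>\<tau>. - (T powr b * (T + \<tau>) powr (- b))) has_real_derivative v \<tau>) (at \<tau>)"
      by (simp add: v_def mult_ac)
    show "0 \<le> v \<tau>" using v_pos[OF \<tau>] by simp
  qed measurable
  have "T powr b * T powr (- b) = 1" using T by (simp add: powr_minus)
  then have v1: "(\<integral>\<^sup>+\<tau>. ennreal (v \<tau>) * indicator {0..s} \<tau> \<partial>lborel) \<le> 1"
    unfolding v_int by (intro ennreal_le_1[THEN iffD2]) simp
  \<comment> \<open>On the segment \<open>G\<close> is the product of \<open>?h\<close> and
    \<open>?w\<close>, so Jensen leaves the integrand
    \<open>G \<tau> powr p * v \<tau> powr (1 - p)\<close>.\<close>
  let ?w = "\<lambda>\<tau>. v \<tau> * indicator {0..s} \<tau>" and ?h = "\<lambda>\<tau>. G \<tau> / \<bar>v \<tau>\<bar>"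
  have "ennreal (a powr p) \<le> (\<integral>\<^sup>+\<tau>. ennreal (?h \<tau> powr p * ?w \<tau>) \<partial>lborel)"
  proof (rule powr_nn_integral_le[OF p a])
    show "0 \<le> ?h \<tau>" for \<tau> using G[of \<tau>] by simp
    show "0 \<le> ?w \<tau>" for \<tau> using v_pos[of \<tau>] by (auto simp: indicator_def)
    have "(\<integral>\<^sup>+\<tau>. ennreal (?w \<tau>) \<partial>lborel) = (\<integral>\<^sup>+\<tau>. ennreal (v \<tau>) * indicator {0..s} \<tau> \<partial>lborel)"
      by (intro nn_integral_cong) (auto simp: indicator_def)
    then show "(\<integral>\<^sup>+\<tau>. ennreal (?w \<tau>) \<partial>lborel) \<le> 1" using v1 by simp
    have "(\<integral>\<^sup>+\<tau>\<in>{0..s}. ennreal (G \<tau>) \<partial>lborel) = (\<integral>\<^sup>+\<tau>. ennreal (?h \<tau> * ?w \<tau>) \<partial>lborel)"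
      using v_pos by (intro nn_integral_cong) (force simp: indicator_def)
    with le show "ennreal a \<le> (\<integral>\<^sup>+\<tau>. ennreal (?h \<tau> * ?w \<tau>) \<partial>lborel)" by simp
  qed measurable
  also have "\<dots> = (\<integral>\<^sup>+\<tau>\<in>{0..s}.
    ennreal (b powr (1 - p) * T powr (- (b * (p - 1))) * (G \<tau> powr p * (T + \<tau>) powr ((b + 1) * (p - 1)))) \<partial>lborel)"
  proof (rule nn_integral_cong)
    fix \<tau> :: real
    show "ennreal (?h \<tau> powr p * ?w \<tau>) = ennreal (b powr (1 - p) * T powr (- (b * (p - 1))) *
        (G \<tau> powr p * (T + \<tau>) powr ((b + 1) * (p - 1)))) * indicator {0..s} \<tau>"
    proof (cases "\<tau> \<in> {0..s}")
      case True
      then have pos: "0 < T + \<tau>" using T by simp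
      have "?h \<tau> powr p * v \<tau> = G \<tau> powr p * (v \<tau> powr (- p) * v \<tau> powr 1)"
        using v_pos[OF True] G[of \<tau>] by (simp add: powr_divide powr_minus field_simps)
      also have "v \<tau> powr (- p) * v \<tau> powr 1 = v \<tau> powr (1 - p)"
        by (simp only: powr_add[symmetric] uminus_add_conv_diff)
      also have "v \<tau> powr (1 - p) = b powr (1 - p) * T powr (b * (1 - p)) * (T + \<tau>) powr ((- b - 1) * (1 - p))"
        using b T pos by (simp add: v_def powr_mult powr_powr)
      also have "b * (1 - p) = - (b * (p - 1))" by (simp add: algebra_simps)
      also have "(- b - 1) * (1 - p) = (b + 1) * (p - 1)" by (simp add: algebra_simps)
      finally show ?thesis using True by (simp add: mult_ac)
    qed simp
  qed
  finally show ?thesis .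
qed

subsection \<open>The boundary estimate\<close>

lemma borel_measurable_infdist_self [measurable]:
  "(\<lambda>x::'a::euclidean_space. infdist x A) \<in> borel_measurable borel"
  by (intro borel_measurable_continuous_onI continuous_intros)

lemma ball_borel [measurable]: "ball (c::'a::euclidean_space) r \<in> sets borel"
  by simp

lemma nn_integral_cmult_add:
  fixes u v :: "'a \<Rightarrow> ennreal"
  assumes "u \<in> borel_measurable N" "v \<in> borel_measurable N"
  shows "(\<integral>\<^sup>+x. c * (u x + v x) \<partial>N) = c * ((\<integral>\<^sup>+x. u x \<partial>N) + (\<integral>\<^sup>+x. v x \<partial>N))"
  using assms by (simp add: nn_integral_cmult nn_integral_add)

lemma ennreal_distrib_real:
  assumes "0 \<le> a" "0 \<le> b" "0 \<le> c" "0 \<le> r" "0 \<le> k"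
  shows "ennreal a * (ennreal b * (ennreal c * X * ennreal r + ennreal k * Y)) =
    ennreal (a * b * c * r) * X + ennreal (a * b * k) * Y"
  using assms by (simp add: distrib_left ennreal_mult mult_ac)

lemma abs_add_powr_le:
  fixes x y p :: real
  assumes "0 < p"
  shows "\<bar>x + y\<bar> powr p \<le> 2 powr p * (\<bar>x\<bar> powr p + \<bar>y\<bar> powr p)"
proof -
  have "\<bar>x + y\<bar> powr p \<le> (2 * max \<bar>x\<bar> \<bar>y\<bar>) powr p"
    using assms by (intro powr_mono2) auto
  also have "\<dots> = 2 powr p * max \<bar>x\<bar> \<bar>y\<bar> powr p" by (intro powr_mult)
  also have "\<dots> \<le> 2 powr p * (\<bar>x\<bar> powr p + \<bar>y\<bar> powr p)"
    by (intro mult_left_mono) (auto simp: max_def)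
  finally show ?thesis .
qed

text \<open>At least one of \<sigma> and \<nu> is 0. A singular weight is expressed through the
  depth, with \<sigma> > -1 equivalent to \<gamma> > -\<alpha>; a bounded weight is left as it
  is.\<close>

locale weighted_chart = graph_chart +
  fixes p \<gamma> \<sigma> \<nu> M :: real
  assumes p: "1 < p" and gamma: "- \<alpha> < \<gamma>"
    and sigma_def: "\<sigma> = min \<gamma> 0 / \<alpha>" and nu_def: "\<nu> = max \<gamma> 0" and M_def: "M = K + 1"
begin

lemma sigma: "- 1 < \<sigma>" "\<sigma> \<le> 0" and nu: "0 \<le> \<nu>" and exponents: "\<gamma> = \<alpha> * \<sigma> + \<nu>" and M: "1 \<le> M"
  using alpha gamma K by (auto simp: sigma_def nu_def M_def min_def max_def field_simps)

lemma t_pos: "x \<in> \<Omega> \<Longrightarrow> x \<in> ball z (R / 2) \<Longrightarrow> 0 < t x"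
  using mem[of x] R by auto

lemma t_le: "x \<in> \<Omega> \<Longrightarrow> x \<in> ball z (R / 2) \<Longrightarrow> t x \<le> M * d x powr \<alpha>"
  using t_le_d_powr by (simp add: M_def)

lemma t_measurable [measurable]: "t \<in> borel_measurable borel"
  using t_cont by (rule borel_measurable_continuous_onI)

lemma domain_measurable [measurable]: "\<Omega> \<in> sets borel"
  using open_domain by simp

text \<open>The exponent \<sigma> is at most 0, which reverses \<open>t_le\<close> and turns an
  upper bound for the depth into an upper bound for the weight.\<close>

lemma d_powr_le:
  assumes "x \<in> \<Omega>" "x \<in> ball z (R / 2)"
  shows "d x powr \<gamma> \<le> M powr (- \<sigma>) * (t x powr \<sigma> * d x powr \<nu>)"
proof -
  have "(M * d x powr \<alpha>) powr \<sigma> \<le> t x powr \<sigma>"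
    using sigma t_pos[OF assms] t_le[OF assms] by (intro powr_mono2') auto
  moreover have "(M * d x powr \<alpha>) powr \<sigma> = M powr \<sigma> * d x powr (\<alpha> * \<sigma>)"
    using M by (simp add: powr_mult powr_powr)
  ultimately have "M powr (- \<sigma>) * (M powr \<sigma> * d x powr (\<alpha> * \<sigma>)) \<le> M powr (- \<sigma>) * t x powr \<sigma>"
    by (intro mult_left_mono) auto
  moreover have "M powr (- \<sigma>) * (M powr \<sigma> * d x powr (\<alpha> * \<sigma>)) = d x powr (\<alpha> * \<sigma>)"
    using M by (simp add: powr_minus)
  ultimately have "d x powr (\<alpha> * \<sigma>) * d x powr \<nu> \<le> M powr (- \<sigma>) * t x powr \<sigma> * d x powr \<nu>"
    by (intro mult_right_mono) auto
  then show ?thesis by (simp add: exponents powr_add mult.assoc)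
qed

text \<open>The way back from depth to distance, possible because \<open>p + \<sigma> > 0\<close>.
  The exponents add up as
  \<open>\<alpha> * (p + \<sigma>) + \<nu> = \<gamma> + \<alpha> * p\<close>.\<close>

lemma t_powr_le:
  assumes "x \<in> \<Omega>" "x \<in> ball z (R / 2)"
  shows "t x powr (p + \<sigma>) * d x powr \<nu> \<le> M powr (p + \<sigma>) * d x powr (\<gamma> + \<alpha> * p)"
proof -
  have "t x powr (p + \<sigma>) \<le> (M * d x powr \<alpha>) powr (p + \<sigma>)"
    using sigma p t_pos[OF assms] t_le[OF assms] by (intro powr_mono2) auto
  also have "\<dots> = M powr (p + \<sigma>) * d x powr (\<alpha> * (p + \<sigma>))"
    using M by (simp add: powr_mult powr_powr)
  finally have "t x powr (p + \<sigma>) * d x powr \<nu> \<le> M powr (p + \<sigma>) * d x powr (\<alpha> * (p + \<sigma>)) * d x powr \<nu>"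
    by (intro mult_right_mono) auto
  also have "\<dots> = M powr (p + \<sigma>) * d x powr (\<gamma> + \<alpha> * p)"
    by (simp add: exponents mult.assoc powr_add[symmetric] algebra_simps)
  finally show ?thesis .
qed

text \<open>Hardy's inequality along the fibres. The choice of \<open>b\<close> makes the power \<open>\<kappa>\<close> of \<open>t x\<close> that is left
  after Jensen's inequality integrable.\<close>

lemma hardy_shift_estimate:
  assumes ug: "upper_gradient \<Omega> f G" and \<rho>: "\<rho> \<le> R / 8" and s: "0 \<le> s" "s \<le> R / 4"
  shows "(\<integral>\<^sup>+x\<in>\<Omega> \<inter> ball z \<rho>. ennreal (\<bar>f (x - s *\<^sub>R e) - f x\<bar> powr p * d x powr \<gamma>) \<partial>lborel)
    \<le> ennreal (M powr p * ((\<sigma> + 1) / (2 * (p - 1))) powr (1 - p) / ((\<sigma> + 1) / 2)) *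
      (\<integral>\<^sup>+x\<in>\<Omega>. ennreal (G x powr p * d x powr (\<gamma> + \<alpha> * p)) \<partial>lborel)"
proof -
  let ?N = "\<Omega> \<inter> ball z \<rho>" and ?W = "\<Omega> \<inter> ball z (R / 2)"
  \<comment> \<open>This makes \<open>b * (p - 1)\<close> half of \<open>\<sigma> + 1\<close>; any
    value strictly between 0 and \<open>\<sigma> + 1\<close> would do. Then \<kappa> is the midpoint
    of -1 and \<sigma>.\<close>
  define b where "b = (\<sigma> + 1) / (2 * (p - 1))"
  define \<kappa> where "\<kappa> = (\<sigma> - 1) / 2"
  define A where "A = M powr (- \<sigma>) * b powr (1 - p)"
  \<comment> \<open>Everything that can be evaluated at the lowered point:
    \<open>t x + \<tau>\<close> is its depth, and the factor \<open>d x powr \<nu>\<close> only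
    grows on the way down. Of \<open>x\<close> itself only \<open>t x powr \<kappa>\<close>
    remains.\<close>
  define \<Psi> where "\<Psi> y = A * (G y powr p * t y powr ((b + 1) * (p - 1)) * d y powr \<nu>)" for y
  have b: "0 < b" using sigma p by (simp add: b_def)
  have bp: "b * (p - 1) = (\<sigma> + 1) / 2" using p by (simp add: b_def field_simps)
  have \<kappa>: "- 1 < \<kappa>" "\<kappa> + 1 = (\<sigma> + 1) / 2" "- (b * (p - 1)) + \<sigma> = \<kappa>"
    using sigma by (auto simp: \<kappa>_def bp field_simps)
  have A: "0 \<le> A" by (simp add: A_def)
  have [measurable]: "f \<in> borel_measurable borel" and Gm [measurable]: "G \<in> borel_measurable borel"
    and G: "\<And>x. 0 \<le> G x"
    using ug by (auto simp: upper_gradient_def)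
  have [measurable]: "\<Psi> \<in> borel_measurable borel" unfolding \<Psi>_def by measurable
  have "AE x in lborel. (\<forall>\<tau>\<in>{0..s}. x + \<tau> *\<^sub>R (- e) \<in> \<Omega>) \<longrightarrow>
        ennreal \<bar>f (x + s *\<^sub>R (- e)) - f x\<bar> \<le>
          (\<integral>\<^sup>+\<tau>\<in>{0..s}. ennreal (norm (- e) * G (x + \<tau> *\<^sub>R (- e))) \<partial>lborel)"
    using ug s unfolding upper_gradient_def by blast
  then have "AE x in lborel. ennreal (\<bar>f (x - s *\<^sub>R e) - f x\<bar> powr p * d x powr \<gamma>) * indicator ?N x
      \<le> (\<integral>\<^sup>+\<tau>\<in>{0..R / 4}. ennreal (\<Psi> (x - \<tau> *\<^sub>R e) * t x powr \<kappa>) \<partial>lborel) * indicator ?N x"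
  proof eventually_elim
    fix x
    assume seg: "(\<forall>\<tau>\<in>{0..s}. x + \<tau> *\<^sub>R (- e) \<in> \<Omega>) \<longrightarrow>
        ennreal \<bar>f (x + s *\<^sub>R (- e)) - f x\<bar> \<le>
          (\<integral>\<^sup>+\<tau>\<in>{0..s}. ennreal (norm (- e) * G (x + \<tau> *\<^sub>R (- e))) \<partial>lborel)"
    show "ennreal (\<bar>f (x - s *\<^sub>R e) - f x\<bar> powr p * d x powr \<gamma>) * indicator ?N x
      \<le> (\<integral>\<^sup>+\<tau>\<in>{0..R / 4}. ennreal (\<Psi> (x - \<tau> *\<^sub>R e) * t x powr \<kappa>) \<partial>lborel) * indicator ?N x"
    proof (cases "x \<in> ?N")
      case True
      then have x: "x \<in> \<Omega>" "x \<in> ball z (R / 8)" "x \<in> ball z (R / 4)" "x \<in> ball z (R / 2)"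
        using \<rho> R by auto
      have T: "0 < t x" by (rule t_pos) (use x in auto)
      let ?a = "\<bar>f (x - s *\<^sub>R e) - f x\<bar>"
      have "\<forall>\<tau>\<in>{0..s}. x + \<tau> *\<^sub>R (- e) \<in> \<Omega>"
        using shift_in_domain(1)[OF x(1,3)] s by auto
      with seg have "ennreal ?a \<le> (\<integral>\<^sup>+\<tau>\<in>{0..s}. ennreal (G (x - \<tau> *\<^sub>R e)) \<partial>lborel)"
        by (simp add: norm_e)
      then have "ennreal (?a powr p) \<le> (\<integral>\<^sup>+\<tau>\<in>{0..s}. ennreal (b powr (1 - p) * t x powr (- (b * (p - 1))) *
          (G (x - \<tau> *\<^sub>R e) powr p * (t x + \<tau>) powr ((b + 1) * (p - 1)))) \<partial>lborel)"
        by (intro powr_weighted_segment_le p b T s G) (simp, measurable)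
      then have "ennreal (?a powr p * d x powr \<gamma>) \<le> (\<integral>\<^sup>+\<tau>\<in>{0..s}. ennreal (b powr (1 - p) * t x powr (- (b * (p - 1))) *
          (G (x - \<tau> *\<^sub>R e) powr p * (t x + \<tau>) powr ((b + 1) * (p - 1)))) \<partial>lborel) * ennreal (d x powr \<gamma>)"
        by (simp add: ennreal_mult mult_right_mono)
      also have "\<dots> = (\<integral>\<^sup>+\<tau>. ennreal (b powr (1 - p) * t x powr (- (b * (p - 1))) *
          (G (x - \<tau> *\<^sub>R e) powr p * (t x + \<tau>) powr ((b + 1) * (p - 1)))) * indicator {0..s} \<tau> * ennreal (d x powr \<gamma>) \<partial>lborel)"
        by (rule nn_integral_multc[symmetric]) measurable
      \<comment> \<open>Enlarging the segment to the full length makes the bound independent of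
        \<open>s\<close>.\<close>
      also have "\<dots> \<le> (\<integral>\<^sup>+\<tau>\<in>{0..R / 4}. ennreal (\<Psi> (x - \<tau> *\<^sub>R e) * t x powr \<kappa>) \<partial>lborel)"
      proof (rule nn_integral_mono)
        fix \<tau> :: real
        let ?g = "G (x - \<tau> *\<^sub>R e) powr p * (t x + \<tau>) powr ((b + 1) * (p - 1))"
        show "ennreal (b powr (1 - p) * t x powr (- (b * (p - 1))) * ?g) * indicator {0..s} \<tau> * ennreal (d x powr \<gamma>)
          \<le> ennreal (\<Psi> (x - \<tau> *\<^sub>R e) * t x powr \<kappa>) * indicator {0..R / 4} \<tau>"
        proof (cases "\<tau> \<in> {0..s}")
          case True
          then have \<tau>: "0 \<le> \<tau>" "\<tau> \<le> R / 4" using s by auto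
          have "d x powr \<nu> \<le> d (x - \<tau> *\<^sub>R e) powr \<nu>"
            using d_mono_shift[OF x(1,2) \<tau>] nu d_pos[OF x(1)] by (intro powr_mono2) auto
          then have "d x powr \<gamma> \<le> M powr (- \<sigma>) * (t x powr \<sigma> * d (x - \<tau> *\<^sub>R e) powr \<nu>)"
            by (intro order_trans[OF d_powr_le[OF x(1,4)]] mult_left_mono) auto
          then have "b powr (1 - p) * t x powr (- (b * (p - 1))) * ?g * d x powr \<gamma>
            \<le> b powr (1 - p) * t x powr (- (b * (p - 1))) * ?g * (M powr (- \<sigma>) * (t x powr \<sigma> * d (x - \<tau> *\<^sub>R e) powr \<nu>))"
            by (rule mult_left_mono) simp
          also have "\<dots> = A * (?g * d (x - \<tau> *\<^sub>R e) powr \<nu>) * (t x powr (- (b * (p - 1))) * t x powr \<sigma>)"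
            by (simp add: A_def mult_ac)
          also have "\<dots> = \<Psi> (x - \<tau> *\<^sub>R e) * t x powr \<kappa>"
            by (simp only: powr_add[symmetric] \<kappa>(3) \<Psi>_def t_shift)
          finally show ?thesis using True \<tau>
            by (simp add: ennreal_leI flip: ennreal_mult)
        qed simp
      qed
      finally show ?thesis using True by simp
    qed simp
  qed
  then have "(\<integral>\<^sup>+x\<in>?N. ennreal (\<bar>f (x - s *\<^sub>R e) - f x\<bar> powr p * d x powr \<gamma>) \<partial>lborel)
    \<le> (\<integral>\<^sup>+x\<in>?N. (\<integral>\<^sup>+\<tau>\<in>{0..R / 4}. ennreal (\<Psi> (x - \<tau> *\<^sub>R e) * t x powr \<kappa>) \<partial>lborel) \<partial>lborel)"
    by (rule nn_integral_mono_AE)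
  also have "\<dots> \<le> (\<integral>\<^sup>+y\<in>?W. ennreal (\<Psi> y * (t y powr (\<kappa> + 1) / (\<kappa> + 1))) \<partial>lborel)"
  proof (rule nn_integral_shift_fibre_le[where e=e])
    show "0 \<le> \<Psi> y" for y using A G[of y] by (simp add: \<Psi>_def)
    show "0 < t x" if "x \<in> ?N" for x
      using that \<rho> R by (intro t_pos) auto
    show "x - s *\<^sub>R e \<in> ?W" if "x \<in> ?N" "0 \<le> s" "s \<le> R / 4" for x s
      using that shift_in_domain[of x s] \<rho> R by auto
  qed (use \<kappa> t_shift in measurable)
  also have "\<dots> \<le> (\<integral>\<^sup>+y. ennreal (M powr p * b powr (1 - p) / ((\<sigma> + 1) / 2)) *
      (ennreal (G y powr p * d y powr (\<gamma> + \<alpha> * p)) * indicator \<Omega> y) \<partial>lborel)"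
  proof (rule nn_integral_mono)
    fix y
    show "ennreal (\<Psi> y * (t y powr (\<kappa> + 1) / (\<kappa> + 1))) * indicator ?W y
      \<le> ennreal (M powr p * b powr (1 - p) / ((\<sigma> + 1) / 2)) *
        (ennreal (G y powr p * d y powr (\<gamma> + \<alpha> * p)) * indicator \<Omega> y)"
    proof (cases "y \<in> ?W")
      case True
      then have y: "y \<in> \<Omega>" "y \<in> ball z (R / 2)" by auto
      \<comment> \<open>The auxiliary exponent \<open>b\<close> cancels: the powers of
        \<open>t\<close> from Jensen and from the fibre integral recombine to the one needed in
        \<open>t_powr_le\<close>.\<close>
      have ex: "(b + 1) * (p - 1) + (\<kappa> + 1) = p + \<sigma>"
        using \<kappa>(2) bp by (simp add: distrib_right)
      have "\<Psi> y * (t y powr (\<kappa> + 1) / (\<kappa> + 1))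
        = A / (\<kappa> + 1) * G y powr p * (t y powr ((b + 1) * (p - 1)) * t y powr (\<kappa> + 1) * d y powr \<nu>)"
        by (simp add: \<Psi>_def mult_ac)
      also have "\<dots> = A / (\<kappa> + 1) * G y powr p * (t y powr (p + \<sigma>) * d y powr \<nu>)"
        by (simp only: powr_add[symmetric] ex)
      also have "\<dots> \<le> A / (\<kappa> + 1) * G y powr p * (M powr (p + \<sigma>) * d y powr (\<gamma> + \<alpha> * p))"
        using A \<kappa>(1) by (intro mult_left_mono t_powr_le y) auto
      also have "\<dots> = M powr (- \<sigma>) * M powr (p + \<sigma>) * b powr (1 - p) / (\<kappa> + 1) * (G y powr p * d y powr (\<gamma> + \<alpha> * p))"
        by (simp add: A_def mult_ac)
      also have "M powr (- \<sigma>) * M powr (p + \<sigma>) = M powr p"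
        by (simp flip: powr_add)
      finally have "\<Psi> y * (t y powr (\<kappa> + 1) / (\<kappa> + 1)) \<le>
          M powr p * b powr (1 - p) / ((\<sigma> + 1) / 2) * (G y powr p * d y powr (\<gamma> + \<alpha> * p))"
        unfolding \<kappa>(2) .
      then have "ennreal (\<Psi> y * (t y powr (\<kappa> + 1) / (\<kappa> + 1))) \<le>
          ennreal (M powr p * b powr (1 - p) / ((\<sigma> + 1) / 2)) * ennreal (G y powr p * d y powr (\<gamma> + \<alpha> * p))"
        using sigma by (subst ennreal_mult[symmetric]) (auto intro!: ennreal_leI)
      then show ?thesis using True by simp
    qed simp
  qed
  also have "\<dots> = ennreal (M powr p * b powr (1 - p) / ((\<sigma> + 1) / 2)) *
      (\<integral>\<^sup>+y\<in>\<Omega>. ennreal (G y powr p * d y powr (\<gamma> + \<alpha> * p)) \<partial>lborel)"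
    by (rule nn_integral_cmult) measurable
  finally show ?thesis by (simp only: b_def)
qed

text \<open>Points of depth at most \<open>R / 8\<close>, lowered by \<open>R / 8\<close> to
  \<open>R / 4\<close>, end up at depths between \<open>R / 8\<close> and \<open>3 * R / 8\<close>,
  hence away from the boundary. Moved to the lowered point \<open>y\<close>, the factor
  \<open>t x powr \<sigma>\<close> becomes \<open>(t y - s) powr \<sigma>\<close>, which may be
  singular; integration over \<open>s\<close> removes this singularity.\<close>

lemma averaged_shift_estimate:
  fixes f :: "'a \<Rightarrow> real"
  assumes [measurable]: "f \<in> borel_measurable borel" and \<rho>: "\<rho> \<le> R / 8"
    and t_small: "\<And>x. x \<in> ball z \<rho> \<Longrightarrow> t x \<le> R / 8"
    and \<epsilon>: "\<And>x. x \<in> \<Omega> \<Longrightarrow> x \<in> ball z (R / 2) \<Longrightarrow> R / 8 \<le> t x \<Longrightarrow> \<epsilon> \<le> d x"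
  shows "(\<integral>\<^sup>+s\<in>{R/8..R/4}. (\<integral>\<^sup>+x\<in>\<Omega> \<inter> ball z \<rho>. ennreal (\<bar>f (x - s *\<^sub>R e)\<bar> powr p * d x powr \<gamma>) \<partial>lborel) \<partial>lborel)
    \<le> ennreal (M powr (- \<sigma>) / (\<sigma> + 1)) * (\<integral>\<^sup>+x\<in>{x\<in>\<Omega>. \<epsilon> \<le> d x}. ennreal (\<bar>f x\<bar> powr p) \<partial>lborel)"
proof -
  let ?N = "\<Omega> \<inter> ball z \<rho>" and ?W = "\<Omega> \<inter> ball z (R / 2)" and ?E = "{x\<in>\<Omega>. \<epsilon> \<le> d x}"
  have [measurable]: "?E \<in> sets borel"
  proof -
    have "{x \<in> space borel. \<epsilon> \<le> d x} \<in> sets borel" by measurable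
    then have "\<Omega> \<inter> {x. \<epsilon> \<le> d x} \<in> sets borel" by simp
    then show ?thesis by (simp add: Int_def)
  qed
  define \<Psi> where "\<Psi> y = M powr (- \<sigma>) * (\<bar>f y\<bar> powr p * indicator {y. R / 8 \<le> t y \<and> t y \<le> 3 * R / 8} y)" for y
  have [measurable]: "\<Psi> \<in> borel_measurable borel" unfolding \<Psi>_def by measurable
  have "(\<integral>\<^sup>+s\<in>{R/8..R/4}. (\<integral>\<^sup>+x\<in>?N. ennreal (\<bar>f (x - s *\<^sub>R e)\<bar> powr p * d x powr \<gamma>) \<partial>lborel) \<partial>lborel)
    = (\<integral>\<^sup>+s. \<integral>\<^sup>+x. ennreal (\<bar>f (x - s *\<^sub>R e)\<bar> powr p * d x powr \<gamma>) * indicator ?N x * indicator {R/8..R/4} s \<partial>lborel \<partial>lborel)"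
    by (rule nn_integral_cong, rule nn_integral_multc[symmetric]) measurable
  also have "\<dots> = (\<integral>\<^sup>+x. \<integral>\<^sup>+s. ennreal (\<bar>f (x - s *\<^sub>R e)\<bar> powr p * d x powr \<gamma>) * indicator ?N x * indicator {R/8..R/4} s \<partial>lborel \<partial>lborel)"
    by (rule lborel_pair.Fubini') measurable
  also have "\<dots> \<le> (\<integral>\<^sup>+x. (\<integral>\<^sup>+s\<in>{0..R/4}. ennreal (\<Psi> (x - s *\<^sub>R e) * t x powr \<sigma>) \<partial>lborel) * indicator ?N x \<partial>lborel)"
  proof (rule nn_integral_mono)
    fix x
    have "(\<integral>\<^sup>+s. ennreal (\<bar>f (x - s *\<^sub>R e)\<bar> powr p * d x powr \<gamma>) * indicator ?N x * indicator {R/8..R/4} s \<partial>lborel)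
      \<le> (\<integral>\<^sup>+s. ennreal (\<Psi> (x - s *\<^sub>R e) * t x powr \<sigma>) * indicator {0..R/4} s * indicator ?N x \<partial>lborel)"
    proof (rule nn_integral_mono)
      fix s :: real
      show "ennreal (\<bar>f (x - s *\<^sub>R e)\<bar> powr p * d x powr \<gamma>) * indicator ?N x * indicator {R/8..R/4} s
        \<le> ennreal (\<Psi> (x - s *\<^sub>R e) * t x powr \<sigma>) * indicator {0..R/4} s * indicator ?N x"
      proof (cases "x \<in> ?N \<and> s \<in> {R/8..R/4}")
        case True
        then have x: "x \<in> \<Omega>" "x \<in> ball z (R / 2)" using \<rho> R by auto
        have "0 < t x" by (rule t_pos[OF x])
        moreover have "t x \<le> R / 8" using t_small True by auto
        ultimately have \<Psi>: "\<Psi> (x - s *\<^sub>R e) = M powr (- \<sigma>) * \<bar>f (x - s *\<^sub>R e)\<bar> powr p"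
          using True by (simp add: \<Psi>_def t_shift)
        have "d x \<le> 1" using d_less[OF x(2)] R by linarith
        then have "d x powr \<nu> \<le> 1" using nu d_pos[OF x(1)] by (simp add: powr_le1)
        then have "t x powr \<sigma> * d x powr \<nu> \<le> t x powr \<sigma>" by (simp add: mult_left_le)
        then have "d x powr \<gamma> \<le> M powr (- \<sigma>) * t x powr \<sigma>"
          by (intro order_trans[OF d_powr_le[OF x]] mult_left_mono) auto
        then have "\<bar>f (x - s *\<^sub>R e)\<bar> powr p * d x powr \<gamma> \<le> \<bar>f (x - s *\<^sub>R e)\<bar> powr p * (M powr (- \<sigma>) * t x powr \<sigma>)"
          by (intro mult_left_mono) auto
        also have "\<dots> = \<Psi> (x - s *\<^sub>R e) * t x powr \<sigma>" by (simp add: \<Psi> mult_ac)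
        finally show ?thesis using True R by (simp add: ennreal_leI)
      qed (auto simp: indicator_def)
    qed
    also have "\<dots> = (\<integral>\<^sup>+s\<in>{0..R/4}. ennreal (\<Psi> (x - s *\<^sub>R e) * t x powr \<sigma>) \<partial>lborel) * indicator ?N x"
      by (rule nn_integral_multc) measurable
    finally show "(\<integral>\<^sup>+s. ennreal (\<bar>f (x - s *\<^sub>R e)\<bar> powr p * d x powr \<gamma>) * indicator ?N x * indicator {R/8..R/4} s \<partial>lborel)
      \<le> (\<integral>\<^sup>+s\<in>{0..R/4}. ennreal (\<Psi> (x - s *\<^sub>R e) * t x powr \<sigma>) \<partial>lborel) * indicator ?N x" .
  qed
  also have "\<dots> \<le> (\<integral>\<^sup>+y\<in>?W. ennreal (\<Psi> y * (t y powr (\<sigma> + 1) / (\<sigma> + 1))) \<partial>lborel)"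
  proof (rule nn_integral_shift_fibre_le[where e=e])
    show "0 \<le> \<Psi> y" for y by (simp add: \<Psi>_def)
    show "0 < t x" if "x \<in> ?N" for x
      using that \<rho> R by (intro t_pos) auto
    show "x - s *\<^sub>R e \<in> ?W" if "x \<in> ?N" "0 \<le> s" "s \<le> R / 4" for x s
      using that shift_in_domain[of x s] \<rho> R by auto
  qed (use sigma t_shift in measurable)
  also have "\<dots> \<le> (\<integral>\<^sup>+y. ennreal (M powr (- \<sigma>) / (\<sigma> + 1)) * (ennreal (\<bar>f y\<bar> powr p) * indicator ?E y) \<partial>lborel)"
  proof (rule nn_integral_mono)
    fix y
    show "ennreal (\<Psi> y * (t y powr (\<sigma> + 1) / (\<sigma> + 1))) * indicator ?W y
      \<le> ennreal (M powr (- \<sigma>) / (\<sigma> + 1)) * (ennreal (\<bar>f y\<bar> powr p) * indicator ?E y)"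
    proof (cases "y \<in> ?W \<and> R / 8 \<le> t y \<and> t y \<le> 3 * R / 8")
      case True
      then have "y \<in> ?E" using \<epsilon> by auto
      have "t y powr (\<sigma> + 1) \<le> 1" using True R sigma by (intro powr_le1) auto
      then have "M powr (- \<sigma>) * \<bar>f y\<bar> powr p * (t y powr (\<sigma> + 1) / (\<sigma> + 1)) \<le> M powr (- \<sigma>) * \<bar>f y\<bar> powr p * (1 / (\<sigma> + 1))"
        using sigma by (intro mult_left_mono divide_right_mono) auto
      then have "ennreal (\<Psi> y * (t y powr (\<sigma> + 1) / (\<sigma> + 1))) \<le> ennreal (M powr (- \<sigma>) / (\<sigma> + 1) * \<bar>f y\<bar> powr p)"
        using True by (intro ennreal_leI) (simp add: \<Psi>_def)
      also have "\<dots> = ennreal (M powr (- \<sigma>) / (\<sigma> + 1)) * ennreal (\<bar>f y\<bar> powr p)"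
        using sigma by (intro ennreal_mult) auto
      finally show ?thesis using True \<open>y \<in> ?E\<close> by simp
    qed (auto simp: \<Psi>_def indicator_def)
  qed
  also have "\<dots> = ennreal (M powr (- \<sigma>) / (\<sigma> + 1)) * (\<integral>\<^sup>+y\<in>?E. ennreal (\<bar>f y\<bar> powr p) \<partial>lborel)"
    by (rule nn_integral_cmult) measurable
  finally show ?thesis .
qed

lemma boundary_estimate:
  "\<exists>\<rho>>0. \<exists>\<epsilon>>0. \<exists>C::real. \<forall>f G. upper_gradient \<Omega> f G \<longrightarrow>
    (\<integral>\<^sup>+x\<in>\<Omega> \<inter> ball z \<rho>. ennreal (\<bar>f x\<bar> powr p * d x powr \<gamma>) \<partial>lborel) \<le>
    ennreal C * ((\<integral>\<^sup>+x\<in>\<Omega>. ennreal (G x powr p * d x powr (\<gamma> + \<alpha> * p)) \<partial>lborel) +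
                 (\<integral>\<^sup>+x\<in>{x\<in>\<Omega>. \<epsilon> \<le> d x}. ennreal (\<bar>f x\<bar> powr p) \<partial>lborel))"
proof -
  have "isCont t z" using t_cont by (simp add: continuous_on_eq_continuous_at)
  then obtain \<delta> where \<delta>: "0 < \<delta>" "\<And>x. dist x z < \<delta> \<Longrightarrow> dist (t x) (t z) < R / 8"
    using R unfolding continuous_at_eps_delta by (metis divide_pos_pos zero_less_numeral)
  define \<rho> where "\<rho> = min \<delta> (R / 8)"
  have \<rho>: "0 < \<rho>" "\<rho> \<le> R / 8" using \<delta> R by (auto simp: \<rho>_def)
  have t_small: "t x \<le> R / 8" if "x \<in> ball z \<rho>" for x
    using \<delta>(2)[of x] that by (auto simp: \<rho>_def t_z dist_commute dist_real_def)
  \<comment> \<open>The solution of \<open>M * \<epsilon> powr \<alpha> = R / 8\<close>: by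
    \<open>t_le\<close>, depth at least \<open>R / 8\<close> forces distance at least
    \<epsilon>.\<close>
  define \<epsilon> where "\<epsilon> = (R / 8 / M) powr (1 / \<alpha>)"
  have \<epsilon>_pos: "0 < \<epsilon>" using R M by (simp add: \<epsilon>_def)
  have \<epsilon>: "\<epsilon> \<le> d x" if "x \<in> \<Omega>" "x \<in> ball z (R / 2)" "R / 8 \<le> t x" for x
  proof -
    have "R / 8 / M \<le> d x powr \<alpha>"
      using t_le[OF that(1,2)] that(3) M by (simp add: field_simps)
    then have "\<epsilon> \<le> (d x powr \<alpha>) powr (1 / \<alpha>)"
      unfolding \<epsilon>_def using R M alpha by (intro powr_mono2) auto
    also have "\<dots> = d x" using alpha d_pos[OF that(1)] by (simp add: powr_powr)
    finally show ?thesis .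
  qed
  define C1 where "C1 = M powr p * ((\<sigma> + 1) / (2 * (p - 1))) powr (1 - p) / ((\<sigma> + 1) / 2)"
  define C2 where "C2 = M powr (- \<sigma>) / (\<sigma> + 1)"
  have C12: "0 \<le> C1" "0 \<le> C2" using sigma by (auto simp: C1_def C2_def)
  \<comment> \<open>The factor \<open>2 powr p\<close> comes from splitting \<open>f x\<close>
    through \<open>f (x - s *\<^sub>R e)\<close>, and \<open>8 / R\<close> is the reciprocal length
    of the interval of shifts.\<close>
  define C where "C = 2 powr p * C1 + 8 / R * 2 powr p * C2"
  have "(\<integral>\<^sup>+x\<in>\<Omega> \<inter> ball z \<rho>. ennreal (\<bar>f x\<bar> powr p * d x powr \<gamma>) \<partial>lborel) \<le>
    ennreal C * ((\<integral>\<^sup>+x\<in>\<Omega>. ennreal (G x powr p * d x powr (\<gamma> + \<alpha> * p)) \<partial>lborel) +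
                 (\<integral>\<^sup>+x\<in>{x\<in>\<Omega>. \<epsilon> \<le> d x}. ennreal (\<bar>f x\<bar> powr p) \<partial>lborel))"
    (is "?I \<le> _ * (?X + ?Y)") if ug: "upper_gradient \<Omega> f G" for f G
  proof -
    have [measurable]: "f \<in> borel_measurable borel"
      using ug by (auto simp: upper_gradient_def)
    let ?N = "\<Omega> \<inter> ball z \<rho>"
    define B where "B s = (\<integral>\<^sup>+x\<in>?N. ennreal (\<bar>f (x - s *\<^sub>R e)\<bar> powr p * d x powr \<gamma>) \<partial>lborel)" for s
    have [measurable]: "B \<in> borel_measurable borel"
      unfolding B_def by measurable
    have I_le: "?I \<le> ennreal (2 powr p) * (ennreal C1 * ?X + B s)" if s: "0 \<le> s" "s \<le> R / 4" for s
    proof -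
      have "?I \<le> (\<integral>\<^sup>+x. ennreal (2 powr p) * (ennreal (\<bar>f (x - s *\<^sub>R e) - f x\<bar> powr p * d x powr \<gamma>) * indicator ?N x
          + ennreal (\<bar>f (x - s *\<^sub>R e)\<bar> powr p * d x powr \<gamma>) * indicator ?N x) \<partial>lborel)"
      proof (rule nn_integral_mono)
        fix x
        let ?u = "\<bar>f (x - s *\<^sub>R e) - f x\<bar> powr p" and ?v = "\<bar>f (x - s *\<^sub>R e)\<bar> powr p"
        have "\<bar>f x\<bar> powr p \<le> 2 powr p * (?u + ?v)"
          using abs_add_powr_le[of p "- (f (x - s *\<^sub>R e) - f x)" "f (x - s *\<^sub>R e)"] p
          by (simp add: abs_minus_commute)
        then have "\<bar>f x\<bar> powr p * d x powr \<gamma> \<le> 2 powr p * (?u + ?v) * d x powr \<gamma>"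
          by (rule mult_right_mono) simp
        also have "\<dots> = 2 powr p * (?u * d x powr \<gamma> + ?v * d x powr \<gamma>)"
          by (simp add: algebra_simps)
        finally have "ennreal (\<bar>f x\<bar> powr p * d x powr \<gamma>)
            \<le> ennreal (2 powr p) * (ennreal (?u * d x powr \<gamma>) + ennreal (?v * d x powr \<gamma>))"
          by (subst ennreal_plus[symmetric], simp, simp, subst ennreal_mult[symmetric])
             (auto intro: ennreal_leI)
        then show "ennreal (\<bar>f x\<bar> powr p * d x powr \<gamma>) * indicator ?N x
          \<le> ennreal (2 powr p) * (ennreal (?u * d x powr \<gamma>) * indicator ?N x + ennreal (?v * d x powr \<gamma>) * indicator ?N x)"
          by (cases "x \<in> ?N") auto
      qed
      also have "\<dots> = ennreal (2 powr p) * ((\<integral>\<^sup>+x\<in>?N. ennreal (\<bar>f (x - s *\<^sub>R e) - f x\<bar> powr p * d x powr \<gamma>) \<partial>lborel) + B s)"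
        unfolding B_def by (rule nn_integral_cmult_add) measurable
      also have "\<dots> \<le> ennreal (2 powr p) * (ennreal C1 * ?X + B s)"
        unfolding C1_def by (intro mult_left_mono add_right_mono hardy_shift_estimate ug \<rho>(2) s) simp
      finally show ?thesis .
    qed
    \<comment> \<open>The left side does not depend on \<open>s\<close>, so it can be integrated
      over the shifts. No term is subtracted, hence \<open>?I\<close> may be infinite.\<close>
    have "ennreal (R / 8) * ?I = (\<integral>\<^sup>+s\<in>{R/8..R/4}. ?I \<partial>lborel)"
    proof -
      have "emeasure lborel {R/8..R/4} = ennreal (R / 8)" using R by simp
      then show ?thesis by (subst nn_integral_cmult_indicator) (simp_all only: mult.commute, simp)
    qed
    also have "\<dots> \<le> (\<integral>\<^sup>+s. ennreal (2 powr p) * (ennreal C1 * ?X * indicator {R/8..R/4} s + B s * indicator {R/8..R/4} s) \<partial>lborel)"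
    proof (rule nn_integral_mono)
      fix s :: real
      show "?I * indicator {R/8..R/4} s \<le> ennreal (2 powr p) * (ennreal C1 * ?X * indicator {R/8..R/4} s + B s * indicator {R/8..R/4} s)"
        using I_le[of s] R by (cases "s \<in> {R/8..R/4}") auto
    qed
    also have "\<dots> = ennreal (2 powr p) * ((\<integral>\<^sup>+s\<in>{R/8..R/4}. ennreal C1 * ?X \<partial>lborel) + (\<integral>\<^sup>+s\<in>{R/8..R/4}. B s \<partial>lborel))"
      by (rule nn_integral_cmult_add) measurable
    also have "\<dots> \<le> ennreal (2 powr p) * (ennreal C1 * ?X * ennreal (R / 8) + ennreal C2 * ?Y)"
    proof (intro mult_left_mono add_mono)
      show "(\<integral>\<^sup>+s\<in>{R/8..R/4}. ennreal C1 * ?X \<partial>lborel) \<le> ennreal C1 * ?X * ennreal (R / 8)"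
        using R by (simp add: nn_integral_cmult_indicator)
      show "(\<integral>\<^sup>+s\<in>{R/8..R/4}. B s \<partial>lborel) \<le> ennreal C2 * ?Y"
        unfolding B_def C2_def by (rule averaged_shift_estimate[OF _ \<rho>(2) t_small \<epsilon>]) simp
    qed simp
    finally have "ennreal (8 / R) * (ennreal (R / 8) * ?I) \<le>
        ennreal (8 / R) * (ennreal (2 powr p) * (ennreal C1 * ?X * ennreal (R / 8) + ennreal C2 * ?Y))"
      by (rule mult_left_mono) simp
    moreover have "ennreal (8 / R) * (ennreal (R / 8) * ?I) = ?I"
      using R by (simp add: mult.assoc[symmetric] flip: ennreal_mult)
    moreover have "ennreal (8 / R) * (ennreal (2 powr p) * (ennreal C1 * ?X * ennreal (R / 8) + ennreal C2 * ?Y))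
        = ennreal (8 / R * 2 powr p * C1 * (R / 8)) * ?X + ennreal (8 / R * 2 powr p * C2) * ?Y"
      using R C12 by (intro ennreal_distrib_real) auto
    moreover have "ennreal (8 / R * 2 powr p * C1 * (R / 8)) * ?X \<le> ennreal C * ?X"
      using R C12 by (intro mult_right_mono ennreal_leI) (auto simp: C_def)
    moreover have "ennreal (8 / R * 2 powr p * C2) * ?Y \<le> ennreal C * ?Y"
      using R C12 by (intro mult_right_mono ennreal_leI) (auto simp: C_def)
    ultimately show ?thesis
      by (simp add: distrib_left) (meson add_mono order_trans)
  qed
  then show ?thesis using \<rho>(1) \<epsilon>_pos by blast
qed

end

subsection \<open>The Poincare inequality in the interior\<close>

text \<open>Jensen on the unit interval, Tonelli, and translation invariance. Convexity keeps the
  whole segment from \<open>x\<close> to \<open>x + h\<close> in \<open>B\<close>, so each translate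
  contributes at most the integral over \<open>B\<close>.\<close>

lemma upper_gradient_translation_estimate:
  fixes f G :: "'a::euclidean_space \<Rightarrow> real" and h :: 'a
  assumes ug: "upper_gradient \<Omega> f G" and p: "1 < p"
    and B: "convex B" "B \<subseteq> \<Omega>" and [measurable]: "B \<in> sets borel"
  shows "(\<integral>\<^sup>+x. indicator B x * (indicator B (x + h) * ennreal (\<bar>f (x + h) - f x\<bar> powr p)) \<partial>lborel)
    \<le> ennreal (norm h powr p) * (\<integral>\<^sup>+x\<in>B. ennreal (G x powr p) \<partial>lborel)"
proof -
  have [measurable]: "f \<in> borel_measurable borel" "G \<in> borel_measurable borel" and G: "\<And>x. 0 \<le> G x"
    using ug by (auto simp: upper_gradient_def)
  let ?X = "\<integral>\<^sup>+x\<in>B. ennreal (G x powr p) \<partial>lborel"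
  have "AE x in lborel. (\<forall>\<tau>\<in>{0..1}. x + \<tau> *\<^sub>R h \<in> \<Omega>) \<longrightarrow>
        ennreal \<bar>f (x + 1 *\<^sub>R h) - f x\<bar> \<le> (\<integral>\<^sup>+\<tau>\<in>{0..1}. ennreal (norm h * G (x + \<tau> *\<^sub>R h)) \<partial>lborel)"
    using ug zero_le_one[where 'a=real] unfolding upper_gradient_def by blast
  then have "AE x in lborel. indicator B x * (indicator B (x + h) * ennreal (\<bar>f (x + h) - f x\<bar> powr p))
      \<le> (\<integral>\<^sup>+\<tau>. indicator B (x + \<tau> *\<^sub>R h) * ennreal (G (x + \<tau> *\<^sub>R h) powr p) * (indicator {0..1} \<tau> * ennreal (norm h powr p)) \<partial>lborel)"
  proof eventually_elim
    fix x
    assume seg: "(\<forall>\<tau>\<in>{0..1}. x + \<tau> *\<^sub>R h \<in> \<Omega>) \<longrightarrow>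
        ennreal \<bar>f (x + 1 *\<^sub>R h) - f x\<bar> \<le> (\<integral>\<^sup>+\<tau>\<in>{0..1}. ennreal (norm h * G (x + \<tau> *\<^sub>R h)) \<partial>lborel)"
    show "indicator B x * (indicator B (x + h) * ennreal (\<bar>f (x + h) - f x\<bar> powr p))
      \<le> (\<integral>\<^sup>+\<tau>. indicator B (x + \<tau> *\<^sub>R h) * ennreal (G (x + \<tau> *\<^sub>R h) powr p) * (indicator {0..1} \<tau> * ennreal (norm h powr p)) \<partial>lborel)"
    proof (cases "x \<in> B \<and> x + h \<in> B")
      case True
      have inB: "x + \<tau> *\<^sub>R h \<in> B" if "\<tau> \<in> {0..1}" for \<tau>
        using convexD[OF B(1), of x "x + h" "1 - \<tau>" \<tau>] True that by (simp add: algebra_simps)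
      have "\<forall>\<tau>\<in>{0..1}. x + \<tau> *\<^sub>R h \<in> \<Omega>" using inB B(2) by blast
      with seg have "ennreal \<bar>f (x + h) - f x\<bar> \<le> (\<integral>\<^sup>+\<tau>\<in>{0..1}. ennreal (norm h * G (x + \<tau> *\<^sub>R h)) \<partial>lborel)"
        by simp
      also have "\<dots> = (\<integral>\<^sup>+\<tau>. ennreal (norm h * G (x + \<tau> *\<^sub>R h) * indicator {0..1} \<tau>) \<partial>lborel)"
        by (intro nn_integral_cong) (auto simp: indicator_def)
      finally have "ennreal (\<bar>f (x + h) - f x\<bar> powr p)
          \<le> (\<integral>\<^sup>+\<tau>. ennreal ((norm h * G (x + \<tau> *\<^sub>R h)) powr p * indicator {0..1} \<tau>) \<partial>lborel)"
        using G by (intro powr_nn_integral_le p) (simp_all add: ennreal_indicator)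
      also have "\<dots> \<le> (\<integral>\<^sup>+\<tau>. indicator B (x + \<tau> *\<^sub>R h) * ennreal (G (x + \<tau> *\<^sub>R h) powr p) * (indicator {0..1} \<tau> * ennreal (norm h powr p)) \<partial>lborel)"
      proof (rule nn_integral_mono)
        fix \<tau> :: real
        show "ennreal ((norm h * G (x + \<tau> *\<^sub>R h)) powr p * indicator {0..1} \<tau>)
          \<le> indicator B (x + \<tau> *\<^sub>R h) * ennreal (G (x + \<tau> *\<^sub>R h) powr p) * (indicator {0..1} \<tau> * ennreal (norm h powr p))"
          using inB[of \<tau>] G by (cases "\<tau> \<in> {0..1}") (simp_all add: powr_mult ennreal_mult mult.commute)
      qed
      finally show ?thesis using True by simp
    qed auto
  qed
  then have "(\<integral>\<^sup>+x. indicator B x * (indicator B (x + h) * ennreal (\<bar>f (x + h) - f x\<bar> powr p)) \<partial>lborel)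
    \<le> (\<integral>\<^sup>+x. \<integral>\<^sup>+\<tau>. indicator B (x + \<tau> *\<^sub>R h) * ennreal (G (x + \<tau> *\<^sub>R h) powr p) * (indicator {0..1} \<tau> * ennreal (norm h powr p)) \<partial>lborel \<partial>lborel)"
    by (rule nn_integral_mono_AE)
  also have "\<dots> = (\<integral>\<^sup>+\<tau>. \<integral>\<^sup>+x. indicator B (x + \<tau> *\<^sub>R h) * ennreal (G (x + \<tau> *\<^sub>R h) powr p) * (indicator {0..1} \<tau> * ennreal (norm h powr p)) \<partial>lborel \<partial>lborel)"
    by (rule lborel_pair.Fubini') measurable
  also have "\<dots> = (\<integral>\<^sup>+\<tau>. ?X * ennreal (norm h powr p) * indicator {0..1::real} \<tau> \<partial>lborel)"
  proof (rule nn_integral_cong)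
    fix \<tau> :: real
    have "(\<integral>\<^sup>+x. indicator B (x + \<tau> *\<^sub>R h) * ennreal (G (x + \<tau> *\<^sub>R h) powr p) * (indicator {0..1} \<tau> * ennreal (norm h powr p)) \<partial>lborel)
      = (\<integral>\<^sup>+x. indicator B x * ennreal (G x powr p) * (indicator {0..1} \<tau> * ennreal (norm h powr p)) \<partial>lborel)"
      by (rule nn_integral_lborel_shift[of "\<lambda>x. indicator B x * ennreal (G x powr p) * (indicator {0..1} \<tau> * ennreal (norm h powr p))"]) measurable
    also have "\<dots> = (\<integral>\<^sup>+x. indicator B x * ennreal (G x powr p) \<partial>lborel) * (indicator {0..1} \<tau> * ennreal (norm h powr p))"
      by (rule nn_integral_multc) measurable
    finally show "(\<integral>\<^sup>+x. indicator B (x + \<tau> *\<^sub>R h) * ennreal (G (x + \<tau> *\<^sub>R h) powr p) * (indicator {0..1} \<tau> * ennreal (norm h powr p)) \<partial>lborel)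
      = ?X * ennreal (norm h powr p) * indicator {0..1} \<tau>"
      by (simp add: mult_ac)
  qed
  also have "\<dots> = ?X * ennreal (norm h powr p) * emeasure lborel {0..1::real}"
    by (rule nn_integral_cmult_indicator) simp
  finally show ?thesis by (simp add: mult.commute)
qed

text \<open>Substitute \<open>y = x + h\<close> and integrate the translation estimate over
  \<open>h\<close>; only vectors shorter than the diameter contribute. The double integral takes the
  place of a mean value, so that \<open>f\<close> may fail to be integrable.\<close>

lemma poincare_ball:
  fixes f G :: "'a::euclidean_space \<Rightarrow> real"
  assumes ug: "upper_gradient \<Omega> f G" and p: "1 < p" and B: "ball a r \<subseteq> \<Omega>"
  shows "(\<integral>\<^sup>+x\<in>ball a r. (\<integral>\<^sup>+y\<in>ball a r. ennreal (\<bar>f y - f x\<bar> powr p) \<partial>lborel) \<partial>lborel)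
    \<le> ennreal ((2 * r) powr p * measure lborel (ball (0::'a) (2 * r))) * (\<integral>\<^sup>+x\<in>ball a r. ennreal (G x powr p) \<partial>lborel)"
proof -
  have [measurable]: "f \<in> borel_measurable borel" "G \<in> borel_measurable borel"
    using ug by (auto simp: upper_gradient_def)
  let ?B = "ball a r" and ?X = "\<integral>\<^sup>+x\<in>ball a r. ennreal (G x powr p) \<partial>lborel"
  have "(\<integral>\<^sup>+x\<in>?B. (\<integral>\<^sup>+y\<in>?B. ennreal (\<bar>f y - f x\<bar> powr p) \<partial>lborel) \<partial>lborel)
    = (\<integral>\<^sup>+x. \<integral>\<^sup>+h. indicator ?B x * (indicator ?B (x + h) * ennreal (\<bar>f (x + h) - f x\<bar> powr p)) \<partial>lborel \<partial>lborel)"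
  proof (rule nn_integral_cong)
    fix x
    have "(\<integral>\<^sup>+y\<in>?B. ennreal (\<bar>f y - f x\<bar> powr p) \<partial>lborel)
        = (\<integral>\<^sup>+h. ennreal (\<bar>f (h + x) - f x\<bar> powr p) * indicator ?B (h + x) \<partial>lborel)"
      by (rule nn_integral_lborel_shift[symmetric, of "\<lambda>y. ennreal (\<bar>f y - f x\<bar> powr p) * indicator ?B y"]) measurable
    also have "\<dots> = (\<integral>\<^sup>+h. indicator ?B (x + h) * ennreal (\<bar>f (x + h) - f x\<bar> powr p) \<partial>lborel)"
      by (simp add: add.commute mult.commute)
    finally have "(\<integral>\<^sup>+y\<in>?B. ennreal (\<bar>f y - f x\<bar> powr p) \<partial>lborel) * indicator ?B x
        = indicator ?B x * (\<integral>\<^sup>+h. indicator ?B (x + h) * ennreal (\<bar>f (x + h) - f x\<bar> powr p) \<partial>lborel)"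
      by (simp add: mult.commute)
    also have "\<dots> = (\<integral>\<^sup>+h. indicator ?B x * (indicator ?B (x + h) * ennreal (\<bar>f (x + h) - f x\<bar> powr p)) \<partial>lborel)"
      by (rule nn_integral_cmult[symmetric]) measurable
    finally show "(\<integral>\<^sup>+y\<in>?B. ennreal (\<bar>f y - f x\<bar> powr p) \<partial>lborel) * indicator ?B x
        = (\<integral>\<^sup>+h. indicator ?B x * (indicator ?B (x + h) * ennreal (\<bar>f (x + h) - f x\<bar> powr p)) \<partial>lborel)" .
  qed
  also have "\<dots> = (\<integral>\<^sup>+h. \<integral>\<^sup>+x. indicator ?B x * (indicator ?B (x + h) * ennreal (\<bar>f (x + h) - f x\<bar> powr p)) \<partial>lborel \<partial>lborel)"
    by (rule lborel_pair.Fubini') measurable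
  also have "\<dots> \<le> (\<integral>\<^sup>+h. ennreal ((2 * r) powr p) * ?X * indicator (ball 0 (2 * r)) (h::'a) \<partial>lborel)"
  proof (rule nn_integral_mono)
    fix h :: 'a
    show "(\<integral>\<^sup>+x. indicator ?B x * (indicator ?B (x + h) * ennreal (\<bar>f (x + h) - f x\<bar> powr p)) \<partial>lborel)
      \<le> ennreal ((2 * r) powr p) * ?X * indicator (ball 0 (2 * r)) h"
    proof (cases "h \<in> ball 0 (2 * r)")
      case True
      then have "norm h powr p \<le> (2 * r) powr p" using p by (intro powr_mono2) auto
      then have "ennreal (norm h powr p) * ?X \<le> ennreal ((2 * r) powr p) * ?X"
        by (intro mult_right_mono ennreal_leI) auto
      with upper_gradient_translation_estimate[OF ug p convex_ball B, of h]
      show ?thesis using True by auto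
    next
      case False
      have zero: "indicator ?B x * (indicator ?B (x + h) * c) = 0" for x and c :: ennreal
      proof -
        have "\<not> (x \<in> ?B \<and> x + h \<in> ?B)"
        proof
          assume "x \<in> ?B \<and> x + h \<in> ?B"
          then have "dist x (x + h) < 2 * r" using dist_triangle2[of x "x + h" a] by (auto simp: dist_commute)
          then show False using False by (simp add: dist_norm)
        qed
        then show ?thesis by (auto simp: indicator_def)
      qed
      show ?thesis by (simp only: zero) simp
    qed
  qed
  also have "\<dots> = ennreal ((2 * r) powr p) * ?X * emeasure lborel (ball (0::'a) (2 * r))"
    by (rule nn_integral_cmult_indicator) simp
  also have "emeasure lborel (ball (0::'a) (2 * r)) = ennreal (measure lborel (ball (0::'a) (2 * r)))"
    using less_imp_neq[OF emeasure_lborel_ball_finite[of "0::'a" "2 * r"]]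
    by (intro emeasure_eq_ennreal_measure) simp
  finally show ?thesis by (simp add: ennreal_mult mult_ac)
qed

text \<open>This serves to pick a good centre value. If \<open>F\<close> exceeded \<open>v\<close>
  throughout \<open>B\<close>, the excess would have integral 0 there, so \<open>B\<close> would be
  null.\<close>

lemma exists_le_average:
  fixes F :: "'a \<Rightarrow> ennreal"
  assumes [measurable]: "F \<in> borel_measurable N" "B \<in> sets N"
    and B: "0 < emeasure N B" "emeasure N B < \<infinity>" and v: "v < \<infinity>"
    and le: "(\<integral>\<^sup>+x\<in>B. F x \<partial>N) \<le> v * emeasure N B"
  shows "\<exists>x\<in>B. F x \<le> v"
proof (rule ccontr)
  assume "\<not> ?thesis"
  then have gt: "v < F x" if "x \<in> B" for x using that by (auto simp: not_le)
  have vB: "(\<integral>\<^sup>+x\<in>B. v \<partial>N) = v * emeasure N B"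
    by (rule nn_integral_cmult_indicator) simp
  have fin: "v * emeasure N B < \<infinity>" using B v by (simp add: ennreal_mult_less_top)
  have "(\<integral>\<^sup>+x. F x * indicator B x - v * indicator B x \<partial>N) = (\<integral>\<^sup>+x\<in>B. F x \<partial>N) - (\<integral>\<^sup>+x\<in>B. v \<partial>N)"
  proof (rule nn_integral_diff)
    show "(\<integral>\<^sup>+x\<in>B. v \<partial>N) \<noteq> \<infinity>" unfolding vB using fin by simp
    show "AE x in N. v * indicator B x \<le> F x * indicator B x"
      using gt by (intro AE_I2) (auto simp: indicator_def less_imp_le)
  qed measurable
  also have "\<dots> = 0" using le order.strict_trans1[OF le fin] unfolding vB by (simp add: diff_eq_0_iff_ennreal)
  finally have "AE x in N. F x * indicator B x - v * indicator B x = 0"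
    by (subst (asm) nn_integral_0_iff_AE) auto
  then have "AE x in N. x \<notin> B"
  proof eventually_elim
    fix x assume "F x * indicator B x - v * indicator B x = 0"
    then have "x \<in> B \<Longrightarrow> F x \<le> v" using ennreal_minus_eq_0[of "F x" v] by simp
    then show "x \<notin> B" using gt[of x] by auto
  qed
  then have "emeasure N B = 0" by (subst (asm) AE_iff_measurable[OF \<open>B \<in> sets N\<close>]) (use sets.sets_into_space[OF \<open>B \<in> sets N\<close>] in auto)
  with B show False by simp
qed

text \<open>Averaging over a ball that is common to \<open>A\<close> and \<open>B\<close> transfers a bound from \<open>A\<close> to \<open>B\<close>.\<close>

lemma transfer_estimate:
  fixes f :: "'a::euclidean_space \<Rightarrow> real"
  assumes [measurable]: "f \<in> borel_measurable borel" and p: "0 < p" and q: "0 < q"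
    and sub: "ball b q \<subseteq> A" "ball b q \<subseteq> ball a r"
    and [measurable]: "A \<in> sets borel"
  shows "(\<integral>\<^sup>+x\<in>ball a r. ennreal (\<bar>f x - c\<bar> powr p) \<partial>lborel) \<le>
    ennreal (2 powr p / measure lborel (ball b q)) *
     ((\<integral>\<^sup>+x\<in>ball a r. (\<integral>\<^sup>+y\<in>ball a r. ennreal (\<bar>f y - f x\<bar> powr p) \<partial>lborel) \<partial>lborel)
      + ennreal (measure lborel (ball a r)) * (\<integral>\<^sup>+x\<in>A. ennreal (\<bar>f x - c\<bar> powr p) \<partial>lborel))"
proof -
  let ?B = "ball a r" and ?Q = "ball b q"
  let ?D = "\<lambda>x. \<integral>\<^sup>+y\<in>?B. ennreal (\<bar>f y - f x\<bar> powr p) \<partial>lborel"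
  let ?A = "\<integral>\<^sup>+x\<in>A. ennreal (\<bar>f x - c\<bar> powr p) \<partial>lborel"
  have em: "emeasure lborel (ball w s) = ennreal (measure lborel (ball w s))" for w :: 'a and s
    using less_imp_neq[OF emeasure_lborel_ball_finite[of w s]]
    by (intro emeasure_eq_ennreal_measure) simp
  define m where "m = measure lborel ?Q"
  have m: "0 < m" unfolding m_def using q content_ball_pos[of q b] by simp
  have pt: "ennreal (\<bar>f x - c\<bar> powr p) \<le> ennreal (2 powr p / m) * (?D x + ?A)" for x
  proof -
    have "ennreal (\<bar>f x - c\<bar> powr p) * ennreal m = (\<integral>\<^sup>+y\<in>?Q. ennreal (\<bar>f x - c\<bar> powr p) \<partial>lborel)"
      unfolding m_def em[symmetric] by (rule nn_integral_cmult_indicator[symmetric]) simp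
    also have "\<dots> \<le> (\<integral>\<^sup>+y. ennreal (2 powr p) * (ennreal (\<bar>f y - f x\<bar> powr p) * indicator ?B y
        + ennreal (\<bar>f y - c\<bar> powr p) * indicator A y) \<partial>lborel)"
    proof (rule nn_integral_mono)
      fix y
      have "\<bar>f x - c\<bar> powr p \<le> 2 powr p * (\<bar>f y - f x\<bar> powr p + \<bar>f y - c\<bar> powr p)"
        using abs_add_powr_le[OF p, of "f x - f y" "f y - c"] by (simp add: abs_minus_commute)
      then have "ennreal (\<bar>f x - c\<bar> powr p) \<le> ennreal (2 powr p) * (ennreal (\<bar>f y - f x\<bar> powr p) + ennreal (\<bar>f y - c\<bar> powr p))"
        by (subst ennreal_plus[symmetric], simp, simp, subst ennreal_mult[symmetric])
           (auto intro: ennreal_leI)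
      then show "ennreal (\<bar>f x - c\<bar> powr p) * indicator ?Q y \<le>
          ennreal (2 powr p) * (ennreal (\<bar>f y - f x\<bar> powr p) * indicator ?B y + ennreal (\<bar>f y - c\<bar> powr p) * indicator A y)"
      proof (cases "y \<in> ?Q")
        case True
        then have "y \<in> A" "y \<in> ?B" using sub by blast+
        moreover assume "ennreal (\<bar>f x - c\<bar> powr p) \<le> ennreal (2 powr p) * (ennreal (\<bar>f y - f x\<bar> powr p) + ennreal (\<bar>f y - c\<bar> powr p))"
        ultimately show ?thesis using True by simp
      qed simp
    qed
    also have "\<dots> = ennreal (2 powr p) * (?D x + ?A)"
      by (rule nn_integral_cmult_add) measurable
    finally have "ennreal (1 / m) * (ennreal (\<bar>f x - c\<bar> powr p) * ennreal m) \<le> ennreal (1 / m) * (ennreal (2 powr p) * (?D x + ?A))"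
      by (rule mult_left_mono) simp
    moreover have "ennreal (1 / m) * (ennreal (\<bar>f x - c\<bar> powr p) * ennreal m) = ennreal (\<bar>f x - c\<bar> powr p)"
      using m by (simp flip: ennreal_mult)
    moreover have "ennreal (1 / m) * (ennreal (2 powr p) * (?D x + ?A)) = ennreal (2 powr p / m) * (?D x + ?A)"
      using m by (simp add: mult.assoc[symmetric] flip: ennreal_mult)
    ultimately show ?thesis by simp
  qed
  have "(\<integral>\<^sup>+x\<in>?B. ennreal (\<bar>f x - c\<bar> powr p) \<partial>lborel) \<le>
    (\<integral>\<^sup>+x. ennreal (2 powr p / m) * (?D x * indicator ?B x + ?A * indicator ?B x) \<partial>lborel)"
  proof (rule nn_integral_mono)
    fix x
    show "ennreal (\<bar>f x - c\<bar> powr p) * indicator ?B x \<le> ennreal (2 powr p / m) * (?D x * indicator ?B x + ?A * indicator ?B x)"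
      using pt[of x] by (cases "x \<in> ?B") auto
  qed
  also have "\<dots> = ennreal (2 powr p / m) * ((\<integral>\<^sup>+x\<in>?B. ?D x \<partial>lborel) + (\<integral>\<^sup>+x\<in>?B. ?A \<partial>lborel))"
    by (rule nn_integral_cmult_add) measurable
  also have "(\<integral>\<^sup>+x\<in>?B. ?A \<partial>lborel) = ?A * emeasure lborel ?B"
    by (rule nn_integral_cmult_indicator) simp
  finally show ?thesis by (simp add: m_def em mult.commute)
qed

lemma nn_integral_finite_cover_le:
  fixes u :: "'a \<Rightarrow> ennreal"
  assumes "finite T" "A \<subseteq> (\<Union>z\<in>T. B z)" and [measurable]: "u \<in> borel_measurable N" "\<And>z. z \<in> T \<Longrightarrow> B z \<in> sets N"
  shows "(\<integral>\<^sup>+x\<in>A. u x \<partial>N) \<le> (\<Sum>z\<in>T. \<integral>\<^sup>+x\<in>B z. u x \<partial>N)"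
proof -
  have "(\<integral>\<^sup>+x\<in>A. u x \<partial>N) \<le> (\<integral>\<^sup>+x. (\<Sum>z\<in>T. u x * indicator (B z) x) \<partial>N)"
  proof (rule nn_integral_mono)
    fix x
    show "u x * indicator A x \<le> (\<Sum>z\<in>T. u x * indicator (B z) x)"
    proof (cases "x \<in> A")
      case True
      then obtain z where "z \<in> T" "x \<in> B z" using assms(2) by blast
      then have "u x * indicator (B z) x \<le> (\<Sum>z\<in>T. u x * indicator (B z) x)"
        by (intro member_le_sum assms(1)) auto
      then show ?thesis using True \<open>x \<in> B z\<close> by simp
    qed simp
  qed
  also have "\<dots> = (\<Sum>z\<in>T. \<integral>\<^sup>+x\<in>B z. u x \<partial>N)"
    by (rule nn_integral_sum) (use assms in measurable)
  finally show ?thesis .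
qed

text \<open>Since \<open>ennreal\<close> truncates negative reals to 0, absolute values are what
  make the constants add up.\<close>

lemma sum_ennreal_mult_le:
  fixes C :: "'b \<Rightarrow> real"
  assumes "finite T" "\<And>z. z \<in> T \<Longrightarrow> a z \<le> ennreal (C z) * X"
  shows "(\<Sum>z\<in>T. a z) \<le> ennreal (\<Sum>z\<in>T. \<bar>C z\<bar>) * X"
proof -
  have "(\<Sum>z\<in>T. a z) \<le> (\<Sum>z\<in>T. ennreal \<bar>C z\<bar> * X)"
    by (intro sum_mono order_trans[OF assms(2)] mult_right_mono ennreal_leI) auto
  also have "\<dots> = ennreal (\<Sum>z\<in>T. \<bar>C z\<bar>) * X"
    by (simp add: sum_distrib_right[symmetric] sum_ennreal)
  finally show ?thesis .
qed

text \<open>The exponent \<delta> may have either sign, because the interior estimates meet the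
  weight only where \<open>d\<close> is bounded above and away from 0.\<close>

locale bounded_open_domain =
  fixes \<Omega> :: "'a::euclidean_space set" and p \<delta> :: real
  assumes open_domain: "open \<Omega>" and bounded: "bounded \<Omega>" and connected: "connected \<Omega>"
    and nonempty: "\<Omega> \<noteq> {}" and p: "1 < p"
begin

abbreviation d :: "'a \<Rightarrow> real" where "d x \<equiv> infdist x (frontier \<Omega>)"

abbreviation energy :: "('a \<Rightarrow> real) \<Rightarrow> ennreal" where
  "energy G \<equiv> \<integral>\<^sup>+x\<in>\<Omega>. ennreal (G x powr p * d x powr \<delta>) \<partial>lborel"

abbreviation core :: "real \<Rightarrow> 'a set" where "core \<epsilon> \<equiv> {x\<in>\<Omega>. \<epsilon> \<le> d x}"

lemma frontier_nonempty: "frontier \<Omega> \<noteq> {}"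
proof -
  have "\<Omega> \<noteq> UNIV" using bounded not_bounded_UNIV by metis
  then show ?thesis using nonempty frontier_not_empty by blast
qed

lemma d_pos: "x \<in> \<Omega> \<Longrightarrow> 0 < d x"
  using infdist_frontier_pos[OF open_domain frontier_nonempty] .

lemma domain_borel [measurable]: "\<Omega> \<in> sets borel"
  using open_domain by simp

text \<open>On the boundary \<open>d\<close> is 0, so \<Omega> may be replaced by its closure in the
  definition of the core.\<close>

lemma compact_core:
  assumes "0 < \<epsilon>"
  shows "compact (core \<epsilon>)"
proof -
  have "core \<epsilon> = closure \<Omega> \<inter> {x. \<epsilon> \<le> d x}"
  proof
    show "core \<epsilon> \<subseteq> closure \<Omega> \<inter> {x. \<epsilon> \<le> d x}" using closure_subset by auto
    show "closure \<Omega> \<inter> {x. \<epsilon> \<le> d x} \<subseteq> core \<epsilon>"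
    proof
      fix x assume x: "x \<in> closure \<Omega> \<inter> {x. \<epsilon> \<le> d x}"
      then have "x \<notin> frontier \<Omega>" using assms by auto
      then show "x \<in> core \<epsilon>" using x open_domain by (auto simp: frontier_def interior_open)
    qed
  qed
  moreover have "closed {x. \<epsilon> \<le> d x}"
    by (intro closed_Collect_le continuous_intros)
  ultimately show ?thesis
    using bounded by (simp add: compact_Int_closed compact_closure)
qed

lemma core_borel [measurable]: "core \<epsilon> \<in> sets borel"
proof -
  have "\<Omega> \<inter> {x. \<epsilon> \<le> d x} \<in> sets borel"
    by (intro sets.Int domain_borel borel_closed closed_Collect_le continuous_intros)
  then show ?thesis by (simp add: Int_def)
qed

lemma local_poincare:
  assumes a: "a \<in> \<Omega>"
  shows "\<exists>r>0. ball a r \<subseteq> \<Omega> \<and> (\<exists>D>0. \<forall>f G. upper_gradient \<Omega> f G \<longrightarrow>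
    (\<integral>\<^sup>+x\<in>ball a r. (\<integral>\<^sup>+y\<in>ball a r. ennreal (\<bar>f y - f x\<bar> powr p) \<partial>lborel) \<partial>lborel) \<le> ennreal D * energy G)"
proof -
  define r where "r = d a / 2"
  have r: "0 < r" using d_pos[OF a] by (simp add: r_def)
  have B: "ball a r \<subseteq> \<Omega>"
    using ball_infdist_frontier_subset[OF a] r by (auto simp: r_def)
  \<comment> \<open>On the ball \<open>d\<close> lies between \<open>r\<close> and
    \<open>3 * r\<close>; the minimum bounds the weight from below for either sign of
    \<delta>.\<close>
  define m where "m = min (r powr \<delta>) ((3 * r) powr \<delta>)"
  have m: "0 < m" using r by (simp add: m_def)
  have m_le: "m \<le> d x powr \<delta>" if "x \<in> ball a r" for x
  proof -
    have "d a \<le> d x + dist a x" "d x \<le> d a + dist x a" by (rule infdist_triangle)+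
    then have "r \<le> d x" "d x \<le> 3 * r" using that by (auto simp: r_def dist_commute)
    then show ?thesis using r
      by (cases "0 \<le> \<delta>") (auto simp: m_def min_le_iff_disj intro: powr_mono2 powr_mono2')
  qed
  define D where "D = (2 * r) powr p * measure lborel (ball (0::'a) (2 * r)) * (1 / m)"
  have D: "0 < D" using r m content_ball_pos[of "2 * r" "0::'a"] by (simp add: D_def)
  have "(\<integral>\<^sup>+x\<in>ball a r. (\<integral>\<^sup>+y\<in>ball a r. ennreal (\<bar>f y - f x\<bar> powr p) \<partial>lborel) \<partial>lborel) \<le> ennreal D * energy G"
    if ug: "upper_gradient \<Omega> f G" for f G
  proof -
    have [measurable]: "G \<in> borel_measurable borel" using ug by (simp add: upper_gradient_def)
    have "(\<integral>\<^sup>+x\<in>ball a r. ennreal (G x powr p) \<partial>lborel)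
      \<le> (\<integral>\<^sup>+x. ennreal (1 / m) * (ennreal (G x powr p * d x powr \<delta>) * indicator \<Omega> x) \<partial>lborel)"
    proof (rule nn_integral_mono)
      fix x
      show "ennreal (G x powr p) * indicator (ball a r) x
        \<le> ennreal (1 / m) * (ennreal (G x powr p * d x powr \<delta>) * indicator \<Omega> x)"
      proof (cases "x \<in> ball a r")
        case True
        have "G x powr p * m \<le> G x powr p * d x powr \<delta>"
          using m_le[OF True] by (intro mult_left_mono) auto
        then have "G x powr p \<le> 1 / m * (G x powr p * d x powr \<delta>)"
          using m by (simp add: field_simps)
        then have "ennreal (G x powr p) \<le> ennreal (1 / m) * ennreal (G x powr p * d x powr \<delta>)"
          using m by (subst ennreal_mult[symmetric]) (auto intro: ennreal_leI)
        moreover have "x \<in> \<Omega>" using True B by blast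
        ultimately show ?thesis using True by simp
      qed simp
    qed
    also have "\<dots> = ennreal (1 / m) * energy G"
      by (rule nn_integral_cmult) measurable
    finally have "ennreal ((2 * r) powr p * measure lborel (ball (0::'a) (2 * r))) * (\<integral>\<^sup>+x\<in>ball a r. ennreal (G x powr p) \<partial>lborel)
      \<le> ennreal ((2 * r) powr p * measure lborel (ball (0::'a) (2 * r))) * (ennreal (1 / m) * energy G)"
      by (rule mult_left_mono) simp
    also have "\<dots> = ennreal D * energy G"
      unfolding D_def using m by (subst ennreal_mult[of _ "1 / m"]) (auto simp: mult.assoc)
    finally show ?thesis using poincare_ball[OF ug p B] by (rule order_trans[rotated])
  qed
  with r B D show ?thesis by blast
qed

text \<open>The value \<open>c f G\<close> is fixed on one ball and then propagated along
  overlapping balls, so the same number serves every core. Connectedness reaches each point and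
  compactness makes the constant uniform in \<open>f\<close> and \<open>G\<close>.\<close>

lemma interior_poincare:
  "\<exists>c. \<forall>\<epsilon>>0. \<exists>C::real. \<forall>f G. upper_gradient \<Omega> f G \<longrightarrow>
    (\<integral>\<^sup>+x\<in>core \<epsilon>. ennreal (\<bar>f x - c f G\<bar> powr p) \<partial>lborel) \<le> ennreal C * energy G"
proof -
  obtain a0 where a0: "a0 \<in> \<Omega>" using nonempty by blast
  obtain r0 D0 where r0: "0 < r0" "ball a0 r0 \<subseteq> \<Omega>" "0 < D0"
    and D0: "\<And>f G. upper_gradient \<Omega> f G \<Longrightarrow>
      (\<integral>\<^sup>+x\<in>ball a0 r0. (\<integral>\<^sup>+y\<in>ball a0 r0. ennreal (\<bar>f y - f x\<bar> powr p) \<partial>lborel) \<partial>lborel) \<le> ennreal D0 * energy G"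
    using local_poincare[OF a0] by blast
  define m where "m = measure lborel (ball a0 r0)"
  have m: "0 < m" unfolding m_def using r0 content_ball_pos[of r0 a0] by simp
  have em: "emeasure lborel (ball a0 r0) = ennreal m"
    unfolding m_def using less_imp_neq[OF emeasure_lborel_ball_finite[of a0 r0]]
    by (intro emeasure_eq_ennreal_measure) simp
  \<comment> \<open>A value \<open>f x\<close> at a point where the inner integral of the Poincare
    inequality is at most its average; for infinite energy any number works, because
    \<open>D0 / m > 0\<close>.\<close>
  have base: "\<exists>c. (\<integral>\<^sup>+x\<in>ball a0 r0. ennreal (\<bar>f x - c\<bar> powr p) \<partial>lborel) \<le> ennreal (D0 / m) * energy G"
    if ug: "upper_gradient \<Omega> f G" for f G
  proof (cases "energy G < \<infinity>")
    case True
    have [measurable]: "f \<in> borel_measurable borel" using ug by (simp add: upper_gradient_def)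
    have "\<exists>x\<in>ball a0 r0. (\<integral>\<^sup>+y\<in>ball a0 r0. ennreal (\<bar>f y - f x\<bar> powr p) \<partial>lborel) \<le> ennreal (D0 / m) * energy G"
    proof (rule exists_le_average[where N=lborel])
      show "ennreal (D0 / m) * energy G < \<infinity>" using True by (simp add: ennreal_mult_less_top)
      have "ennreal (D0 / m) * energy G * emeasure lborel (ball a0 r0) = ennreal (D0 / m * m) * energy G"
        unfolding em using m r0 by (subst ennreal_mult) (auto simp: mult_ac)
      also have "D0 / m * m = D0" using m by simp
      finally show "(\<integral>\<^sup>+x\<in>ball a0 r0. (\<integral>\<^sup>+y\<in>ball a0 r0. ennreal (\<bar>f y - f x\<bar> powr p) \<partial>lborel) \<partial>lborel)
          \<le> ennreal (D0 / m) * energy G * emeasure lborel (ball a0 r0)"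
        using D0[OF ug] by simp
      show "0 < emeasure lborel (ball a0 r0)" "emeasure lborel (ball a0 r0) < \<infinity>"
        using em m by auto
    qed measurable
    then show ?thesis by blast
  next
    case False
    then have "energy G = \<infinity>" by (simp add: top.not_eq_extremum[symmetric])
    then show ?thesis using m r0 by (auto simp: ennreal_mult_top)
  qed
  define c where "c f G = (SOME c. (\<integral>\<^sup>+x\<in>ball a0 r0. ennreal (\<bar>f x - c\<bar> powr p) \<partial>lborel) \<le> ennreal (D0 / m) * energy G)" for f G
  define good where "good a \<longleftrightarrow> (\<exists>r>0. ball a r \<subseteq> \<Omega> \<and> (\<exists>C. \<forall>f G. upper_gradient \<Omega> f G \<longrightarrow>
    (\<integral>\<^sup>+x\<in>ball a r. ennreal (\<bar>f x - c f G\<bar> powr p) \<partial>lborel) \<le> ennreal C * energy G))" for a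
  have "(\<integral>\<^sup>+x\<in>ball a0 r0. ennreal (\<bar>f x - c f G\<bar> powr p) \<partial>lborel) \<le> ennreal (D0 / m) * energy G"
    if "upper_gradient \<Omega> f G" for f G
    using someI_ex[OF base[OF that]] unfolding c_def .
  then have "good a0" unfolding good_def using r0(1,2) by blast
  have good: "good b" if b: "b \<in> \<Omega>" for b
  \<comment> \<open>It remains to see that, inside a Poincare ball, one good point makes all points
    good.\<close>
  proof (rule connected_induction_simple[where P=good, OF connected a0 b \<open>good a0\<close>])
    fix a assume "a \<in> \<Omega>"
    from local_poincare[OF this] obtain r D where r: "0 < r" "ball a r \<subseteq> \<Omega>" "0 < D"
      and D: "\<And>f G. upper_gradient \<Omega> f G \<Longrightarrow>
        (\<integral>\<^sup>+x\<in>ball a r. (\<integral>\<^sup>+y\<in>ball a r. ennreal (\<bar>f y - f x\<bar> powr p) \<partial>lborel) \<partial>lborel) \<le> ennreal D * energy G"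
      by blast
    have "good y" if x: "x \<in> ball a r" and y: "y \<in> ball a r" and "good x" for x y
    proof -
      from \<open>good x\<close> obtain s C where s: "0 < s" "ball x s \<subseteq> \<Omega>"
        and C: "\<And>f G. upper_gradient \<Omega> f G \<Longrightarrow>
          (\<integral>\<^sup>+w\<in>ball x s. ennreal (\<bar>f w - c f G\<bar> powr p) \<partial>lborel) \<le> ennreal C * energy G"
        unfolding good_def by blast
      \<comment> \<open>A ball about \<open>x\<close> inside both the ball where \<open>x\<close> is
        good and the Poincare ball: the overlap required by
        \<open>transfer_estimate\<close>.\<close>
      define q where "q = min s (r - dist a x)"
      have q: "0 < q" using s x by (simp add: q_def)
      have sub: "ball x q \<subseteq> ball x s" by (auto simp: q_def)
      have sub': "ball x q \<subseteq> ball a r"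
      proof
        fix w assume "w \<in> ball x q"
        then show "w \<in> ball a r" using dist_triangle[of a w x] by (simp add: q_def)
      qed
      define k where "k = 2 powr p / measure lborel (ball x q)"
      define M where "M = measure lborel (ball a r)"
      define C' where "C' = k * (D + M * \<bar>C\<bar>)"
      have kM: "0 \<le> k" "0 \<le> M" by (auto simp: k_def M_def)
      have *: "(\<integral>\<^sup>+w\<in>ball a r. ennreal (\<bar>f w - c f G\<bar> powr p) \<partial>lborel) \<le> ennreal C' * energy G"
        if ug: "upper_gradient \<Omega> f G" for f G
      proof -
        have fm: "f \<in> borel_measurable borel" using ug by (simp add: upper_gradient_def)
        have "(\<integral>\<^sup>+w\<in>ball a r. ennreal (\<bar>f w - c f G\<bar> powr p) \<partial>lborel) \<le> ennreal k *
           ((\<integral>\<^sup>+x\<in>ball a r. (\<integral>\<^sup>+y\<in>ball a r. ennreal (\<bar>f y - f x\<bar> powr p) \<partial>lborel) \<partial>lborel)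
            + ennreal M * (\<integral>\<^sup>+w\<in>ball x s. ennreal (\<bar>f w - c f G\<bar> powr p) \<partial>lborel))"
          unfolding k_def M_def using p by (intro transfer_estimate fm q sub sub') auto
        also have "\<dots> \<le> ennreal k * (ennreal D * energy G + ennreal M * (ennreal \<bar>C\<bar> * energy G))"
          by (intro mult_left_mono add_mono D[OF ug] order_trans[OF C[OF ug]] mult_right_mono ennreal_leI) auto
        also have "\<dots> = ennreal C' * energy G"
          unfolding C'_def using kM r(3) ennreal_mult[of k "D + M * \<bar>C\<bar>"]
          by (simp add: distrib_left distrib_right ennreal_mult mult.assoc)
        finally show ?thesis .
      qed
      define e where "e = r - dist a y"
      have e: "0 < e" using y by (simp add: e_def)
      have e_sub: "ball y e \<subseteq> ball a r"
      proof
        fix w assume "w \<in> ball y e"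
        then show "w \<in> ball a r" using dist_triangle[of a w y] by (simp add: e_def)
      qed
      have "(\<integral>\<^sup>+w\<in>ball y e. ennreal (\<bar>f w - c f G\<bar> powr p) \<partial>lborel) \<le> ennreal C' * energy G"
        if ug: "upper_gradient \<Omega> f G" for f G
        by (rule order_trans[OF nn_integral_mono *[OF ug]]) (use e_sub in \<open>auto simp: indicator_def\<close>)
      with e e_sub r(2) show ?thesis unfolding good_def by blast
    qed
    then have "\<forall>x\<in>ball a r. \<forall>y\<in>ball a r. good x \<longrightarrow> good y" by blast
    moreover have "openin (top_of_set \<Omega>) (ball a r)" using r(2) by (intro open_subset open_ball)
    moreover have "a \<in> ball a r" using r(1) by simp
    ultimately show "\<exists>T. openin (top_of_set \<Omega>) T \<and> a \<in> T \<and> (\<forall>x\<in>T. \<forall>y\<in>T. good x \<longrightarrow> good y)" by blast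
  qed
  have "\<exists>C::real. \<forall>f G. upper_gradient \<Omega> f G \<longrightarrow>
    (\<integral>\<^sup>+x\<in>core \<epsilon>. ennreal (\<bar>f x - c f G\<bar> powr p) \<partial>lborel) \<le> ennreal C * energy G" if \<epsilon>: "0 < \<epsilon>" for \<epsilon>
  proof -
    define Q where "Q a r C \<longleftrightarrow> (\<forall>f G. upper_gradient \<Omega> f G \<longrightarrow>
      (\<integral>\<^sup>+x\<in>ball a r. ennreal (\<bar>f x - c f G\<bar> powr p) \<partial>lborel) \<le> ennreal C * energy G)" for a r C
    have "\<forall>a\<in>\<Omega>. \<exists>r C. 0 < r \<and> Q a r C"
      using good unfolding good_def Q_def by blast
    then obtain r C where rC: "\<And>a. a \<in> \<Omega> \<Longrightarrow> 0 < r a \<and> Q a (r a) (C a)"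
      by metis
    have r: "0 < r a" if "a \<in> \<Omega>" for a using rC[OF that] by blast
    have C: "(\<integral>\<^sup>+x\<in>ball a (r a). ennreal (\<bar>f x - c f G\<bar> powr p) \<partial>lborel) \<le> ennreal (C a) * energy G"
      if "a \<in> \<Omega>" "upper_gradient \<Omega> f G" for a f G
      using rC[OF that(1)] that(2) unfolding Q_def by blast
    obtain T where T: "T \<subseteq> core \<epsilon>" "finite T" "core \<epsilon> \<subseteq> (\<Union>a\<in>T. ball a (r a))"
      by (rule compactE_image[OF compact_core[OF \<epsilon>], of "core \<epsilon>" "\<lambda>a. ball a (r a)"])
         (use r in auto)
    have "(\<integral>\<^sup>+x\<in>core \<epsilon>. ennreal (\<bar>f x - c f G\<bar> powr p) \<partial>lborel) \<le> ennreal (\<Sum>a\<in>T. \<bar>C a\<bar>) * energy G"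
      if ug: "upper_gradient \<Omega> f G" for f G
    proof -
      have [measurable]: "f \<in> borel_measurable borel" using ug by (simp add: upper_gradient_def)
      have "(\<integral>\<^sup>+x\<in>core \<epsilon>. ennreal (\<bar>f x - c f G\<bar> powr p) \<partial>lborel)
        \<le> (\<Sum>a\<in>T. \<integral>\<^sup>+x\<in>ball a (r a). ennreal (\<bar>f x - c f G\<bar> powr p) \<partial>lborel)"
        by (rule nn_integral_finite_cover_le[OF T(2,3)]) measurable
      also have "\<dots> \<le> ennreal (\<Sum>a\<in>T. \<bar>C a\<bar>) * energy G"
        using T(1) C ug by (intro sum_ennreal_mult_le T(2)) auto
      finally show ?thesis .
    qed
    then show ?thesis by blast
  qed
  then show ?thesis by blast
qed

end

subsection \<open>The weighted inequality\<close>

text \<open>When \<open>f\<close> has weighted mean 0, the weighted mean of \<open>f - c\<close> is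
  \<open>- c\<close>. Jensen for the normalised weight therefore bounds the norm of the constant
  \<open>c\<close> by that of \<open>f - c\<close>, and the triangle inequality finishes.\<close>

lemma mean_zero_powr_le:
  fixes f w :: "'a \<Rightarrow> real" and c p :: real
  assumes p: "1 < p" and [measurable]: "f \<in> borel_measurable N" "w \<in> borel_measurable N"
    and w: "\<And>x. 0 \<le> w x"
    and W: "0 < (\<integral>\<^sup>+x. ennreal (w x) \<partial>N)" "(\<integral>\<^sup>+x. ennreal (w x) \<partial>N) < \<infinity>"
    and fin: "(\<integral>\<^sup>+x. ennreal (\<bar>f x\<bar> powr p * w x) \<partial>N) < \<infinity>"
    and zero: "(\<integral>x. f x * w x \<partial>N) = 0"
  shows "(\<integral>\<^sup>+x. ennreal (\<bar>f x\<bar> powr p * w x) \<partial>N)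
    \<le> ennreal (2 powr p * 2) * (\<integral>\<^sup>+x. ennreal (\<bar>f x - c\<bar> powr p * w x) \<partial>N)"
proof -
  define k where "k = enn2real (\<integral>\<^sup>+x. ennreal (w x) \<partial>N)"
  have k: "(\<integral>\<^sup>+x. ennreal (w x) \<partial>N) = ennreal k" using W by (simp add: k_def)
  have k_pos: "0 < k" using W by (simp add: k_def enn2real_positive_iff)
  have w_int: "integrable N w"
    using W w by (intro integrableI_nonneg) auto
  \<comment> \<open>Integrability, from \<bar>f\<bar> \<le>
    \<open>\<bar>f x\<bar> powr p + 1\<close> and finite mass, ensures that the integral in
    \<open>zero\<close> is a genuine one and not the default value 0.\<close>
  have fw_int: "integrable N (\<lambda>x. f x * w x)"
  proof (rule integrableI_bounded)
    have "(\<integral>\<^sup>+x. ennreal (norm (f x * w x)) \<partial>N) \<le> (\<integral>\<^sup>+x. ennreal (\<bar>f x\<bar> powr p * w x) + ennreal (w x) \<partial>N)"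
    proof (rule nn_integral_mono)
      fix x
      have "\<bar>f x\<bar> \<le> \<bar>f x\<bar> powr p + 1"
      proof (cases "\<bar>f x\<bar> \<le> 1")
        case False
        then have "\<bar>f x\<bar> powr 1 \<le> \<bar>f x\<bar> powr p" using p by (intro powr_mono) auto
        then show ?thesis using False by simp
      qed (simp add: add_increasing)
      then have "\<bar>f x\<bar> * w x \<le> (\<bar>f x\<bar> powr p + 1) * w x" by (intro mult_right_mono w)
      then show "ennreal (norm (f x * w x)) \<le> ennreal (\<bar>f x\<bar> powr p * w x) + ennreal (w x)"
        using w[of x] by (simp add: abs_mult distrib_right ennreal_leI flip: ennreal_plus)
    qed
    also have "\<dots> = (\<integral>\<^sup>+x. ennreal (\<bar>f x\<bar> powr p * w x) \<partial>N) + (\<integral>\<^sup>+x. ennreal (w x) \<partial>N)"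
      by (rule nn_integral_add) measurable
    also have "\<dots> < \<infinity>" using fin W by simp
    finally show "(\<integral>\<^sup>+x. ennreal (norm (f x * w x)) \<partial>N) < \<infinity>" .
  qed measurable
  have "(\<integral>x. (f x - c) * w x \<partial>N) = (\<integral>x. f x * w x \<partial>N) - (\<integral>x. c * w x \<partial>N)"
    using fw_int w_int by (simp add: left_diff_distrib)
  also have "\<dots> = - (c * k)"
    using zero w by (simp add: k_def integral_eq_nn_integral)
  finally have "\<bar>c\<bar> * k = norm (\<integral>x. (f x - c) * w x \<partial>N)"
    using k_pos by (simp add: abs_mult)
  then have "ennreal (\<bar>c\<bar> * k) \<le> (\<integral>\<^sup>+x. ennreal (norm ((f x - c) * w x)) \<partial>N)"
    using fw_int w_int by (simp only:) (intro integral_norm_bound_ennreal, simp add: left_diff_distrib)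
  then have "ennreal (1 / k) * ennreal (\<bar>c\<bar> * k) \<le> ennreal (1 / k) * (\<integral>\<^sup>+x. ennreal (norm ((f x - c) * w x)) \<partial>N)"
    by (rule mult_left_mono) simp
  also have "\<dots> = (\<integral>\<^sup>+x. ennreal (1 / k) * ennreal (norm ((f x - c) * w x)) \<partial>N)"
    by (rule nn_integral_cmult[symmetric]) measurable
  also have "\<dots> = (\<integral>\<^sup>+x. ennreal (\<bar>f x - c\<bar> * (w x / k)) \<partial>N)"
    using k_pos w by (intro nn_integral_cong) (simp add: abs_mult flip: ennreal_mult)
  also have "ennreal (1 / k) * ennreal (\<bar>c\<bar> * k) = ennreal \<bar>c\<bar>"
    using k_pos by (simp flip: ennreal_mult)
  finally have c_le: "ennreal \<bar>c\<bar> \<le> (\<integral>\<^sup>+x. ennreal (\<bar>f x - c\<bar> * (w x / k)) \<partial>N)" .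
  have "(\<integral>\<^sup>+x. ennreal (w x / k) \<partial>N) = (\<integral>\<^sup>+x. ennreal (1 / k) * ennreal (w x) \<partial>N)"
    using k_pos w by (intro nn_integral_cong) (simp flip: ennreal_mult)
  also have "\<dots> = ennreal (1 / k) * ennreal k"
    unfolding k[symmetric] by (rule nn_integral_cmult) measurable
  also have "\<dots> = 1" using k_pos by (simp flip: ennreal_mult)
  finally have wk: "(\<integral>\<^sup>+x. ennreal (w x / k) \<partial>N) = 1" .
  let ?A = "\<integral>\<^sup>+x. ennreal (\<bar>f x - c\<bar> powr p * w x) \<partial>N"
  have "ennreal (\<bar>c\<bar> powr p) \<le> (\<integral>\<^sup>+x. ennreal (\<bar>f x - c\<bar> powr p * (w x / k)) \<partial>N)"
    by (rule powr_nn_integral_le[OF p _ _ _ _ _ _ c_le]) (use w k_pos wk in auto)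
  also have "\<dots> = (\<integral>\<^sup>+x. ennreal (1 / k) * ennreal (\<bar>f x - c\<bar> powr p * w x) \<partial>N)"
    using k_pos w by (intro nn_integral_cong) (simp flip: ennreal_mult)
  also have "\<dots> = ennreal (1 / k) * ?A"
    by (rule nn_integral_cmult) measurable
  finally have "ennreal k * ennreal (\<bar>c\<bar> powr p) \<le> ennreal k * (ennreal (1 / k) * ?A)"
    by (rule mult_left_mono) simp
  also have "\<dots> = ?A" using k_pos by (simp add: mult.assoc[symmetric] flip: ennreal_mult)
  finally have cA: "ennreal k * ennreal (\<bar>c\<bar> powr p) \<le> ?A" .
  have "(\<integral>\<^sup>+x. ennreal (\<bar>f x\<bar> powr p * w x) \<partial>N)
    \<le> (\<integral>\<^sup>+x. ennreal (2 powr p) * (ennreal (\<bar>f x - c\<bar> powr p * w x) + ennreal (\<bar>c\<bar> powr p) * ennreal (w x)) \<partial>N)"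
  proof (rule nn_integral_mono)
    fix x
    have "\<bar>f x\<bar> powr p * w x \<le> 2 powr p * (\<bar>f x - c\<bar> powr p + \<bar>c\<bar> powr p) * w x"
      using abs_add_powr_le[of p "f x - c" c] p w by (intro mult_right_mono) auto
    also have "\<dots> = 2 powr p * (\<bar>f x - c\<bar> powr p * w x + \<bar>c\<bar> powr p * w x)" by (simp add: algebra_simps)
    finally show "ennreal (\<bar>f x\<bar> powr p * w x)
      \<le> ennreal (2 powr p) * (ennreal (\<bar>f x - c\<bar> powr p * w x) + ennreal (\<bar>c\<bar> powr p) * ennreal (w x))"
      using w[of x] by (simp add: ennreal_leI flip: ennreal_mult ennreal_plus)
  qed
  also have "\<dots> = ennreal (2 powr p) * (?A + (\<integral>\<^sup>+x. ennreal (\<bar>c\<bar> powr p) * ennreal (w x) \<partial>N))"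
    by (rule nn_integral_cmult_add) measurable
  also have "(\<integral>\<^sup>+x. ennreal (\<bar>c\<bar> powr p) * ennreal (w x) \<partial>N) = ennreal k * ennreal (\<bar>c\<bar> powr p)"
    unfolding k[symmetric] by (subst nn_integral_cmult) (auto simp: mult.commute)
  also have "ennreal (2 powr p) * (?A + ennreal k * ennreal (\<bar>c\<bar> powr p)) \<le> ennreal (2 powr p) * (?A + ?A)"
    by (intro mult_left_mono add_left_mono cA) simp
  also have "\<dots> = ennreal (2 powr p * 2) * ?A"
    by (simp add: ennreal_mult mult.assoc mult_2)
  finally show ?thesis .
qed

lemma holder_domain_boundary_estimate:
  fixes \<Omega> :: "(real^'n) set" and p \<alpha> \<gamma> :: real
  assumes "bounded_holder_domain \<alpha> \<Omega>" "1 < p" "0 < \<alpha>" "\<alpha> \<le> 1" "- \<alpha> < \<gamma>" "z \<in> frontier \<Omega>"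
  shows "\<exists>\<rho>>0. \<exists>\<epsilon>>0. \<exists>C::real. \<forall>f G. upper_gradient \<Omega> f G \<longrightarrow>
    (\<integral>\<^sup>+x\<in>\<Omega> \<inter> ball z \<rho>. ennreal (\<bar>f x\<bar> powr p * infdist x (frontier \<Omega>) powr \<gamma>) \<partial>lborel) \<le>
    ennreal C * ((\<integral>\<^sup>+x\<in>\<Omega>. ennreal (G x powr p * infdist x (frontier \<Omega>) powr (\<gamma> + \<alpha> * p)) \<partial>lborel) +
                 (\<integral>\<^sup>+x\<in>{x\<in>\<Omega>. \<epsilon> \<le> infdist x (frontier \<Omega>)}. ennreal (\<bar>f x\<bar> powr p) \<partial>lborel))"
proof -
  obtain e t R K where "graph_chart \<Omega> z e t R K \<alpha>"
    using bounded_holder_domain_chart assms by blast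
  then have "weighted_chart \<Omega> z e t R K \<alpha> p \<gamma> (min \<gamma> 0 / \<alpha>) (max \<gamma> 0) (K + 1)"
    using assms by (intro weighted_chart.intro weighted_chart_axioms.intro) auto
  then show ?thesis by (rule weighted_chart.boundary_estimate)
qed

text \<open>Finitely many chart balls cover the compact boundary. What they leave of the closure is
  a compact subset of \<Omega>, contained in a core, where the weight is bounded.\<close>

lemma holder_domain_global_estimate:
  fixes \<Omega> :: "(real^'n) set" and p \<alpha> \<gamma> :: real
  assumes dom: "bounded_holder_domain \<alpha> \<Omega>" and p: "1 < p" and \<alpha>: "0 < \<alpha>" "\<alpha> \<le> 1" and \<gamma>: "- \<alpha> < \<gamma>"
  shows "\<exists>\<epsilon>>0. \<exists>C::real. \<forall>f G. upper_gradient \<Omega> f G \<longrightarrow>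
    (\<integral>\<^sup>+x\<in>\<Omega>. ennreal (\<bar>f x\<bar> powr p * infdist x (frontier \<Omega>) powr \<gamma>) \<partial>lborel) \<le>
    ennreal C * ((\<integral>\<^sup>+x\<in>\<Omega>. ennreal (G x powr p * infdist x (frontier \<Omega>) powr (\<gamma> + \<alpha> * p)) \<partial>lborel) +
                 (\<integral>\<^sup>+x\<in>{x\<in>\<Omega>. \<epsilon> \<le> infdist x (frontier \<Omega>)}. ennreal (\<bar>f x\<bar> powr p) \<partial>lborel))"
proof -
  interpret bounded_open_domain \<Omega> p "\<gamma> + \<alpha> * p"
    by unfold_locales (use dom p in \<open>auto simp: bounded_holder_domain_def\<close>)
  define Q where "Q z \<rho> \<epsilon> C \<longleftrightarrow> (\<forall>f G. upper_gradient \<Omega> f G \<longrightarrow>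
    (\<integral>\<^sup>+x\<in>\<Omega> \<inter> ball z \<rho>. ennreal (\<bar>f x\<bar> powr p * d x powr \<gamma>) \<partial>lborel) \<le>
      ennreal C * (energy G + (\<integral>\<^sup>+x\<in>core \<epsilon>. ennreal (\<bar>f x\<bar> powr p) \<partial>lborel)))" for z \<rho> \<epsilon> and C :: real
  have "\<exists>\<rho> \<epsilon> C. 0 < \<rho> \<and> 0 < \<epsilon> \<and> Q z \<rho> \<epsilon> C"
    if "z \<in> frontier \<Omega>" for z
    using holder_domain_boundary_estimate[OF dom p \<alpha> \<gamma> that] unfolding Q_def by blast
  then obtain \<rho> E C where Q: "\<And>z. z \<in> frontier \<Omega> \<Longrightarrow> 0 < \<rho> z \<and> 0 < E z \<and> Q z (\<rho> z) (E z) (C z)"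
    by metis
  have \<rho>: "0 < \<rho> z" and E: "0 < E z" if "z \<in> frontier \<Omega>" for z using Q[OF that] by blast+
  have C: "(\<integral>\<^sup>+x\<in>\<Omega> \<inter> ball z (\<rho> z). ennreal (\<bar>f x\<bar> powr p * d x powr \<gamma>) \<partial>lborel) \<le>
        ennreal (C z) * (energy G + (\<integral>\<^sup>+x\<in>core (E z). ennreal (\<bar>f x\<bar> powr p) \<partial>lborel))"
    if "z \<in> frontier \<Omega>" "upper_gradient \<Omega> f G" for z f G
    using Q[OF that(1)] that(2) unfolding Q_def by blast
  have "compact (frontier \<Omega>)" using bounded by (rule compact_frontier_bounded)
  then obtain T where T: "T \<subseteq> frontier \<Omega>" "finite T" "frontier \<Omega> \<subseteq> (\<Union>z\<in>T. ball z (\<rho> z))"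
    by (rule compactE_image[of "frontier \<Omega>" "frontier \<Omega>" "\<lambda>z. ball z (\<rho> z)"]) (use \<rho> in auto)
  define U where "U = closure \<Omega> - (\<Union>z\<in>T. ball z (\<rho> z))"
  have "compact U"
    unfolding U_def using bounded by (intro compact_diff) (auto simp: compact_closure)
  have U_pos: "0 < d x" if "x \<in> U" for x
  proof (rule d_pos)
    show "x \<in> \<Omega>" using that T(3) open_domain by (auto simp: U_def frontier_def interior_open)
  qed
  obtain \<epsilon>0 where \<epsilon>0: "0 < \<epsilon>0" "\<And>x. x \<in> U \<Longrightarrow> \<epsilon>0 \<le> d x"
  proof (cases "U = {}")
    case False
    have "continuous_on U d" by (intro continuous_intros)
    from continuous_attains_inf[OF \<open>compact U\<close> False this]
    obtain x where "x \<in> U" "\<And>y. y \<in> U \<Longrightarrow> d x \<le> d y" by blast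
    then show ?thesis using U_pos that[of "d x"] by blast
  qed (use that[of 1] in auto)
  \<comment> \<open>Small enough for the core to contain the uncovered part and the cores of all
    charts used.\<close>
  define \<epsilon> where "\<epsilon> = Min (insert \<epsilon>0 (E ` T))"
  have \<epsilon>: "0 < \<epsilon>" "\<epsilon> \<le> \<epsilon>0" "\<And>z. z \<in> T \<Longrightarrow> \<epsilon> \<le> E z"
    using T(1,2) E \<epsilon>0(1) by (auto simp: \<epsilon>_def)
  obtain D where D: "1 \<le> D" "\<And>x. x \<in> \<Omega> \<Longrightarrow> d x \<le> D"
  proof -
    obtain z where z: "z \<in> frontier \<Omega>" using frontier_nonempty by blast
    obtain D where "\<And>x. x \<in> \<Omega> \<Longrightarrow> dist z x \<le> D"
      using bounded_any_center[of \<Omega> z] bounded by auto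
    then have "d x \<le> max 1 D" if "x \<in> \<Omega>" for x
      using infdist_le[OF z, of x] that by (force simp: dist_commute)
    then show ?thesis by (intro that[of "max 1 D"]) auto
  qed
  \<comment> \<open>On the core \<open>d\<close> ranges between \<epsilon> and \<open>D\<close>; the
    maximum bounds the weight for either sign of \<gamma>.\<close>
  define H where "H = max (D powr \<gamma>) (\<epsilon> powr \<gamma>)"
  have H: "d x powr \<gamma> \<le> H" if "x \<in> core \<epsilon>" for x
    using that D(2)[of x] \<epsilon>(1)
    by (cases "0 \<le> \<gamma>") (auto simp: H_def le_max_iff_disj infdist_nonneg intro: powr_mono2 powr_mono2')
  have "(\<integral>\<^sup>+x\<in>\<Omega>. ennreal (\<bar>f x\<bar> powr p * d x powr \<gamma>) \<partial>lborel) \<le>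
    ennreal ((\<Sum>z\<in>T. \<bar>C z\<bar>) + H) * (energy G + (\<integral>\<^sup>+x\<in>core \<epsilon>. ennreal (\<bar>f x\<bar> powr p) \<partial>lborel))"
    (is "?I \<le> _ * ?X") if ug: "upper_gradient \<Omega> f G" for f G
  proof -
    have [measurable]: "f \<in> borel_measurable borel" using ug by (simp add: upper_gradient_def)
    let ?u = "\<lambda>x. ennreal (\<bar>f x\<bar> powr p * d x powr \<gamma>)"
    have cover: "\<Omega> \<subseteq> (\<Union>z\<in>T. \<Omega> \<inter> ball z (\<rho> z)) \<union> core \<epsilon>"
    proof
      fix x assume x: "x \<in> \<Omega>"
      show "x \<in> (\<Union>z\<in>T. \<Omega> \<inter> ball z (\<rho> z)) \<union> core \<epsilon>"
      proof (cases "x \<in> U")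
        case True
        then show ?thesis using x \<epsilon>0(2)[OF True] \<epsilon>(2) by auto
      next
        case False
        then show ?thesis using x closure_subset by (auto simp: U_def)
      qed
    qed
    have "?I \<le> (\<integral>\<^sup>+x. ?u x * indicator (\<Union>z\<in>T. \<Omega> \<inter> ball z (\<rho> z)) x + ?u x * indicator (core \<epsilon>) x \<partial>lborel)"
      using cover by (intro nn_integral_mono) (auto simp: indicator_def)
    also have "\<dots> = (\<integral>\<^sup>+x\<in>(\<Union>z\<in>T. \<Omega> \<inter> ball z (\<rho> z)). ?u x \<partial>lborel) + (\<integral>\<^sup>+x\<in>core \<epsilon>. ?u x \<partial>lborel)"
    proof (rule nn_integral_add)
      have [measurable]: "(\<Union>z\<in>T. \<Omega> \<inter> ball z (\<rho> z)) \<in> sets borel"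
        using T(2) by (intro sets.finite_UN) auto
      show "(\<lambda>x. ?u x * indicator (\<Union>z\<in>T. \<Omega> \<inter> ball z (\<rho> z)) x) \<in> borel_measurable lborel" by measurable
    qed measurable
    also have "\<dots> \<le> ennreal (\<Sum>z\<in>T. \<bar>C z\<bar>) * ?X + ennreal H * ?X"
    proof (rule add_mono)
      have "(\<integral>\<^sup>+x\<in>(\<Union>z\<in>T. \<Omega> \<inter> ball z (\<rho> z)). ?u x \<partial>lborel) \<le> (\<Sum>z\<in>T. \<integral>\<^sup>+x\<in>\<Omega> \<inter> ball z (\<rho> z). ?u x \<partial>lborel)"
        by (rule nn_integral_finite_cover_le[OF T(2) order_refl]) measurable
      also have "\<dots> \<le> ennreal (\<Sum>z\<in>T. \<bar>C z\<bar>) * ?X"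
      proof (rule sum_ennreal_mult_le[OF T(2)])
        fix z assume z: "z \<in> T"
        then have "(\<integral>\<^sup>+x\<in>\<Omega> \<inter> ball z (\<rho> z). ?u x \<partial>lborel)
            \<le> ennreal (C z) * (energy G + (\<integral>\<^sup>+x\<in>core (E z). ennreal (\<bar>f x\<bar> powr p) \<partial>lborel))"
          using T(1) ug by (intro C) auto
        also have "\<dots> \<le> ennreal (C z) * ?X"
          using \<epsilon>(3)[OF z] by (intro mult_left_mono add_left_mono nn_integral_mono) (auto simp: indicator_def)
        finally show "(\<integral>\<^sup>+x\<in>\<Omega> \<inter> ball z (\<rho> z). ?u x \<partial>lborel) \<le> ennreal (C z) * ?X" .
      qed
      finally show "(\<integral>\<^sup>+x\<in>(\<Union>z\<in>T. \<Omega> \<inter> ball z (\<rho> z)). ?u x \<partial>lborel) \<le> ennreal (\<Sum>z\<in>T. \<bar>C z\<bar>) * ?X" .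
      have "(\<integral>\<^sup>+x\<in>core \<epsilon>. ?u x \<partial>lborel) \<le> (\<integral>\<^sup>+x. ennreal H * (ennreal (\<bar>f x\<bar> powr p) * indicator (core \<epsilon>) x) \<partial>lborel)"
      proof (rule nn_integral_mono)
        fix x
        show "?u x * indicator (core \<epsilon>) x \<le> ennreal H * (ennreal (\<bar>f x\<bar> powr p) * indicator (core \<epsilon>) x)"
        proof (cases "x \<in> core \<epsilon>")
          case True
          then have "\<bar>f x\<bar> powr p * d x powr \<gamma> \<le> H * \<bar>f x\<bar> powr p"
            using H[OF True] by (subst mult.commute) (intro mult_right_mono, auto)
          then have "?u x \<le> ennreal (H * \<bar>f x\<bar> powr p)" by (rule ennreal_leI)
          also have "\<dots> = ennreal H * ennreal (\<bar>f x\<bar> powr p)"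
            by (intro ennreal_mult) (auto simp: H_def le_max_iff_disj)
          finally show ?thesis using True by simp
        qed simp
      qed
      also have "\<dots> = ennreal H * (\<integral>\<^sup>+x\<in>core \<epsilon>. ennreal (\<bar>f x\<bar> powr p) \<partial>lborel)"
        by (rule nn_integral_cmult) measurable
      also have "\<dots> \<le> ennreal H * ?X"
        by (intro mult_left_mono) auto
      finally show "(\<integral>\<^sup>+x\<in>core \<epsilon>. ?u x \<partial>lborel) \<le> ennreal H * ?X" .
    qed
    also have "\<dots> = ennreal ((\<Sum>z\<in>T. \<bar>C z\<bar>) + H) * ?X"
      by (subst ennreal_plus) (auto simp: H_def distrib_right sum_nonneg le_max_iff_disj)
    finally show ?thesis .
  qed
  then show ?thesis using \<epsilon>(1) by blast
qed

lemma holder_domain_poincare: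
  fixes \<Omega> :: "(real^'n) set" and p \<alpha> \<gamma> :: real
  assumes dom: "bounded_holder_domain \<alpha> \<Omega>" and p: "1 < p" and \<alpha>: "0 < \<alpha>" "\<alpha> \<le> 1" and \<gamma>: "- \<alpha> < \<gamma>"
  shows "(\<integral>\<^sup>+x\<in>\<Omega>. ennreal (infdist x (frontier \<Omega>) powr \<gamma>) \<partial>lborel) < \<infinity>"
    and "\<exists>C::real. \<forall>f G. upper_gradient \<Omega> f G \<longrightarrow> (\<exists>c.
      (\<integral>\<^sup>+x\<in>\<Omega>. ennreal (\<bar>f x - c\<bar> powr p * infdist x (frontier \<Omega>) powr \<gamma>) \<partial>lborel) \<le>
      ennreal C * (\<integral>\<^sup>+x\<in>\<Omega>. ennreal (G x powr p * infdist x (frontier \<Omega>) powr (\<gamma> + \<alpha> * p)) \<partial>lborel))"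
proof -
  interpret bounded_open_domain \<Omega> p "\<gamma> + \<alpha> * p"
    by unfold_locales (use dom p in \<open>auto simp: bounded_holder_domain_def\<close>)
  obtain \<epsilon> C where \<epsilon>: "0 < \<epsilon>" and C: "\<And>f G. upper_gradient \<Omega> f G \<Longrightarrow>
    (\<integral>\<^sup>+x\<in>\<Omega>. ennreal (\<bar>f x\<bar> powr p * d x powr \<gamma>) \<partial>lborel) \<le>
    ennreal C * (energy G + (\<integral>\<^sup>+x\<in>core \<epsilon>. ennreal (\<bar>f x\<bar> powr p) \<partial>lborel))"
    using holder_domain_global_estimate[OF dom p \<alpha> \<gamma>] by blast
  \<comment> \<open>Integrability of the weight is the global estimate for the constant function 1,
    whose energy vanishes and whose core term is the measure of a bounded set.\<close>
  have "upper_gradient \<Omega> (\<lambda>_. 1) (\<lambda>_. 0)" by (simp add: upper_gradient_def)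
  from C[OF this] have "(\<integral>\<^sup>+x\<in>\<Omega>. ennreal (d x powr \<gamma>) \<partial>lborel) \<le> ennreal C * emeasure lborel (core \<epsilon>)"
    using p by simp
  also have "\<dots> < \<infinity>"
    using emeasure_bounded_finite[OF compact_imp_bounded[OF compact_core[OF \<epsilon>]]]
    by (simp add: ennreal_mult_less_top)
  finally show "(\<integral>\<^sup>+x\<in>\<Omega>. ennreal (d x powr \<gamma>) \<partial>lborel) < \<infinity>" .
  obtain c C' where C': "\<And>f G. upper_gradient \<Omega> f G \<Longrightarrow>
    (\<integral>\<^sup>+x\<in>core \<epsilon>. ennreal (\<bar>f x - c f G\<bar> powr p) \<partial>lborel) \<le> ennreal C' * energy G"
    using interior_poincare \<epsilon> by blast
  have "(\<integral>\<^sup>+x\<in>\<Omega>. ennreal (\<bar>f x - c f G\<bar> powr p * d x powr \<gamma>) \<partial>lborel) \<le> ennreal (\<bar>C\<bar> * (1 + \<bar>C'\<bar>)) * energy G"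
    if ug: "upper_gradient \<Omega> f G" for f G
  proof -
    \<comment> \<open>Subtracting a constant keeps the upper gradient, so the global estimate
      applies to \<open>f - c f G\<close> and the core term is absorbed by the interior
      inequality.\<close>
    have "(\<integral>\<^sup>+x\<in>\<Omega>. ennreal (\<bar>f x - c f G\<bar> powr p * d x powr \<gamma>) \<partial>lborel)
      \<le> ennreal C * (energy G + (\<integral>\<^sup>+x\<in>core \<epsilon>. ennreal (\<bar>f x - c f G\<bar> powr p) \<partial>lborel))"
      by (rule C[OF upper_gradient_diff_const[OF ug]])
    also have "\<dots> \<le> ennreal \<bar>C\<bar> * (energy G + ennreal \<bar>C'\<bar> * energy G)"
      by (intro mult_mono add_left_mono order_trans[OF C'[OF ug]] mult_right_mono ennreal_leI) auto
    also have "\<dots> = ennreal (\<bar>C\<bar> * (1 + \<bar>C'\<bar>)) * energy G"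
      by (simp add: ennreal_mult distrib_right mult.assoc)
    finally show ?thesis .
  qed
  then show "\<exists>C::real. \<forall>f G. upper_gradient \<Omega> f G \<longrightarrow> (\<exists>c.
      (\<integral>\<^sup>+x\<in>\<Omega>. ennreal (\<bar>f x - c\<bar> powr p * d x powr \<gamma>) \<partial>lborel) \<le> ennreal C * energy G)" by blast
qed

text \<open>Takes \<open>p\<close>-th roots. Strict positivity of \<open>C\<close> makes the right
  side infinite, not 0, when the integral for \<open>g\<close> is infinite.\<close>

lemma weighted_Lp_norm_mono:
  assumes p: "0 < p" and C: "0 < C"
    and le: "(\<integral>\<^sup>+x\<in>\<Omega>. ennreal (norm (f x) powr p * \<eta> x) \<partial>lebesgue)
      \<le> ennreal C * (\<integral>\<^sup>+x\<in>\<Omega>. ennreal (norm (g x) powr p * \<zeta> x) \<partial>lebesgue)"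
  shows "weighted_Lp_norm p \<Omega> \<eta> f \<le> ennreal (C powr (1 / p)) * weighted_Lp_norm p \<Omega> \<zeta> g"
proof -
  let ?F = "\<integral>\<^sup>+x\<in>\<Omega>. ennreal (norm (f x) powr p * \<eta> x) \<partial>lebesgue"
  let ?G = "\<integral>\<^sup>+x\<in>\<Omega>. ennreal (norm (g x) powr p * \<zeta> x) \<partial>lebesgue"
  show ?thesis
  proof (cases "?G = \<infinity>")
    case True
    then have "weighted_Lp_norm p \<Omega> \<zeta> g = \<infinity>" by (simp add: weighted_Lp_norm_def)
    then show ?thesis using C by (simp add: ennreal_mult_top)
  next
    case False
    then have fin: "ennreal C * ?G < \<infinity>" by (simp add: ennreal_mult_less_top top.not_eq_extremum)
    then have F: "?F \<noteq> \<infinity>" using le by (auto simp: top_unique)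
    have "enn2real ?F \<le> enn2real (ennreal C * ?G)"
      using le fin by (intro enn2real_mono) auto
    also have "\<dots> = C * enn2real ?G" using C by (simp add: enn2real_mult)
    finally have "enn2real ?F powr (1 / p) \<le> (C * enn2real ?G) powr (1 / p)"
      using p by (intro powr_mono2) auto
    also have "\<dots> = C powr (1 / p) * enn2real ?G powr (1 / p)"
      by (rule powr_mult)
    finally show ?thesis
      using F False by (simp add: weighted_Lp_norm_def Let_def ennreal_leI flip: ennreal_mult)
  qed
qed

theorem theorem5p3:
  fixes \<Omega> :: "(real^'n) set" and p \<alpha> \<beta> :: real
  assumes "1 < p"
    and "2 \<le> CARD('n)"
    and "0 < \<alpha>" and "\<alpha> \<le> 1"
    and "bounded_holder_domain \<alpha> \<Omega>"
    and "\<beta> * p > - \<alpha>"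
  shows "\<exists>C::real. 0 < C \<and>
    (\<forall>f g. has_weak_gradient f g \<Omega> \<longrightarrow>
       f \<in> weighted_Lp p \<Omega> (dist_weight \<Omega> (\<beta> * p)) \<longrightarrow>
       (LINT x:\<Omega>|lebesgue. f x * dist_weight \<Omega> (\<beta> * p) x) = 0 \<longrightarrow>
       weighted_Lp_norm p \<Omega> (dist_weight \<Omega> (\<beta> * p)) f
         \<le> ennreal C * weighted_Lp_norm p \<Omega> (dist_weight \<Omega> ((\<beta> + \<alpha>) * p)) g)"
proof -
  define \<gamma> where "\<gamma> = \<beta> * p"
  have \<gamma>: "- \<alpha> < \<gamma>" using assms(6) by (simp add: \<gamma>_def)
  have \<delta>: "(\<beta> + \<alpha>) * p = \<gamma> + \<alpha> * p" by (simp add: \<gamma>_def distrib_right)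
  interpret bounded_open_domain \<Omega> p "\<gamma> + \<alpha> * p"
    by unfold_locales (use assms in \<open>auto simp: bounded_holder_domain_def\<close>)
  obtain C where C: "\<And>f G. upper_gradient \<Omega> f G \<Longrightarrow> \<exists>c.
      (\<integral>\<^sup>+x\<in>\<Omega>. ennreal (\<bar>f x - c\<bar> powr p * d x powr \<gamma>) \<partial>lborel) \<le> ennreal C * energy G"
    using holder_domain_poincare(2)[OF assms(5,1,3,4) \<gamma>] by blast
  \<comment> \<open>The factor \<open>2 powr p * 2\<close> is the cost of removing \<open>c\<close>;
    adding 1 makes the constant positive.\<close>
  define C' where "C' = 2 powr p * 2 * (\<bar>C\<bar> + 1)"
  have C': "0 < C'" by (simp add: C'_def)
  let ?w = "\<lambda>x. indicator \<Omega> x * d x powr \<gamma>"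
  have w: "ennreal (u * ?w x) = ennreal (u * d x powr \<gamma>) * indicator \<Omega> x" for u x
    by (simp add: indicator_def)
  have W_fin: "(\<integral>\<^sup>+x. ennreal (?w x) \<partial>lborel) < \<infinity>"
    using holder_domain_poincare(1)[OF assms(5,1,3,4) \<gamma>] w[of 1] by simp
  have W_pos: "0 < (\<integral>\<^sup>+x. ennreal (?w x) \<partial>lborel)"
  proof (rule ccontr)
    assume "\<not> ?thesis"
    then have "AE x in lborel. ennreal (?w x) = 0"
      by (subst (asm) zero_less_iff_neq_zero) (simp add: nn_integral_0_iff_AE)
    then have "AE x in lborel. x \<notin> \<Omega>"
    proof eventually_elim
      fix x assume "ennreal (?w x) = 0"
      then show "x \<notin> \<Omega>" using d_pos[of x] by (auto simp: indicator_def split: if_splits)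
    qed
    then have "emeasure lborel \<Omega> = 0"
      by (subst (asm) AE_iff_measurable[of \<Omega>]) auto
    then show False using open_not_negligible[OF open_domain nonempty]
      by (simp add: negligible_iff_emeasure0)
  qed
  have "weighted_Lp_norm p \<Omega> (dist_weight \<Omega> \<gamma>) f
      \<le> ennreal (C' powr (1 / p)) * weighted_Lp_norm p \<Omega> (dist_weight \<Omega> (\<gamma> + \<alpha> * p)) g"
    if weak: "has_weak_gradient f g \<Omega>" and Lp: "f \<in> weighted_Lp p \<Omega> (dist_weight \<Omega> \<gamma>)"
      and mean: "(LINT x:\<Omega>|lebesgue. f x * dist_weight \<Omega> \<gamma> x) = 0" for f g
  proof (rule weighted_Lp_norm_mono)
    \<comment> \<open>From here on \<open>f\<close> and the norm of \<open>g\<close> are replaced by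
      Borel functions, and the completed measure by \<open>lborel\<close>; almost everywhere
      equality on \<Omega> preserves all integrals involved.\<close>
    obtain f' G where ug: "upper_gradient \<Omega> f' G"
      and ae: "AE x in lborel. x \<in> \<Omega> \<longrightarrow> f x = f' x \<and> norm (g x) = G x"
      by (rule weak_gradient_imp_upper_gradient[OF open_domain weak])
    have [measurable]: "f' \<in> borel_measurable borel" using ug by (simp add: upper_gradient_def)
    have F: "(\<integral>\<^sup>+x\<in>\<Omega>. ennreal (norm (f x) powr p * dist_weight \<Omega> \<gamma> x) \<partial>lebesgue)
        = (\<integral>\<^sup>+x. ennreal (\<bar>f' x\<bar> powr p * ?w x) \<partial>lborel)"
      unfolding nn_integral_completion
      by (rule nn_integral_cong_AE, use ae in eventually_elim) (auto simp: dist_weight_def indicator_def)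
    have G: "(\<integral>\<^sup>+x\<in>\<Omega>. ennreal (norm (g x) powr p * dist_weight \<Omega> (\<gamma> + \<alpha> * p) x) \<partial>lebesgue) = energy G"
      unfolding nn_integral_completion
      by (rule nn_integral_cong_AE, use ae in eventually_elim) (auto simp: dist_weight_def indicator_def)
    \<comment> \<open>A finite value of \<open>weighted_Lp_norm\<close> excludes the infinite branch
      of its definition.\<close>
    have fin: "(\<integral>\<^sup>+x. ennreal (\<bar>f' x\<bar> powr p * ?w x) \<partial>lborel) < \<infinity>"
      unfolding F[symmetric] using Lp
      by (auto simp: weighted_Lp_def weighted_Lp_norm_def Let_def top.not_eq_extremum split: if_splits)
    have zero: "(\<integral>x. f' x * ?w x \<partial>lborel) = 0"
    proof -
      have m: "(\<lambda>x. f' x * ?w x) \<in> borel_measurable lborel" by measurable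
      have "(\<integral>x. f' x * ?w x \<partial>lborel) = (\<integral>x. f' x * ?w x \<partial>lebesgue)"
        by (rule integral_completion[symmetric, OF m])
      also have "\<dots> = (LINT x:\<Omega>|lebesgue. f x * dist_weight \<Omega> \<gamma> x)"
        unfolding set_lebesgue_integral_def
      proof (rule integral_cong_AE)
        show ae': "AE x in lebesgue. f' x * ?w x = indicator \<Omega> x *\<^sub>R (f x * dist_weight \<Omega> \<gamma> x)"
          using AE_completion[OF ae] by eventually_elim (auto simp: dist_weight_def indicator_def)
        show m': "(\<lambda>x. f' x * ?w x) \<in> borel_measurable lebesgue"
          by (rule measurable_completion[OF m])
        have "(\<lambda>x. indicator \<Omega> x *\<^sub>R f x) \<in> borel_measurable lebesgue"
          using weak by (intro locally_integrable_imp_measurable open_domain) (simp add: has_weak_gradient_def)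
        moreover have "(\<lambda>x. d x powr \<gamma>) \<in> borel_measurable lebesgue"
          by (rule measurable_completion) measurable
        ultimately have "(\<lambda>x. (indicator \<Omega> x *\<^sub>R f x) * d x powr \<gamma>) \<in> borel_measurable lebesgue"
          by (rule borel_measurable_times)
        then show "(\<lambda>x. indicator \<Omega> x *\<^sub>R (f x * dist_weight \<Omega> \<gamma> x)) \<in> borel_measurable lebesgue"
          by (simp add: dist_weight_def mult.assoc)
      qed
      finally show ?thesis using mean by simp
    qed
    obtain c where c: "(\<integral>\<^sup>+x\<in>\<Omega>. ennreal (\<bar>f' x - c\<bar> powr p * d x powr \<gamma>) \<partial>lborel) \<le> ennreal C * energy G"
      using C[OF ug] by blast
    have "(\<integral>\<^sup>+x. ennreal (\<bar>f' x\<bar> powr p * ?w x) \<partial>lborel)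
        \<le> ennreal (2 powr p * 2) * (\<integral>\<^sup>+x. ennreal (\<bar>f' x - c\<bar> powr p * ?w x) \<partial>lborel)"
      by (rule mean_zero_powr_le[OF assms(1) _ _ _ W_pos W_fin fin zero]) (measurable, simp_all add: open_domain)
    also have "\<dots> \<le> ennreal (2 powr p * 2) * (ennreal (\<bar>C\<bar> + 1) * energy G)"
      unfolding w by (intro mult_left_mono order_trans[OF c] mult_right_mono ennreal_leI) auto
    also have "\<dots> = ennreal C' * energy G"
      unfolding C'_def mult.assoc[symmetric] by (subst ennreal_mult[of "2 powr p * 2" "\<bar>C\<bar> + 1"]) auto
    finally show "(\<integral>\<^sup>+x\<in>\<Omega>. ennreal (norm (f x) powr p * dist_weight \<Omega> \<gamma> x) \<partial>lebesgue)
      \<le> ennreal C' * (\<integral>\<^sup>+x\<in>\<Omega>. ennreal (norm (g x) powr p * dist_weight \<Omega> (\<gamma> + \<alpha> * p) x) \<partial>lebesgue)"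
      unfolding F G .
  qed (use assms(1) C' in auto)
  moreover have "0 < C' powr (1 / p)" using C' by simp
  ultimately show ?thesis unfolding \<delta> \<gamma>_def[symmetric] by blast
qed

end
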